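(* Let $u_h:[0,\infty)\to S_h^0$ be the solution of $$(u_h''(t),\chi)+\alpha(u_h'(t),\chi)+a(u_h(t),\chi)=0\quad\text{for all }\chi\in S_h^0,\ t>0,\qquad u_h(0)=u_{0,h},\ u_h'(0)=u_{1,h},$$ with $u_{0,h},u_{1,h}\in S_h^0$. Define $$\mathcal{E}_{A_h}^{(1)}(u_h)(t)=\tfrac12\left(\|A^{1/2}u_h'(t)\|^2+\|A_hu_h(t)\|^2\right).$$ Then for every $\delta$ with $0<\delta\le \frac13\min\left(\alpha,\frac{\lambda_1}{2\alpha}\right)$, $$\mathcal{E}_{A_h}^{(1)}(u_h)(t)\le 3\,e^{-2\delta t}\,\mathcal{E}_{A_h}^{(1)}(u_h)(0),\qquad t\ge0.$$
   Context: $\Omega\subset\mathbb{R}^d$ is a convex polygonal or polyhedral domain and $\alpha>0$ is a fixed constant. $\mathbf{A}(x)$ is a real symmetric, uniformly positive definite matrix and $a_0(x)\ge 0$, with smooth coefficients. $(\cdot,\cdot)$ and $\|\cdot\|$ are the inner product and norm of $L^2(\Omega)$, and $\|\cdot\|_k$ is the norm of $H^k(\Omega)$. $a(v,w)=(\mathbf{A}\nabla v,\nabla w)+(a_0v,w)=(A^{1/2}v,A^{1/2}w)$ on $H^1_0(\Omega)$, where $A\phi=-\nabla\cdot(\mathbf{A}\nabla\phi)+a_0\phi$ with domain $H^2(\Omega)\cap H_0^1(\Omega)$, and $\lambda_1>0$ is the principal (smallest) eigenvalue of $A$. $\{S_h^0\}_{h>0}$ is a family of finite-dimensional subspaces of $H_0^1(\Omega)$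 with the approximation property $\inf_{\chi\in S_h^0}(\|v-\chi\|+h\|v-\chi\|_1)\le Ch^r\|v\|_r$ for $v\in H^r(\Omega)\cap H_0^1(\Omega)$, for a fixed integer $r\ge2$ and a constant $C$ independent of $h$ and $v$. $A_h:S_h^0\to S_h^0$ is defined by $(A_hv_h,\chi)=a(v_h,\chi)$ for all $v_h,\chi\in S_h^0$, so that $\|A^{1/2}v_h\|^2=a(v_h,v_h)=\|A_h^{1/2}v_h\|^2$ for $v_h\in S_h^0$. *)

theory Defs
  imports "HOL-Analysis.Analysis"
begin

section \<open>The Hilbert space of square-integrable functions modulo null sets\<close>

text \<open>Borel representatives suffice: every Lebesgue measurable function agrees almost everywhere
  with a Borel measurable one.\<close>

definition square_integrable :: "(real^'n \<Rightarrow> real) \<Rightarrow> bool" where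
  "square_integrable f \<longleftrightarrow> f \<in> borel_measurable lborel \<and> integrable lborel (\<lambda>x. (f x)\<^sup>2)"

definition l2rel :: "(real^'n \<Rightarrow> real) \<Rightarrow> (real^'n \<Rightarrow> real) \<Rightarrow> bool" where
  "l2rel f g \<longleftrightarrow> square_integrable f \<and> square_integrable g \<and> (AE x in lborel. f x = g x)"

lemma square_integrable_0: "square_integrable (\<lambda>_. 0)"
  by (simp add: square_integrable_def)

lemma integrable_mult_square_integrable:
  assumes "square_integrable f" "square_integrable g"
  shows "integrable lborel (\<lambda>x. f x * g x)"
proof (rule Bochner_Integration.integrable_bound)
  show "integrable lborel (\<lambda>x. (f x)\<^sup>2 + (g x)\<^sup>2)"
    using assms by (auto simp: square_integrable_def)
  show "(\<lambda>x. f x * g x) \<in> borel_measurable lborel"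
    using assms by (auto simp: square_integrable_def)
  have "\<bar>a * b\<bar> \<le> a\<^sup>2 + b\<^sup>2" for a b :: real
  proof -
    have "0 \<le> (\<bar>a\<bar> - \<bar>b\<bar>)\<^sup>2" by simp
    then have "2 * (\<bar>a\<bar> * \<bar>b\<bar>) \<le> a\<^sup>2 + b\<^sup>2" by (simp add: power2_diff)
    moreover have "0 \<le> \<bar>a\<bar> * \<bar>b\<bar>" by simp
    ultimately show ?thesis unfolding abs_mult by linarith
  qed
  then show "AE x in lborel. norm (f x * g x) \<le> norm ((f x)\<^sup>2 + (g x)\<^sup>2)"
    by simp
qed

lemma square_integrable_add:
  assumes "square_integrable f" "square_integrable g"
  shows "square_integrable (\<lambda>x. f x + g x)"
proof -
  have "integrable lborel (\<lambda>x. (f x)\<^sup>2 + (g x)\<^sup>2 + 2 * (f x * g x))"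
    using assms integrable_mult_square_integrable[OF assms]
    by (auto simp: square_integrable_def)
  then have "integrable lborel (\<lambda>x. (f x + g x)\<^sup>2)"
    by (simp add: power2_sum algebra_simps)
  then show ?thesis
    using assms by (auto simp: square_integrable_def)
qed

lemma square_integrable_scale:
  assumes "square_integrable f"
  shows "square_integrable (\<lambda>x. c * f x)"
  using assms by (auto simp: square_integrable_def power_mult_distrib)

lemma part_equivp_l2rel: "part_equivp l2rel"
proof (rule part_equivpI)
  show "\<exists>f. l2rel f f"
    using square_integrable_0 by (auto simp: l2rel_def)
  show "symp l2rel"
    by (auto simp: symp_def l2rel_def elim: AE_mp)
  show "transp l2rel"
    unfolding transp_def l2rel_def by auto
qed

quotient_type 'n l2 = "real^'n \<Rightarrow> real" / partial: l2rel
  by (rule part_equivp_l2rel)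

instantiation l2 :: (finite) real_vector
begin

lift_definition zero_l2 :: "'a l2" is "\<lambda>_. 0"
  by (simp add: l2rel_def square_integrable_0)

lift_definition plus_l2 :: "'a l2 \<Rightarrow> 'a l2 \<Rightarrow> 'a l2" is "\<lambda>f g x. f x + g x"
  unfolding l2rel_def by (auto intro: square_integrable_add)

lift_definition scaleR_l2 :: "real \<Rightarrow> 'a l2 \<Rightarrow> 'a l2" is "\<lambda>c f x. c * f x"
  unfolding l2rel_def by (auto intro: square_integrable_scale)

lift_definition uminus_l2 :: "'a l2 \<Rightarrow> 'a l2" is "\<lambda>f x. - f x"
  unfolding l2rel_def by (auto simp: square_integrable_def)

definition minus_l2 :: "'a l2 \<Rightarrow> 'a l2 \<Rightarrow> 'a l2" where
  "minus_l2 v w = v + - w"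

instance
proof
  fix u v w :: "'a l2" and c d :: real
  show "u + v + w = u + (v + w)"
    by transfer (auto simp: l2rel_def add.assoc intro!: square_integrable_add)
  show "u + v = v + u"
    by transfer (auto simp: l2rel_def add.commute intro!: square_integrable_add)
  show "0 + u = u"
    by transfer (auto simp: l2rel_def)
  show "- u + u = 0"
    by transfer (auto simp: l2rel_def square_integrable_0)
  show "u - v = u + - v"
    by (simp add: minus_l2_def)
  show "c *\<^sub>R (u + v) = c *\<^sub>R u + c *\<^sub>R v"
    by transfer (auto simp: l2rel_def distrib_left
        intro!: square_integrable_add square_integrable_scale)
  show "(c + d) *\<^sub>R u = c *\<^sub>R u + d *\<^sub>R u"
    by transfer (auto simp: l2rel_def distrib_right
        intro!: square_integrable_add square_integrable_scale)
  show "c *\<^sub>R d *\<^sub>R u = (c * d) *\<^sub>R u"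
    by transfer (auto simp: l2rel_def mult.assoc intro!: square_integrable_scale)
  show "1 *\<^sub>R u = u"
    by transfer (auto simp: l2rel_def)
qed

end

instantiation l2 :: (finite) real_inner
begin

lift_definition inner_l2 :: "'a l2 \<Rightarrow> 'a l2 \<Rightarrow> real" is
  "\<lambda>f g. LINT x|lborel. f x * g x"
proof -
  fix f f' g g' :: "real^'a \<Rightarrow> real"
  assume f: "l2rel f f'" and g: "l2rel g g'"
  show "(LINT x|lborel. f x * g x) = (LINT x|lborel. f' x * g' x)"
  proof (rule integral_cong_AE)
    show "(\<lambda>x. f x * g x) \<in> borel_measurable lborel" "(\<lambda>x. f' x * g' x) \<in> borel_measurable lborel"
      using f g by (auto simp: l2rel_def square_integrable_def)
    show "AE x in lborel. f x * g x = f' x * g' x"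
      using f g by (auto simp: l2rel_def)
  qed
qed

definition norm_l2 :: "'a l2 \<Rightarrow> real" where
  "norm_l2 v = sqrt (v \<bullet> v)"

definition dist_l2 :: "'a l2 \<Rightarrow> 'a l2 \<Rightarrow> real" where
  "dist_l2 v w = norm (v - w)"

definition sgn_l2 :: "'a l2 \<Rightarrow> 'a l2" where
  "sgn_l2 v = v /\<^sub>R norm v"

definition uniformity_l2 :: "('a l2 \<times> 'a l2) filter" where
  "uniformity_l2 = (INF e\<in>{0 <..}. principal {(v, w). dist v w < e})"

definition open_l2 :: "'a l2 set \<Rightarrow> bool" where
  "open_l2 U = (\<forall>v\<in>U. eventually (\<lambda>(v', w). v' = v \<longrightarrow> w \<in> U) uniformity)"

instance
proof
  fix u v w :: "'a l2" and c :: real and U :: "'a l2 set"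
  show "dist u v = norm (u - v)" by (simp add: dist_l2_def)
  show "sgn u = u /\<^sub>R norm u" by (simp add: sgn_l2_def)
  show "uniformity = (INF e\<in>{0 <..}. principal {(v, w). dist v w < (e::real)} ::
      ('a l2 \<times> 'a l2) filter)"
    by (simp add: uniformity_l2_def)
  show "open U = (\<forall>v\<in>U. \<forall>\<^sub>F (v', w) in uniformity. v' = v \<longrightarrow> w \<in> U)"
    by (simp add: open_l2_def)
  show "norm u = sqrt (u \<bullet> u)" by (simp add: norm_l2_def)
  show "u \<bullet> v = v \<bullet> u"
    by transfer (simp add: mult.commute)
  show "(u + v) \<bullet> w = u \<bullet> w + v \<bullet> w"
    by transfer (simp add: l2rel_def distrib_right integrable_mult_square_integrable)
  show "c *\<^sub>R u \<bullet> v = c * (u \<bullet> v)"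
    by transfer (simp add: mult.assoc)
  show "0 \<le> u \<bullet> u"
    by transfer simp
  show "u \<bullet> u = 0 \<longleftrightarrow> u = 0"
  proof transfer
    fix f :: "real^'a \<Rightarrow> real"
    assume "l2rel f f"
    then have f: "square_integrable f" by (simp add: l2rel_def)
    have "(LINT x|lborel. f x * f x) = 0 \<longleftrightarrow> (AE x in lborel. f x * f x = 0)"
      by (rule integral_nonneg_eq_0_iff_AE)
        (simp_all add: integrable_mult_square_integrable[OF f f])
    then show "(LINT x|lborel. f x * f x) = 0 \<longleftrightarrow> l2rel f (\<lambda>_. 0)"
      using f by (simp add: l2rel_def square_integrable_0)
  qed
qed

end

text \<open>\<open>of_fun f\<close> is the class of a square-integrable \<open>f\<close>; \<open>fun_of v\<close> is an arbitrary
  representative of \<open>v\<close>, so only its values up to null sets are meaningful.\<close>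

abbreviation of_fun :: "(real^'n \<Rightarrow> real) \<Rightarrow> 'n l2" where "of_fun \<equiv> abs_l2"
abbreviation fun_of :: "'n l2 \<Rightarrow> real^'n \<Rightarrow> real" where "fun_of \<equiv> rep_l2"

lemma square_integrable_fun_of: "square_integrable (fun_of v)"
  using Quotient_rep_reflp[OF Quotient_l2, of v] by (simp add: l2rel_def)

lemma fun_of_of_fun: "square_integrable f \<Longrightarrow> AE x in lborel. fun_of (of_fun f) x = f x"
  using Quotient_rep_abs[OF Quotient_l2, of f] by (simp add: l2rel_def)

lemma of_fun_fun_of: "of_fun (fun_of v) = v"
  using Quotient_abs_rep[OF Quotient_l2] .

lemma inner_l2_fun_of: "v \<bullet> w = (LINT x|lborel. fun_of v x * fun_of w x)"
  by (simp add: inner_l2_def)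

text \<open>The space over a domain is realised inside the space over \<^term>\<open>UNIV\<close> by extension by zero.\<close>

definition L2 :: "(real^'n) set \<Rightarrow> ('n::finite) l2 set" where
  "L2 \<Omega> = {v. AE x in lborel. x \<notin> \<Omega> \<longrightarrow> fun_of v x = 0}"


section \<open>Smooth functions, weak derivatives, Sobolev spaces\<close>

definition partial :: "'n \<Rightarrow> (real^'n \<Rightarrow> real) \<Rightarrow> real^'n \<Rightarrow> real" where
  "partial i f x = frechet_derivative f (at x) (axis i 1)"

primrec partials :: "'n list \<Rightarrow> (real^'n \<Rightarrow> real) \<Rightarrow> real^'n \<Rightarrow> real" where
  "partials [] f = f"
| "partials (i # is) f = partial i (partials is f)"

definition smooth_on :: "(real^'n) set \<Rightarrow> (real^'n \<Rightarrow> real) \<Rightarrow> bool" where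
  "smooth_on U f \<longleftrightarrow> open U \<and> (\<forall>is. \<forall>x\<in>U. partials is f differentiable (at x))"

definition test_functions :: "(real^'n) set \<Rightarrow> (real^'n \<Rightarrow> real) set" where
  "test_functions \<Omega> = {\<phi>. smooth_on UNIV \<phi> \<and> compact (closure {x. \<phi> x \<noteq> 0})
      \<and> closure {x. \<phi> x \<noteq> 0} \<subseteq> \<Omega>}"

text \<open>A multi-index is a function \<open>\<beta> :: 'n \<Rightarrow> nat\<close>. The list \<open>is\<close> below enumerates the
  differentiations prescribed by \<open>\<beta>\<close>; their order is irrelevant for a test function.\<close>

definition multi_order :: "('n::finite \<Rightarrow> nat) \<Rightarrow> nat" where
  "multi_order \<beta> = (\<Sum>i\<in>UNIV. \<beta> i)"

definition has_weak_derivative ::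
  "(real^'n) set \<Rightarrow> ('n::finite \<Rightarrow> nat) \<Rightarrow> 'n l2 \<Rightarrow> 'n l2 \<Rightarrow> bool" where
  "has_weak_derivative \<Omega> \<beta> v g \<longleftrightarrow> g \<in> L2 \<Omega> \<and>
     (\<forall>\<phi>\<in>test_functions \<Omega>. \<forall>is. (\<forall>i. count_list is i = \<beta> i) \<longrightarrow>
        (LINT x|lborel. fun_of v x * partials is \<phi> x)
          = (-1) ^ multi_order \<beta> * (LINT x|lborel. fun_of g x * \<phi> x))"

definition weak_derivative :: "(real^'n) set \<Rightarrow> ('n::finite \<Rightarrow> nat) \<Rightarrow> 'n l2 \<Rightarrow> 'n l2" where
  "weak_derivative \<Omega> \<beta> v = (THE g. has_weak_derivative \<Omega> \<beta> v g)"

definition weak_partial :: "(real^'n) set \<Rightarrow> 'n \<Rightarrow> ('n::finite) l2 \<Rightarrow> 'n l2" where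
  "weak_partial \<Omega> i = weak_derivative \<Omega> (\<lambda>j. if j = i then 1 else 0)"

definition weak_grad :: "(real^'n) set \<Rightarrow> ('n::finite) l2 \<Rightarrow> real^'n \<Rightarrow> real^'n" where
  "weak_grad \<Omega> v x = (\<chi> i. fun_of (weak_partial \<Omega> i v) x)"

definition sobolev :: "(real^'n) set \<Rightarrow> nat \<Rightarrow> ('n::finite) l2 set" where
  "sobolev \<Omega> k = {v \<in> L2 \<Omega>. \<forall>\<beta>. multi_order \<beta> \<le> k \<longrightarrow> (\<exists>g. has_weak_derivative \<Omega> \<beta> v g)}"

definition sobolev_norm :: "(real^'n) set \<Rightarrow> nat \<Rightarrow> ('n::finite) l2 \<Rightarrow> real" where
  "sobolev_norm \<Omega> k v = sqrt (\<Sum>\<beta> | multi_order \<beta> \<le> k. (norm (weak_derivative \<Omega> \<beta> v))\<^sup>2)"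

definition H10 :: "(real^'n) set \<Rightarrow> ('n::finite) l2 set" where
  "H10 \<Omega> = {v \<in> sobolev \<Omega> 1. \<forall>e>0. \<exists>\<phi>\<in>test_functions \<Omega>. sobolev_norm \<Omega> 1 (v - of_fun \<phi>) < e}"


section \<open>The elliptic operator\<close>

definition convex_polyhedral_domain :: "(real^'n) set \<Rightarrow> bool" where
  "convex_polyhedral_domain \<Omega> \<longleftrightarrow> \<Omega> \<noteq> {} \<and> (\<exists>P. polytope P \<and> \<Omega> = interior P)"

text \<open>Smooth coefficients are smooth up to the boundary, i.e. on a neighbourhood of the closure.\<close>

definition elliptic_coefficients ::
  "(real^'n) set \<Rightarrow> (real^'n \<Rightarrow> real^'n^'n) \<Rightarrow> (real^'n \<Rightarrow> real) \<Rightarrow> bool" where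
  "elliptic_coefficients \<Omega> \<A> a0 \<longleftrightarrow>
     (\<exists>U. closure \<Omega> \<subseteq> U \<and> (\<forall>i j. smooth_on U (\<lambda>x. \<A> x $ i $ j)) \<and> smooth_on U a0) \<and>
     (\<forall>x\<in>\<Omega>. transpose (\<A> x) = \<A> x) \<and>
     (\<exists>c>0. \<forall>x\<in>\<Omega>. \<forall>\<xi>. c * (norm \<xi>)\<^sup>2 \<le> (\<A> x *v \<xi>) \<bullet> \<xi>) \<and>
     (\<forall>x\<in>\<Omega>. 0 \<le> a0 x)"

definition energy_form ::
  "(real^'n) set \<Rightarrow> (real^'n \<Rightarrow> real^'n^'n) \<Rightarrow> (real^'n \<Rightarrow> real) \<Rightarrow>
    ('n::finite) l2 \<Rightarrow> 'n l2 \<Rightarrow> real" where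
  "energy_form \<Omega> \<A> a0 v w =
     (LINT x:\<Omega>|lborel. (\<A> x *v weak_grad \<Omega> v x) \<bullet> weak_grad \<Omega> w x) +
     (LINT x:\<Omega>|lborel. a0 x * fun_of v x * fun_of w x)"

definition elliptic_domain :: "(real^'n) set \<Rightarrow> ('n::finite) l2 set" where
  "elliptic_domain \<Omega> = sobolev \<Omega> 2 \<inter> H10 \<Omega>"

definition elliptic_op ::
  "(real^'n) set \<Rightarrow> (real^'n \<Rightarrow> real^'n^'n) \<Rightarrow> (real^'n \<Rightarrow> real) \<Rightarrow> ('n::finite) l2 \<Rightarrow> 'n l2" where
  "elliptic_op \<Omega> \<A> a0 v =
     - (\<Sum>i\<in>UNIV. weak_partial \<Omega> i
          (of_fun (\<lambda>x. indicator \<Omega> x * (\<A> x *v weak_grad \<Omega> v x) $ i)))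
     + of_fun (\<lambda>x. indicator \<Omega> x * (a0 x * fun_of v x))"

text \<open>The operator is symmetric, so only real eigenvalues are relevant.\<close>

definition elliptic_eigenvalue ::
  "(real^'n) set \<Rightarrow> (real^'n \<Rightarrow> real^'n^'n) \<Rightarrow> (real^'n::finite \<Rightarrow> real) \<Rightarrow> real \<Rightarrow> bool" where
  "elliptic_eigenvalue \<Omega> \<A> a0 \<mu> \<longleftrightarrow>
     (\<exists>\<phi>\<in>elliptic_domain \<Omega>. \<phi> \<noteq> 0 \<and> elliptic_op \<Omega> \<A> a0 \<phi> = \<mu> *\<^sub>R \<phi>)"

definition principal_eigenvalue ::
  "(real^'n) set \<Rightarrow> (real^'n \<Rightarrow> real^'n^'n) \<Rightarrow> (real^'n::finite \<Rightarrow> real) \<Rightarrow> real \<Rightarrow> bool" where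
  "principal_eigenvalue \<Omega> \<A> a0 \<mu> \<longleftrightarrow>
     elliptic_eigenvalue \<Omega> \<A> a0 \<mu> \<and> (\<forall>\<nu>. elliptic_eigenvalue \<Omega> \<A> a0 \<nu> \<longrightarrow> \<mu> \<le> \<nu>)"


section \<open>Self-adjoint operators and square roots\<close>

text \<open>An unbounded operator in the closed subspace \<open>H\<close> is given by its domain \<open>D\<close> and a function
  \<open>T\<close> that is meaningful on \<open>D\<close> only.\<close>

definition self_adjoint_op :: "'a::real_inner set \<Rightarrow> 'a set \<Rightarrow> ('a \<Rightarrow> 'a) \<Rightarrow> bool" where
  "self_adjoint_op H D T \<longleftrightarrow>
     subspace D \<and> D \<subseteq> H \<and> H \<subseteq> closure D \<and> T ` D \<subseteq> H \<and>
     (\<forall>v\<in>D. \<forall>w\<in>D. T (v + w) = T v + T w) \<and> (\<forall>v\<in>D. \<forall>c. T (c *\<^sub>R v) = c *\<^sub>R T v) \<and>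
     (\<forall>v\<in>D. \<forall>w\<in>D. T v \<bullet> w = v \<bullet> T w) \<and>
     (\<forall>y\<in>H. (\<exists>z\<in>H. \<forall>v\<in>D. T v \<bullet> y = v \<bullet> z) \<longrightarrow> y \<in> D)"

text \<open>\<open>R\<close> with domain \<open>DR\<close> is the nonnegative self-adjoint square root of \<open>T\<close> with domain \<open>D\<close>;
  the equation for \<open>D\<close> says that \<open>R \<circ> R\<close> has the same domain as \<open>T\<close>.\<close>

definition positive_sqrt_op ::
  "'a::real_inner set \<Rightarrow> 'a set \<Rightarrow> ('a \<Rightarrow> 'a) \<Rightarrow> 'a set \<Rightarrow> ('a \<Rightarrow> 'a) \<Rightarrow> bool" where
  "positive_sqrt_op H D T DR R \<longleftrightarrow>
     self_adjoint_op H DR R \<and> (\<forall>v\<in>DR. 0 \<le> R v \<bullet> v) \<and>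
     D = {v \<in> DR. R v \<in> DR} \<and> (\<forall>v\<in>D. R (R v) = T v)"


section \<open>The semidiscrete problem\<close>

definition approximating_family :: "(real^'n) set \<Rightarrow> nat \<Rightarrow> (real \<Rightarrow> ('n::finite) l2 set) \<Rightarrow> bool" where
  "approximating_family \<Omega> r S \<longleftrightarrow>
     (\<forall>h>0. subspace (S h) \<and> (\<exists>b. finite b \<and> S h = span b) \<and> S h \<subseteq> H10 \<Omega>) \<and>
     (\<exists>C. \<forall>h>0. \<forall>v\<in>sobolev \<Omega> r \<inter> H10 \<Omega>.
        (INF \<psi>\<in>S h. norm (v - \<psi>) + h * sobolev_norm \<Omega> 1 (v - \<psi>)) \<le> C * h ^ r * sobolev_norm \<Omega> r v)"

definition discrete_op ::
  "(real^'n) set \<Rightarrow> (real^'n \<Rightarrow> real^'n^'n) \<Rightarrow> (real^'n \<Rightarrow> real) \<Rightarrow>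
    ('n::finite) l2 set \<Rightarrow> 'n l2 \<Rightarrow> 'n l2" where
  "discrete_op \<Omega> \<A> a0 V v = (THE w. w \<in> V \<and> (\<forall>\<psi>\<in>V. w \<bullet> \<psi> = energy_form \<Omega> \<A> a0 v \<psi>))"

text \<open>Classical solution: once continuously differentiable on \<open>[0, \<infinity>)\<close> and twice differentiable on
  \<open>(0, \<infinity>)\<close>. Here \<open>u'\<close> and \<open>u''\<close> are the first and second time derivatives of \<open>u\<close>.\<close>

definition semidiscrete_solution ::
  "(real^'n) set \<Rightarrow> (real^'n \<Rightarrow> real^'n^'n) \<Rightarrow> (real^'n \<Rightarrow> real) \<Rightarrow> real \<Rightarrow> ('n::finite) l2 set \<Rightarrow>
    'n l2 \<Rightarrow> 'n l2 \<Rightarrow> (real \<Rightarrow> 'n l2) \<Rightarrow> (real \<Rightarrow> 'n l2) \<Rightarrow> (real \<Rightarrow> 'n l2) \<Rightarrow> bool" where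
  "semidiscrete_solution \<Omega> \<A> a0 \<alpha> V u0 u1 u u' u'' \<longleftrightarrow>
     (\<forall>t\<ge>0. u t \<in> V) \<and>
     (\<forall>t\<ge>0. (u has_vector_derivative u' t) (at t within {0..})) \<and>
     continuous_on {0..} u' \<and>
     (\<forall>t>0. (u' has_vector_derivative u'' t) (at t)) \<and>
     (\<forall>t>0. \<forall>\<psi>\<in>V. u'' t \<bullet> \<psi> + \<alpha> * (u' t \<bullet> \<psi>) + energy_form \<Omega> \<A> a0 (u t) \<psi> = 0) \<and>
     u 0 = u0 \<and> u' 0 = u1"

text \<open>Here \<open>R\<close> stands for the square root of the elliptic operator and \<open>Ah\<close> for the discrete
  operator.\<close>

definition energy1 ::
  "('a::real_inner \<Rightarrow> 'a) \<Rightarrow> ('a \<Rightarrow> 'a) \<Rightarrow> (real \<Rightarrow> 'a) \<Rightarrow> (real \<Rightarrow> 'a) \<Rightarrow> real \<Rightarrow> real" where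
  "energy1 R Ah u u' t = 1 / 2 * ((norm (R (u' t)))\<^sup>2 + (norm (Ah (u t)))\<^sup>2)"

end

theory Submission
  imports Defs
begin

text \<open>On the finite-dimensional space \<open>S h\<close> the equation reads \<open>u'' + \<alpha> u' + B u = 0\<close> with \<open>B\<close> the discrete
  operator. Substituting \<open>u = e\<^sup>-\<^sup>\<delta>\<^sup>t w\<close> again gives a damped wave equation, with damping \<open>\<alpha> - 2 \<delta> \<ge> 0\<close>, so
  the energy of \<open>w\<close> in the inner product induced by \<open>B\<close> decreases; for small \<open>\<delta>\<close> it is comparable with
  \<open>e\<^sup>2\<^sup>\<delta>\<^sup>t\<close> times the energy of \<open>u\<close>, provided that \<open>B \<ge> \<lambda>\<^sub>1\<close>.

  The bound \<open>B \<ge> \<lambda>\<^sub>1\<close> says that the Rayleigh quotient on \<open>H10 \<Omega>\<close> is at least the smallest eigenvalue,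
  that is, that its infimum is attained. A minimizing sequence has a convergent subsequence because,
  modulo finitely many linear functionals (averages over the cells of a fine grid), the \<open>L\<^sup>2\<close> norm is
  bounded by a small multiple of the norm of the gradient. The minimizer lies in the domain of the
  elliptic operator because the square root is self-adjoint, so no elliptic regularity is
  involved.\<close>

section \<open>Minimizing the Rayleigh quotient of a self-adjoint operator\<close>

text \<open>The number \<open>lam1\<close> is a minimum over eigenfunctions in the domain of the
  elliptic operator, whereas the discrete space lies only in \<open>H10 \<Omega>\<close>. A lower
  bound for the form on this larger space can therefore not be read off from \<open>lam1\<close>: an
  eigenfunction that realizes the infimum has to be produced. The averaging inequality used for this
  is obtained for continuously differentiable functions, whose mean square variation over a cell is
  controlled by translations, and reaches \<open>H10 \<Omega>\<close> by approximation. As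
  \<open>weak_derivative\<close> is a definite description, that passage needs uniqueness of weak
  derivatives, hence enough test functions, hence explicit smooth bumps. On the side of the decay
  estimate, \<open>3 * \<delta> \<le> \<alpha>\<close> keeps the damping of \<open>w\<close>
  positive, \<open>6 * (\<delta> * \<alpha>) \<le> lam1\<close> bounds the lower-order term by a
  sixth of the energy, and both together bound the cross term by a quarter. This gives the factors
  \<open>7 / 12\<close> and \<open>5 / 4\<close>, with quotient \<open>15 / 7 < 3\<close>.\<close>

lemma inner_eq_on_dense_imp_eq:
  fixes a b :: "'a::real_inner"
  assumes "a \<in> closure D" "b \<in> closure D" "\<And>w. w \<in> D \<Longrightarrow> w \<bullet> a = w \<bullet> b"
  shows "a = b"
proof -
  have "D \<subseteq> {w. w \<bullet> (a - b) = 0}" using assms(3) by (auto simp: inner_diff_right)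
  moreover have "closed {w. w \<bullet> (a - b) = 0}"
    by (intro closed_Collect_eq continuous_intros)
  ultimately have "closure D \<subseteq> {w. w \<bullet> (a - b) = 0}" by (rule closure_minimal)
  with assms(1,2) have "a \<bullet> (a - b) = 0" "b \<bullet> (a - b) = 0" by blast+
  then have "(a - b) \<bullet> (a - b) = 0" unfolding inner_diff_left[of a b] by simp
  then show ?thesis by simp
qed

text \<open>An adjoint is closed: passing to the limit in
  \<open>R w \<bullet> v k = w \<bullet> R (v k)\<close> yields exactly the premise of the
  maximality clause in \<open>self_adjoint_op\<close>. This acts as completeness of the form domain
  in the graph norm.\<close>

lemma self_adjoint_op_closed:
  assumes sa: "self_adjoint_op H D R"
    and v: "\<And>k. v k \<in> D" "v \<longlonglongrightarrow> x" "(\<lambda>k. R (v k)) \<longlonglongrightarrow> z" and H: "x \<in> H" "z \<in> H"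
  shows "x \<in> D" "R x = z"
proof -
  have sub: "subspace D" "H \<subseteq> closure D" and sym: "\<And>v w. v \<in> D \<Longrightarrow> w \<in> D \<Longrightarrow> R v \<bullet> w = v \<bullet> R w"
    and mx: "\<And>y z. y \<in> H \<Longrightarrow> z \<in> H \<Longrightarrow> (\<And>v. v \<in> D \<Longrightarrow> R v \<bullet> y = v \<bullet> z) \<Longrightarrow> y \<in> D"
    and RH: "R ` D \<subseteq> H"
    using sa unfolding self_adjoint_op_def by blast+
  have eq: "R w \<bullet> x = w \<bullet> z" if w: "w \<in> D" for w
  proof -
    have "(\<lambda>k. R w \<bullet> v k) \<longlonglongrightarrow> R w \<bullet> x" by (intro tendsto_intros v)
    moreover have "(\<lambda>k. R w \<bullet> v k) \<longlonglongrightarrow> w \<bullet> z"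
      unfolding sym[OF w v(1)] by (intro tendsto_intros v)
    ultimately show ?thesis by (rule LIMSEQ_unique)
  qed
  show xD: "x \<in> D" using mx[OF H eq] .
  show "R x = z"
    using RH sub(2) xD H(2) eq sym[OF _ xD] by (intro inner_eq_on_dense_imp_eq[of _ D]) auto
qed

text \<open>Bolzano-Weierstrass, applied once for each functional; later passages to subsequences do
  not disturb the limits already secured.\<close>

lemma finite_inner_convergent_subsequence:
  fixes v :: "nat \<Rightarrow> 'a::real_inner"
  assumes "finite G" "bounded (range v)"
  shows "\<exists>r. strict_mono (r :: nat \<Rightarrow> nat) \<and> (\<forall>g\<in>G. convergent (\<lambda>k. v (r k) \<bullet> g))"
  using assms(1)
proof (induction G)
  case empty
  show ?case by (rule exI[of _ id]) (simp add: strict_mono_def)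
next
  case (insert g G)
  then obtain r where r: "strict_mono (r :: nat \<Rightarrow> nat)" "\<And>g. g \<in> G \<Longrightarrow> convergent (\<lambda>k. v (r k) \<bullet> g)"
    by blast
  obtain M where M: "\<And>k. norm (v k) \<le> M" using assms(2) by (auto simp: bounded_iff)
  have "bounded (range (\<lambda>k. v (r k) \<bullet> g))"
    unfolding bounded_iff
  proof (intro exI ballI)
    fix y assume "y \<in> range (\<lambda>k. v (r k) \<bullet> g)"
    then obtain k where "y = v (r k) \<bullet> g" by auto
    then have "norm y \<le> norm (v (r k)) * norm g" using Cauchy_Schwarz_ineq2 by auto
    also have "\<dots> \<le> M * norm g" by (intro mult_right_mono M) simp
    finally show "norm y \<le> M * norm g" .
  qed
  then obtain l s where s: "strict_mono (s :: nat \<Rightarrow> nat)" "((\<lambda>k. v (r k) \<bullet> g) \<circ> s) \<longlonglongrightarrow> l"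
    using bounded_imp_convergent_subsequence by blast
  have "convergent (\<lambda>k. v ((r \<circ> s) k) \<bullet> g')" if "g' \<in> insert g G" for g'
  proof (cases "g' = g")
    case True
    then show ?thesis using s(2) by (auto simp: o_def convergent_def)
  next
    case False
    then have "convergent ((\<lambda>k. v (r k) \<bullet> g') \<circ> s)"
      using that r(2) s(1) by (intro convergent_subseq_convergent) auto
    then show ?thesis by (simp add: o_def)
  qed
  then show ?case using strict_mono_o[OF r(1) s(1)] by blast
qed

lemma Cauchy_if_dist_square_le:
  fixes x :: "nat \<Rightarrow> 'a::real_normed_vector"
  assumes "\<And>k l. (norm (x k - x l))\<^sup>2 \<le> b k + b l" "b \<longlonglongrightarrow> 0"
  shows "Cauchy x"
proof (rule metric_CauchyI)
  fix e :: real assume "0 < e"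
  then have "0 < e\<^sup>2 / 2" by simp
  from order_tendstoD(2)[OF assms(2) this] obtain N where N: "\<And>n. n \<ge> N \<Longrightarrow> b n < e\<^sup>2 / 2"
    by (auto simp: eventually_sequentially)
  have "dist (x m) (x n) < e" if "m \<ge> N" "n \<ge> N" for m n
  proof -
    have "(norm (x m - x n))\<^sup>2 < e\<^sup>2"
      using assms(1)[of m n] N[OF that(1)] N[OF that(2)] by linarith
    then show ?thesis using \<open>0 < e\<close> by (simp add: dist_norm power_less_imp_less_base)
  qed
  then show "\<exists>M. \<forall>m\<ge>M. \<forall>n\<ge>M. dist (x m) (x n) < e" by blast
qed

text \<open>The first variation at a minimum: a nonzero linear coefficient would beat the quadratic
  term for a small step of the right sign.\<close>

lemma nonneg_quadratic_linear_coeff_zero: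
  fixes b c :: real
  assumes "\<And>t. 0 \<le> 2 * t * b + t\<^sup>2 * c"
  shows "b = 0"
proof (rule ccontr)
  assume b: "b \<noteq> 0"
  \<comment> \<open>With \<open>\<bar>c\<bar> + 1\<close> in the denominator the quadratic term is
    at most \<open>- s * b\<close>, half of what the linear term \<open>2 * s * b\<close> takes
    away, for every sign of \<open>c\<close>.\<close>
  define s where "s = - b / (\<bar>c\<bar> + 1)"
  have "s\<^sup>2 * c \<le> s\<^sup>2 * (\<bar>c\<bar> + 1)" by (intro mult_left_mono) auto
  also have "\<dots> = - s * b" by (simp add: s_def power2_eq_square)
  finally have "0 \<le> s * b" using assms[of s] by linarith
  moreover have "s * b < 0"
    using b by (simp add: s_def divide_less_0_iff add_nonneg_pos not_less sum_squares_gt_zero_iff flip: power2_eq_square)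
  ultimately show False by simp
qed

text \<open>The hypothesis \<open>ineq\<close> says that the essential spectrum of \<open>R \<circ> R\<close> is empty; the
  parallelogram identity turns it into the Cauchy property of a minimizing sequence.\<close>

lemma rayleigh_quotient_minimum_attained:
  fixes R :: "'a::real_inner \<Rightarrow> 'a"
  assumes sa: "self_adjoint_op H D R" and cH: "complete H" and nz: "\<phi>0 \<in> D" "\<phi>0 \<noteq> 0"
    and ineq: "\<And>\<kappa>. 0 < \<kappa> \<Longrightarrow> \<exists>(g :: nat \<Rightarrow> 'a) N. \<forall>v\<in>D. \<kappa> * (norm v)\<^sup>2 \<le> (norm (R v))\<^sup>2 + (\<Sum>j<N. (v \<bullet> g j)\<^sup>2)"
  obtains \<mu> \<phi> where "\<phi> \<in> D" "\<phi> \<noteq> 0" "R \<phi> \<in> D" "R (R \<phi>) = \<mu> *\<^sub>R \<phi>"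
    "\<And>v. v \<in> D \<Longrightarrow> \<mu> * (norm v)\<^sup>2 \<le> (norm (R v))\<^sup>2"
proof -
  have sub: "subspace D" "H \<subseteq> closure D" "D \<subseteq> H"
    and sym: "\<And>v w. v \<in> D \<Longrightarrow> w \<in> D \<Longrightarrow> R v \<bullet> w = v \<bullet> R w"
    and mx: "\<And>y z. y \<in> H \<Longrightarrow> z \<in> H \<Longrightarrow> (\<And>v. v \<in> D \<Longrightarrow> R v \<bullet> y = v \<bullet> z) \<Longrightarrow> y \<in> D"
    and RH: "R ` D \<subseteq> H"
    and Radd: "\<And>v w. v \<in> D \<Longrightarrow> w \<in> D \<Longrightarrow> R (v + w) = R v + R w"
    and Rscale: "\<And>v c. v \<in> D \<Longrightarrow> R (c *\<^sub>R v) = c *\<^sub>R R v"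
    using sa unfolding self_adjoint_op_def by blast+
  have Rdiff: "R (v - w) = R v - R w" if "v \<in> D" "w \<in> D" for v w
    using Radd[of v "(-1) *\<^sub>R w"] Rscale[of w "-1"] subspace_scale[OF sub(1), of w "-1"] that by simp
  define S where "S = {v \<in> D. norm v = 1}"
  define \<mu> where "\<mu> = (INF v\<in>S. (norm (R v))\<^sup>2)"
  have bb: "bdd_below ((\<lambda>v. (norm (R v))\<^sup>2) ` S)" by (rule bdd_belowI[of _ 0]) auto
  have Sne: "S \<noteq> {}"
    using subspace_scale[OF sub(1) nz(1), of "1 / norm \<phi>0"] nz(2) unfolding S_def by auto
  have \<mu>0: "0 \<le> \<mu>" unfolding \<mu>_def by (intro cINF_greatest Sne) simp
  have low: "\<mu> * (norm v)\<^sup>2 \<le> (norm (R v))\<^sup>2" if v: "v \<in> D" for v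
  proof (cases "v = 0")
    case False
    have "(1 / norm v) *\<^sub>R v \<in> S"
      using subspace_scale[OF sub(1) v, of "1 / norm v"] False unfolding S_def by auto
    from cINF_lower[OF bb this] have "\<mu> \<le> (norm (R v))\<^sup>2 / (norm v)\<^sup>2"
      by (simp add: \<mu>_def Rscale[OF v] power_divide)
    then show ?thesis using False by (simp add: field_simps)
  qed simp
  have "\<exists>v. v \<in> S \<and> (norm (R v))\<^sup>2 < \<mu> + inverse (real (Suc k))" for k
  proof -
    have "Inf ((\<lambda>v. (norm (R v))\<^sup>2) ` S) < \<mu> + inverse (real (Suc k))" by (simp add: \<mu>_def)
    then show ?thesis using cInf_lessD[of "(\<lambda>v. (norm (R v))\<^sup>2) ` S"] Sne by blast
  qed
  then obtain w where w: "\<And>k. w k \<in> S" "\<And>k. (norm (R (w k)))\<^sup>2 < \<mu> + inverse (real (Suc k))" by metis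
  \<comment> \<open>The value \<open>\<mu> + 1\<close> lies above the infimum by one: subtracting
    \<open>Rd\<close> cancels the multiple of \<open>\<mu>\<close> and leaves exactly the squared
    norm of \<open>v k - v l\<close>.\<close>
  obtain g :: "nat \<Rightarrow> 'a" and N where
    G: "\<And>v. v \<in> D \<Longrightarrow> (\<mu> + 1) * (norm v)\<^sup>2 \<le> (norm (R v))\<^sup>2 + (\<Sum>j<N. (v \<bullet> g j)\<^sup>2)"
    using ineq[of "\<mu> + 1"] \<mu>0 by auto
  have "bounded (range w)" using w(1) by (auto simp: bounded_iff S_def)
  from finite_inner_convergent_subsequence[OF _ this, of "g ` {..<N}"] obtain r where
    r: "strict_mono (r :: nat \<Rightarrow> nat)" "\<And>j. j < N \<Longrightarrow> convergent (\<lambda>k. w (r k) \<bullet> g j)" by auto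
  define c where "c j = lim (\<lambda>k. w (r k) \<bullet> g j)" for j
  have c: "(\<lambda>k. w (r k) \<bullet> g j) \<longlonglongrightarrow> c j" if "j \<in> {..<N}" for j
    using r(2)[of j] that unfolding c_def by (simp add: convergent_LIMSEQ_iff)
  define v where "v k = w (r k)" for k
  define \<epsilon> where "\<epsilon> k = inverse (real (Suc (r k)))" for k
  have \<epsilon>: "\<epsilon> \<longlonglongrightarrow> 0"
    using LIMSEQ_subseq_LIMSEQ[OF LIMSEQ_inverse_real_of_nat r(1)] by (simp add: \<epsilon>_def[abs_def] o_def)
  have v: "v k \<in> D" "norm (v k) = 1" "(norm (R (v k)))\<^sup>2 < \<mu> + \<epsilon> k" for k
    using w[of "r k"] by (auto simp: v_def S_def \<epsilon>_def)
  \<comment> \<open>Comparing with the limits \<open>c j\<close> replaces a difference of two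
    members of the sequence by one error for each index.\<close>
  define b where "b k = 2 * \<epsilon> k + 2 * (\<Sum>j<N. (v k \<bullet> g j - c j)\<^sup>2)" for k
  have b: "b \<longlonglongrightarrow> 0"
  proof -
    have "b \<longlonglongrightarrow> 2 * 0 + 2 * (\<Sum>j<N. (c j - c j)\<^sup>2)"
      unfolding b_def v_def by (intro tendsto_intros \<epsilon> c)
    then show ?thesis by simp
  qed
  \<comment> \<open>Parallelogram identity twice, for \<open>R\<close> and for the vectors
    themselves: the Rayleigh bound at the sum \<open>v k + v l\<close> limits how far apart two
    almost minimizing vectors can be.\<close>
  have Rd: "(norm (R (v k) - R (v l)))\<^sup>2 \<le> 2 * \<epsilon> k + 2 * \<epsilon> l + \<mu> * (norm (v k - v l))\<^sup>2" for k l
  proof -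
    have "(norm (R (v k) - R (v l)))\<^sup>2 = 2 * (norm (R (v k)))\<^sup>2 + 2 * (norm (R (v l)))\<^sup>2 - (norm (R (v k + v l)))\<^sup>2"
      unfolding Radd[OF v(1) v(1)] power2_norm_eq_inner by (simp add: inner_simps inner_commute)
    moreover have "\<mu> * (norm (v k + v l))\<^sup>2 \<le> (norm (R (v k + v l)))\<^sup>2"
      by (intro low subspace_add[OF sub(1)] v)
    moreover have "(norm (v k + v l))\<^sup>2 = 4 - (norm (v k - v l))\<^sup>2"
      using v(2)[of k] v(2)[of l] by (simp add: power2_norm_eq_inner inner_simps norm_eq_1 inner_commute)
    then have "\<mu> * (norm (v k + v l))\<^sup>2 = 4 * \<mu> - \<mu> * (norm (v k - v l))\<^sup>2"
      by (simp add: right_diff_distrib)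
    ultimately show ?thesis using v(3)[of k] v(3)[of l] by linarith
  qed
  have vd: "(norm (v k - v l))\<^sup>2 \<le> b k + b l" for k l
  proof -
    have "((v k - v l) \<bullet> g j)\<^sup>2 \<le> 2 * (v k \<bullet> g j - c j)\<^sup>2 + 2 * (v l \<bullet> g j - c j)\<^sup>2" for j
    proof -
      have "0 \<le> ((v k \<bullet> g j - c j) + (v l \<bullet> g j - c j))\<^sup>2" by simp
      then show ?thesis by (simp add: inner_diff_left power2_eq_square algebra_simps)
    qed
    then have "(\<Sum>j<N. ((v k - v l) \<bullet> g j)\<^sup>2) \<le> (\<Sum>j<N. 2 * (v k \<bullet> g j - c j)\<^sup>2 + 2 * (v l \<bullet> g j - c j)\<^sup>2)"
      by (intro sum_mono)
    moreover have "(\<mu> + 1) * (norm (v k - v l))\<^sup>2 \<le> (norm (R (v k) - R (v l)))\<^sup>2 + (\<Sum>j<N. ((v k - v l) \<bullet> g j)\<^sup>2)"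
      using G[OF subspace_diff[OF sub(1) v(1) v(1)], of k l] by (simp add: Rdiff v)
    ultimately show ?thesis using Rd[of k l]
      by (simp add: b_def sum.distrib sum_distrib_left algebra_simps)
  qed
  have "Cauchy v" by (rule Cauchy_if_dist_square_le[OF vd b])
  moreover have "Cauchy (\<lambda>k. R (v k))"
  proof (rule Cauchy_if_dist_square_le)
    show "(norm (R (v k) - R (v l)))\<^sup>2 \<le> (2 * \<epsilon> k + \<mu> * b k) + (2 * \<epsilon> l + \<mu> * b l)" for k l
      using Rd[of k l] mult_left_mono[OF vd[of k l] \<mu>0] by (simp add: algebra_simps)
    have "(\<lambda>k. 2 * \<epsilon> k + \<mu> * b k) \<longlonglongrightarrow> 2 * 0 + \<mu> * 0" by (intro tendsto_intros \<epsilon> b)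
    then show "(\<lambda>k. 2 * \<epsilon> k + \<mu> * b k) \<longlonglongrightarrow> 0" by simp
  qed
  ultimately obtain \<phi> z where lim: "\<phi> \<in> H" "v \<longlonglongrightarrow> \<phi>" "z \<in> H" "(\<lambda>k. R (v k)) \<longlonglongrightarrow> z"
    using cH v(1) sub(3) RH unfolding complete_def by (metis image_subset_iff subsetD)
  have \<phi>: "\<phi> \<in> D" "R \<phi> = z"
    using self_adjoint_op_closed[OF sa v(1) lim(2,4) lim(1,3)] by auto
  have n1: "norm \<phi> = 1"
    using tendsto_norm[OF lim(2)] by (simp add: v LIMSEQ_const_iff)
  have "(\<lambda>k. (norm (R (v k)))\<^sup>2) \<longlonglongrightarrow> (norm z)\<^sup>2" by (intro tendsto_intros lim)
  moreover have "(\<lambda>k. \<mu> + \<epsilon> k) \<longlonglongrightarrow> \<mu> + 0" by (intro tendsto_intros \<epsilon>)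
  ultimately have "(norm z)\<^sup>2 \<le> \<mu> + 0"
    by (rule LIMSEQ_le) (use v(3) in \<open>auto intro: less_imp_le\<close>)
  with low[OF \<phi>(1)] have R\<mu>: "(norm (R \<phi>))\<^sup>2 = \<mu>" by (simp add: n1 \<phi>)
  \<comment> \<open>The Euler-Lagrange equation in weak form, from perturbing the minimizer in the
    direction \<open>x\<close>.\<close>
  have EL: "R x \<bullet> R \<phi> = x \<bullet> (\<mu> *\<^sub>R \<phi>)" if x: "x \<in> D" for x
  proof -
    have "0 \<le> 2 * t * (R x \<bullet> R \<phi> - \<mu> * (x \<bullet> \<phi>)) + t\<^sup>2 * ((norm (R x))\<^sup>2 - \<mu> * (norm x)\<^sup>2)" for t
    proof -
      have tx: "t *\<^sub>R x \<in> D" using subspace_scale[OF sub(1) x] .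
      have "\<mu> * (norm (\<phi> + t *\<^sub>R x))\<^sup>2 \<le> (norm (R \<phi> + t *\<^sub>R R x))\<^sup>2"
        using low[OF subspace_add[OF sub(1) \<phi>(1) tx]] by (simp add: Radd[OF \<phi>(1) tx] Rscale[OF x])
      moreover have "(norm (\<phi> + t *\<^sub>R x))\<^sup>2 = 1 + 2 * t * (x \<bullet> \<phi>) + t\<^sup>2 * (norm x)\<^sup>2"
        using n1 unfolding power2_norm_eq_inner by (simp add: inner_simps norm_eq_1 power2_eq_square inner_commute)
      moreover have "(norm (R \<phi> + t *\<^sub>R R x))\<^sup>2 = \<mu> + 2 * t * (R x \<bullet> R \<phi>) + t\<^sup>2 * (norm (R x))\<^sup>2"
        unfolding R\<mu>[symmetric] power2_norm_eq_inner by (simp add: inner_simps power2_eq_square inner_commute)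
      ultimately show ?thesis by (simp add: algebra_simps)
    qed
    from nonneg_quadratic_linear_coeff_zero[OF this] show ?thesis by simp
  qed
  have cone: "\<mu> *\<^sub>R \<phi> \<in> H" using subspace_scale[OF sub(1) \<phi>(1)] sub(3) by auto
  \<comment> \<open>The weak equation is the premise of the maximality clause for
    \<open>R \<phi>\<close>, with \<open>\<mu> *\<^sub>R \<phi>\<close> as the image; hence
    \<open>R\<close> may be applied a second time.\<close>
  have RD: "R \<phi> \<in> D" using mx[OF _ cone EL] lim(3) \<phi>(2) by simp
  have "R (R \<phi>) = \<mu> *\<^sub>R \<phi>"
    using RH sub(2) RD cone EL sym[OF _ RD] by (intro inner_eq_on_dense_imp_eq[of _ D]) auto
  moreover have "\<phi> \<noteq> 0" using n1 by auto
  ultimately show thesis using that[of \<phi> \<mu>] \<phi>(1) RD low by blast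
qed

section \<open>Energy decay for the damped wave equation in a finite-dimensional space\<close>

text \<open>Zero vectors in \<open>C\<close> are harmless, since they contribute
  \<open>0 / 0 = 0\<close>; the result of Gram-Schmidt orthogonalization can thus be used as it
  comes.\<close>

lemma span_pairwise_orthogonal_expansion:
  fixes C :: "'a::real_inner set"
  assumes "finite C" "pairwise orthogonal C" "v \<in> span C"
  shows "v = (\<Sum>e\<in>C. (v \<bullet> e / (e \<bullet> e)) *\<^sub>R e)"
  using assms(3)
proof (induction rule: span_induct)
  case base
  define P where "P v = (\<Sum>e\<in>C. (v \<bullet> e / (e \<bullet> e)) *\<^sub>R e)" for v
  have "P (x + y) = P x + P y" "P (c *\<^sub>R x) = c *\<^sub>R P x" "P 0 = 0" for x y and c :: real
    by (simp_all add: P_def inner_add_left add_divide_distrib scaleR_add_left sum.distrib scaleR_sum_right)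
  then have "subspace {v. v = P v}" by (simp add: subspace_def)
  then show ?case unfolding P_def .
next
  case (step x)
  have "(\<Sum>e\<in>C. (x \<bullet> e / (e \<bullet> e)) *\<^sub>R e) = (\<Sum>e\<in>C. if e = x then x else 0)"
    using assms(2) step by (intro sum.cong refl) (auto simp: pairwise_def orthogonal_def)
  then show ?case using assms(1) step by simp
qed

text \<open>The span is the set of fixed points of the orthogonal projection, which is a finite sum
  of continuous maps even though the ambient space may be infinite-dimensional.\<close>

lemma closed_span_finite:
  fixes b :: "'a::real_inner set"
  assumes "finite b"
  shows "closed (span b)"
proof -
  obtain C where C: "finite C" "span C = span b" "pairwise orthogonal C"
    using basis_orthogonal[OF assms] by blast
  have "span b = {v. v = (\<Sum>e\<in>C. (v \<bullet> e / (e \<bullet> e)) *\<^sub>R e)}"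
  proof (intro set_eqI iffI CollectI)
    fix v assume "v \<in> {v. v = (\<Sum>e\<in>C. (v \<bullet> e / (e \<bullet> e)) *\<^sub>R e)}"
    then have v: "v = (\<Sum>e\<in>C. (v \<bullet> e / (e \<bullet> e)) *\<^sub>R e)" by blast
    show "v \<in> span b"
      unfolding C(2)[symmetric] by (subst v) (intro span_sum span_scale span_base)
  next
    fix v assume "v \<in> span b"
    then show "v = (\<Sum>e\<in>C. (v \<bullet> e / (e \<bullet> e)) *\<^sub>R e)"
      using C by (intro span_pairwise_orthogonal_expansion) auto
  qed
  moreover have "closed {v. v = (\<Sum>e\<in>C. (v \<bullet> e / (e \<bullet> e)) *\<^sub>R e)}"
    unfolding divide_inverse
    by (intro closed_Collect_eq continuous_on_id continuous_on_sum continuous_on_scaleR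
        continuous_on_mult continuous_on_inner continuous_on_const)
  ultimately show ?thesis by simp
qed

text \<open>Difference quotients stay in the subspace. \<open>semidiscrete_solution\<close> places
  only \<open>u t\<close> in the discrete space; this supplies the same for both time
  derivatives.\<close>

lemma has_vector_derivative_in_closed_subspace:
  fixes f :: "real \<Rightarrow> 'a::real_normed_vector"
  assumes "subspace V" "closed V" "\<And>s. s \<in> S \<Longrightarrow> f s \<in> V"
    and "(f has_vector_derivative d) (at t within S)" "t \<in> S" "at t within S \<noteq> bot"
  shows "d \<in> V"
proof (rule Lim_in_closed_set[OF assms(2)])
  have "((\<lambda>s. norm (f s - f t - (s - t) *\<^sub>R d) / norm (s - t)) \<longlongrightarrow> 0) (at t within S)"
    using assms(4) by (simp add: has_vector_derivative_def has_derivative_iff_norm)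
  then have "((\<lambda>s. norm ((f s - f t) /\<^sub>R (s - t) - d)) \<longlongrightarrow> 0) (at t within S)"
  proof (rule Lim_transform_eventually)
    have "norm (f s - f t - (s - t) *\<^sub>R d) / norm (s - t) = norm ((f s - f t) /\<^sub>R (s - t) - d)"
      if "s \<noteq> t" for s
    proof -
      have "(f s - f t) /\<^sub>R (s - t) - d = (f s - f t - (s - t) *\<^sub>R d) /\<^sub>R (s - t)"
        using that by (simp add: scaleR_diff_right)
      then show ?thesis by (simp add: divide_inverse mult.commute)
    qed
    then show "\<forall>\<^sub>F s in at t within S. norm (f s - f t - (s - t) *\<^sub>R d) / norm (s - t)
        = norm ((f s - f t) /\<^sub>R (s - t) - d)"
      by (auto simp: eventually_at_filter)
  qed
  then show "((\<lambda>s. (f s - f t) /\<^sub>R (s - t)) \<longlongrightarrow> d) (at t within S)"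
    by (rule LIM_zero_cancel[OF tendsto_norm_zero_cancel])
  show "\<forall>\<^sub>F s in at t within S. (f s - f t) /\<^sub>R (s - t) \<in> V"
    using assms(1,3,5) by (auto simp: eventually_at_filter intro!: always_eventually subspace_scale subspace_diff)
qed (fact assms(6))

text \<open>Extending the discrete operator by the orthogonal projection makes it bounded on the whole
  space, so that it can be composed with derivatives of curves.\<close>

lemma discrete_form_operator:
  fixes R :: "'a::real_inner \<Rightarrow> 'a"
  assumes b: "finite b" "V = span b"
    and Radd: "\<And>v w. v \<in> V \<Longrightarrow> w \<in> V \<Longrightarrow> R (v + w) = R v + R w"
    and Rscale: "\<And>v c. v \<in> V \<Longrightarrow> R (c *\<^sub>R v) = c *\<^sub>R R v"
  obtains B where "bounded_linear B" "\<And>v. B v \<in> V"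
    "\<And>v w. v \<in> V \<Longrightarrow> w \<in> V \<Longrightarrow> B v \<bullet> w = R v \<bullet> R w"
proof -
  obtain C where C: "finite C" "span C = V" "pairwise orthogonal C"
    using basis_orthogonal[OF b(1)] b(2) by blast
  have V: "subspace V" "\<And>e. e \<in> C \<Longrightarrow> e \<in> V"
    using C(2) span_base[of _ C] subspace_span[of C] by auto
  have R0: "R 0 = 0" using Rscale[OF subspace_0[OF V(1)], of 0] by simp
  have Rsum: "R (\<Sum>e\<in>F. f e *\<^sub>R e) = (\<Sum>e\<in>F. f e *\<^sub>R R e)" if "F \<subseteq> C" for F and f :: "'a \<Rightarrow> real"
    using finite_subset[OF that C(1)] that
  proof induction
    case (insert x F)
    then show ?case
      using Radd[of "f x *\<^sub>R x" "\<Sum>e\<in>F. f e *\<^sub>R e"] V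
      by (auto simp: Rscale intro!: subspace_sum subspace_scale)
  qed (simp add: R0)
  have Rexp: "R v = (\<Sum>e\<in>C. (v \<bullet> e / (e \<bullet> e)) *\<^sub>R R e)" if "v \<in> V" for v
    using span_pairwise_orthogonal_expansion[OF C(1,3), of v] C(2) that Rsum[of C "\<lambda>e. v \<bullet> e / (e \<bullet> e)"]
    by simp
  \<comment> \<open>The Riesz representative of \<open>R v \<bullet> R w\<close> in orthogonal
    coordinates: the coefficient at \<open>e'\<close> is
    \<open>R v \<bullet> R e' / (e' \<bullet> e')\<close>, with \<open>v\<close> expanded over
    \<open>C\<close>. Only the products \<open>v \<bullet> e\<close> enter, so \<open>B\<close> sees
    \<open>v\<close> through its projection.\<close>
  define B where "B v = (\<Sum>e\<in>C. \<Sum>e'\<in>C. (v \<bullet> e) *\<^sub>R ((R e \<bullet> R e') / ((e \<bullet> e) * (e' \<bullet> e'))) *\<^sub>R e')" for v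
  show thesis
  proof
    show "bounded_linear B"
      unfolding B_def by (intro bounded_linear_sum bounded_linear_scaleR_const bounded_linear_inner_left)
    show "B v \<in> V" for v
      unfolding B_def by (intro subspace_sum V subspace_scale)
    show "B v \<bullet> w = R v \<bullet> R w" if "v \<in> V" "w \<in> V" for v w
    proof -
      have "R v \<bullet> R w = (\<Sum>e\<in>C. (v \<bullet> e / (e \<bullet> e)) * (\<Sum>e'\<in>C. (w \<bullet> e' / (e' \<bullet> e')) * (R e \<bullet> R e')))"
        unfolding Rexp[OF that(1)] Rexp[OF that(2)] inner_sum_left inner_scaleR_left
        unfolding inner_sum_right inner_scaleR_right ..
      also have "\<dots> = B v \<bullet> w"
        unfolding B_def inner_sum_left inner_scaleR_left sum_distrib_left
        by (intro sum.cong refl) (simp add: inner_commute[of w])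
      finally show ?thesis by simp
    qed
  qed
qed

lemma damped_wave_energy_decay:
  fixes u u' u'' :: "real \<Rightarrow> 'a::real_inner"
  assumes V: "subspace V" and B: "bounded_linear B" "\<And>v. v \<in> V \<Longrightarrow> B v \<in> V"
    and sym: "\<And>v w. v \<in> V \<Longrightarrow> w \<in> V \<Longrightarrow> B v \<bullet> w = v \<bullet> B w"
    and coer: "\<And>v. v \<in> V \<Longrightarrow> \<kappa> * (norm v)\<^sup>2 \<le> B v \<bullet> v"
    and pos: "0 < \<kappa>" "0 < \<alpha>" "0 < \<delta>" "\<delta> \<le> 1 / 3 * min \<alpha> (\<kappa> / (2 * \<alpha>))"
    and uV: "\<And>t. 0 \<le> t \<Longrightarrow> u t \<in> V" "\<And>t. 0 \<le> t \<Longrightarrow> u' t \<in> V"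
    and du: "\<And>t. 0 \<le> t \<Longrightarrow> (u has_vector_derivative u' t) (at t within {0..})"
    and cu': "continuous_on {0..} u'"
    and du': "\<And>t. 0 < t \<Longrightarrow> (u' has_vector_derivative u'' t) (at t)"
    and eq: "\<And>t. 0 < t \<Longrightarrow> u'' t = - \<alpha> *\<^sub>R u' t - B (u t)"
    and t: "0 \<le> t"
  shows "B (u' t) \<bullet> u' t + (norm (B (u t)))\<^sup>2
    \<le> 3 * exp (- 2 * \<delta> * t) * (B (u' 0) \<bullet> u' 0 + (norm (B (u 0)))\<^sup>2)"
proof -
  interpret B: bounded_linear B by fact
  define E where "E s = B (u' s) \<bullet> u' s + B (u s) \<bullet> B (u s)" for s
  define \<Psi> where "\<Psi> s = E s + 2 * \<delta> * (B (u s) \<bullet> u' s) - \<delta> * (\<alpha> - 2 * \<delta>) * (B (u s) \<bullet> u s)" for s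
  define \<Phi> where "\<Phi> s = exp (2 * \<delta> * s) * \<Psi> s" for s
  \<comment> \<open>\<open>w t = exp (\<delta> * t) *\<^sub>R u t\<close> solves \<open>w'' + (\<alpha> - 2 * \<delta>) w' + (B - \<delta> * (\<alpha> - \<delta>)) w = 0\<close>, and \<open>\<Phi>\<close> is
    twice the energy of \<open>w\<close> in the inner product induced by \<open>B\<close>.\<close>
  have \<delta>: "3 * \<delta> \<le> \<alpha>" "6 * (\<delta> * \<alpha>) \<le> \<kappa>"
  proof -
    have "\<delta> \<le> \<alpha> / 3" "\<delta> \<le> \<kappa> / (6 * \<alpha>)" using pos by (auto simp: min_def split: if_splits)
    then show "3 * \<delta> \<le> \<alpha>" "6 * (\<delta> * \<alpha>) \<le> \<kappa>" using pos by (auto simp: field_simps)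
  qed
  \<comment> \<open>The 16 is the square of the weight \<open>4 * \<delta>\<close> used in
    \<open>cross\<close> below.\<close>
  have \<delta>2: "16 * \<delta>\<^sup>2 \<le> \<kappa>"
  proof -
    have "0 < \<delta> * \<alpha>" using pos by simp
    then show ?thesis using \<delta>(2) pos mult_left_mono[OF \<delta>(1), of \<delta>] unfolding power2_eq_square by linarith
  qed
  have nn: "0 \<le> B v \<bullet> v" if "v \<in> V" for v
    using coer[OF that] pos by (meson mult_nonneg_nonneg order_trans zero_le_power2 less_imp_le)
  \<comment> \<open>Coercivity moves up one order by Cauchy-Schwarz: the square of
    \<open>B v \<bullet> v\<close> is at most \<open>(B v \<bullet> B v) * (v \<bullet> v)\<close>,
    and \<open>\<kappa> * (v \<bullet> v) \<le> B v \<bullet> v\<close>.\<close>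
  have WZ: "\<kappa> * (B v \<bullet> v) \<le> B v \<bullet> B v" if v: "v \<in> V" for v
  proof (cases "B v \<bullet> v = 0")
    case False
    then have Z: "0 < B v \<bullet> v" using nn[OF v] by simp
    have "\<kappa> * (B v \<bullet> v)\<^sup>2 \<le> \<kappa> * ((B v \<bullet> B v) * (v \<bullet> v))"
      using pos Cauchy_Schwarz_ineq by (intro mult_left_mono) auto
    also have "\<dots> \<le> (B v \<bullet> B v) * (B v \<bullet> v)"
      using mult_left_mono[OF coer[OF v], of "B v \<bullet> B v"] by (simp add: power2_norm_eq_inner mult_ac)
    finally show ?thesis using Z by (simp add: power2_eq_square)
  qed simp
  \<comment> \<open>The cross term of \<open>\<Psi>\<close> is at most \<open>E s / 4\<close> in
    absolute value, and the subtracted term lies between 0 and \<open>E s / 6\<close>;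
    \<open>1 - 1 / 4 - 1 / 6 = 7 / 12\<close>.\<close>
  have bounds: "7 / 12 * E s \<le> \<Psi> s" "\<Psi> s \<le> 5 / 4 * E s" if s: "0 \<le> s" for s
  proof -
    have X: "0 \<le> B (u' s) \<bullet> u' s" and Z: "0 \<le> B (u s) \<bullet> u s" using nn uV s by auto
    have cross: "8 * \<delta> * \<bar>B (u s) \<bullet> u' s\<bar> \<le> E s"
    proof -
      \<comment> \<open>Weighted Cauchy-Schwarz inequality for the form of \<open>B\<close>; the two
        signs \<open>c = 4 * \<delta>\<close> and \<open>c = - (4 * \<delta>)\<close> give the
        absolute value.\<close>
      have "0 \<le> B (u' s + c *\<^sub>R u s) \<bullet> (u' s + c *\<^sub>R u s)" for c
        using nn[OF subspace_add[OF V uV(2)[OF s] subspace_scale[OF V uV(1)[OF s]]]] .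
      then have "0 \<le> B (u' s) \<bullet> u' s + 2 * c * (B (u s) \<bullet> u' s) + c\<^sup>2 * (B (u s) \<bullet> u s)" for c
        using sym[OF uV(2)[OF s] uV(1)[OF s]]
        by (simp add: B.add B.scaleR inner_simps power2_eq_square inner_commute algebra_simps)
      from this[of "4 * \<delta>"] this[of "- (4 * \<delta>)"]
      have "8 * \<delta> * \<bar>B (u s) \<bullet> u' s\<bar> \<le> B (u' s) \<bullet> u' s + 16 * \<delta>\<^sup>2 * (B (u s) \<bullet> u s)"
        using pos by (auto simp: abs_if power_mult_distrib)
      also have "16 * \<delta>\<^sup>2 * (B (u s) \<bullet> u s) \<le> \<kappa> * (B (u s) \<bullet> u s)"
        using \<delta>2 Z by (rule mult_right_mono)
      also have "\<dots> \<le> B (u s) \<bullet> B (u s)" using WZ uV s by simp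
      finally show ?thesis by (simp add: E_def)
    qed
    have l: "0 \<le> \<delta> * (\<alpha> - 2 * \<delta>) * (B (u s) \<bullet> u s)" using \<delta> pos Z by simp
    have "\<delta> * (\<alpha> - 2 * \<delta>) \<le> \<delta> * \<alpha>" using pos by (intro mult_left_mono) auto
    then have "6 * (\<delta> * (\<alpha> - 2 * \<delta>)) \<le> \<kappa>" using \<delta>(2) by linarith
    from mult_right_mono[OF this Z] WZ[OF uV(1)[OF s]]
    have r: "6 * (\<delta> * (\<alpha> - 2 * \<delta>) * (B (u s) \<bullet> u s)) \<le> E s" using X by (simp add: E_def algebra_simps)
    have c: "8 * (\<delta> * (B (u s) \<bullet> u' s)) \<le> E s" "- (8 * (\<delta> * (B (u s) \<bullet> u' s))) \<le> E s"
    proof -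
      have "8 * \<delta> * \<bar>B (u s) \<bullet> u' s\<bar> = \<bar>8 * (\<delta> * (B (u s) \<bullet> u' s))\<bar>" using pos by (simp add: abs_mult)
      then show "8 * (\<delta> * (B (u s) \<bullet> u' s)) \<le> E s" "- (8 * (\<delta> * (B (u s) \<bullet> u' s))) \<le> E s"
        using cross by linarith+
    qed
    show "7 / 12 * E s \<le> \<Psi> s" "\<Psi> s \<le> 5 / 4 * E s"
      using l r c by (auto simp: \<Psi>_def)
  qed
  have "\<Phi> t \<le> \<Phi> 0"
    using t
  \<comment> \<open>The second time derivative exists at positive times only, so monotonicity comes
    from the open interval together with continuity up to 0.\<close>
  proof (rule DERIV_nonpos_imp_decreasing_open[where f = \<Phi>])
    fix s assume s: "0 < s" "s < t"
    have d: "(u has_vector_derivative u' s) (at s)"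
    proof -
      have "at s within {0..} = at s" using s by (intro at_within_interior) simp
      then show ?thesis using du[of s] s by simp
    qed
    note d' = du'[OF s(1)]
    note BD = B.has_vector_derivative
    note ID = bounded_bilinear.has_vector_derivative[OF bounded_bilinear_inner]
    have in_V: "u s \<in> V" "u' s \<in> V" "u'' s \<in> V"
      using uV[of s] s by (simp_all add: eq subspace_diff subspace_scale V B(2) del: scaleR_minus_left)
    \<comment> \<open>Up to the factor \<open>exp (\<delta> * s)\<close>, the vector
      \<open>u' s + \<delta> *\<^sub>R u s\<close> is \<open>w'\<close>; the right-hand side is the
      damping \<open>\<alpha> - 2 * \<delta>\<close> times minus twice the squared
      \<open>B\<close>-norm of \<open>w'\<close>.\<close>
    have "(\<Phi> has_real_derivative exp (2 * \<delta> * s) *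
       (- 2 * (\<alpha> - 2 * \<delta>) * (B (u' s + \<delta> *\<^sub>R u s) \<bullet> (u' s + \<delta> *\<^sub>R u s)))) (at s)"
    proof -
      define X where "X = B (u' s) \<bullet> u' s"
      define Y where "Y = B (u s) \<bullet> u' s"
      define Z where "Z = B (u s) \<bullet> u s"
      define W where "W = B (u s) \<bullet> B (u s)"
      define T where "T = B (u s) \<bullet> B (u' s)"
      have alt: "B (u' s) \<bullet> u s = Y" "u s \<bullet> B (u' s) = Y" "u' s \<bullet> B (u s) = Y"
          "u' s \<bullet> B (u' s) = X" "u s \<bullet> B (u s) = Z" "B (u' s) \<bullet> B (u s) = T"
          "B (B (u s)) \<bullet> u' s = T" "u' s \<bullet> B (B (u s)) = T"
        unfolding X_def Y_def Z_def W_def T_def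
        using sym[OF in_V(2) in_V(1)] sym[OF B(2)[OF in_V(1)] in_V(2)] by (simp_all add: inner_commute)
      have dX: "((\<lambda>s. B (u' s) \<bullet> u' s) has_vector_derivative - 2 * \<alpha> * X - 2 * T) (at s)"
        using ID[OF BD[OF d'] d']
        by (rule has_vector_derivative_eq_rhs)
          (simp add: eq[OF s(1)] B.diff B.scaleR B.neg inner_simps alt flip: X_def)
      have dW: "((\<lambda>s. B (u s) \<bullet> B (u s)) has_vector_derivative 2 * T) (at s)"
        using ID[OF BD[OF d] BD[OF d]]
        by (rule has_vector_derivative_eq_rhs) (simp add: alt flip: T_def)
      have dY: "((\<lambda>s. B (u s) \<bullet> u' s) has_vector_derivative X - \<alpha> * Y - W) (at s)"
        using ID[OF BD[OF d] d']
        by (rule has_vector_derivative_eq_rhs)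
          (simp add: eq[OF s(1)] inner_simps alt flip: X_def Y_def W_def)
      have dZ: "((\<lambda>s. B (u s) \<bullet> u s) has_vector_derivative 2 * Y) (at s)"
        using ID[OF BD[OF d] d]
        by (rule has_vector_derivative_eq_rhs) (simp add: alt flip: Y_def)
      note D = dX[folded has_real_derivative_iff_has_vector_derivative]
        dW[folded has_real_derivative_iff_has_vector_derivative]
        dY[folded has_real_derivative_iff_has_vector_derivative]
        dZ[folded has_real_derivative_iff_has_vector_derivative]
      have quad: "B (u' s + \<delta> *\<^sub>R u s) \<bullet> (u' s + \<delta> *\<^sub>R u s) = X + 2 * \<delta> * Y + \<delta>\<^sup>2 * Z"
        by (simp add: B.add B.scaleR inner_simps alt power2_eq_square algebra_simps
            flip: X_def Y_def Z_def)
      have dPsi: "(\<Psi> has_real_derivative (- 2 * \<alpha> * X - 2 * T + 2 * T)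
          + 2 * \<delta> * (X - \<alpha> * Y - W) - \<delta> * (\<alpha> - 2 * \<delta>) * (2 * Y)) (at s)"
        unfolding \<Psi>_def E_def by (intro DERIV_add DERIV_diff DERIV_cmult D)
      have Psi: "\<Psi> s = X + W + 2 * \<delta> * Y - \<delta> * (\<alpha> - 2 * \<delta>) * Z"
        by (simp add: \<Psi>_def E_def X_def Y_def Z_def W_def)
      have dexp: "((\<lambda>s. exp (2 * \<delta> * s)) has_real_derivative exp (2 * \<delta> * s) * (2 * \<delta>)) (at s)"
        by (auto intro!: derivative_eq_intros)
      have "(\<Phi> has_real_derivative exp (2 * \<delta> * s) * (2 * \<delta>) * (X + W + 2 * \<delta> * Y - \<delta> * (\<alpha> - 2 * \<delta>) * Z)
          + ((- 2 * \<alpha> * X - 2 * T + 2 * T) + 2 * \<delta> * (X - \<alpha> * Y - W) - \<delta> * (\<alpha> - 2 * \<delta>) * (2 * Y))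
            * exp (2 * \<delta> * s)) (at s)"
        using DERIV_mult[OF dexp dPsi] unfolding Psi \<Phi>_def[abs_def] .
      moreover have "exp (2 * \<delta> * s) * (2 * \<delta>) * (X + W + 2 * \<delta> * Y - \<delta> * (\<alpha> - 2 * \<delta>) * Z)
          + ((- 2 * \<alpha> * X - 2 * T + 2 * T) + 2 * \<delta> * (X - \<alpha> * Y - W) - \<delta> * (\<alpha> - 2 * \<delta>) * (2 * Y))
            * exp (2 * \<delta> * s)
          = exp (2 * \<delta> * s) * (- 2 * (\<alpha> - 2 * \<delta>) * (X + 2 * \<delta> * Y + \<delta>\<^sup>2 * Z))"
        by algebra
      ultimately show ?thesis using quad by simp
    qed
    moreover have "exp (2 * \<delta> * s) *
       (- 2 * (\<alpha> - 2 * \<delta>) * (B (u' s + \<delta> *\<^sub>R u s) \<bullet> (u' s + \<delta> *\<^sub>R u s))) \<le> 0"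
      using nn[OF subspace_add[OF V in_V(2) subspace_scale[OF V in_V(1)]]] \<delta> pos
      by (simp add: mult_nonneg_nonpos mult_nonpos_nonneg mult_le_0_iff)
    ultimately show "\<exists>y. (\<Phi> has_real_derivative y) (at s) \<and> y \<le> 0" by blast
  next
    have "continuous_on {0..} u"
      using du by (intro continuous_on_vector_derivative) auto
    then have c: "continuous_on {0..t} u" "continuous_on {0..t} u'"
      using cu' by (auto intro: continuous_on_subset)
    show "continuous_on {0..t} \<Phi>"
      unfolding \<Phi>_def \<Psi>_def E_def by (intro continuous_intros c B.continuous_on)
  qed
  then have "exp (2 * \<delta> * t) * (7 / 12 * E t) \<le> 5 / 4 * E 0"
  proof -
    assume "\<Phi> t \<le> \<Phi> 0"
    moreover have "exp (2 * \<delta> * t) * (7 / 12 * E t) \<le> exp (2 * \<delta> * t) * \<Psi> t"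
      by (intro mult_left_mono bounds(1)[OF t]) simp
    moreover have "\<Phi> t = exp (2 * \<delta> * t) * \<Psi> t" "\<Phi> 0 = \<Psi> 0" by (simp_all add: \<Phi>_def)
    ultimately show ?thesis using bounds(2)[of 0] by linarith
  qed
  \<comment> \<open>\<open>15 / 7\<close> is the quotient of \<open>5 / 4\<close> and
    \<open>7 / 12\<close>.\<close>
  then have "exp (2 * \<delta> * t) * E t \<le> 15 / 7 * E 0" by (simp add: mult_ac)
  moreover have "0 \<le> E 0" using nn uV by (simp add: E_def)
  ultimately have "exp (2 * \<delta> * t) * E t \<le> 3 * E 0" by linarith
  from mult_left_mono[OF this, of "exp (- 2 * \<delta> * t)"]
  have "E t \<le> exp (- 2 * \<delta> * t) * (3 * E 0)" by (simp add: exp_minus mult.assoc[symmetric])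
  then show ?thesis unfolding E_def power2_norm_eq_inner by (simp only: mult_ac)
qed

section \<open>Completeness of the space of square-integrable functions\<close>

lemma fun_of_measurable [measurable]: "fun_of v \<in> borel_measurable borel"
  using square_integrable_fun_of[of v] by (simp add: square_integrable_def)

lemma l2_eqI:
  assumes "AE x in lborel. fun_of v x = fun_of w x"
  shows "v = w"
  using assms Quotient_rel_rep[OF Quotient_l2, of v w] by (simp add: l2rel_def square_integrable_fun_of)

lemma fun_of_add: "AE x in lborel. fun_of (v + w) x = fun_of v x + fun_of w x"
proof -
  have "v + w = of_fun (\<lambda>x. fun_of v x + fun_of w x)"
    using plus_l2.abs_eq[of "fun_of v" "fun_of w"] by (simp add: of_fun_fun_of l2rel_def square_integrable_fun_of)
  then show ?thesis
    using fun_of_of_fun[OF square_integrable_add[OF square_integrable_fun_of square_integrable_fun_of]] by metis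
qed

lemma fun_of_scaleR: "AE x in lborel. fun_of (c *\<^sub>R v) x = c * fun_of v x"
proof -
  have "c *\<^sub>R v = of_fun (\<lambda>x. c * fun_of v x)"
    using scaleR_l2.abs_eq[of "fun_of v" c] by (simp add: of_fun_fun_of l2rel_def square_integrable_fun_of)
  then show ?thesis
    using fun_of_of_fun[OF square_integrable_scale[OF square_integrable_fun_of]] by metis
qed

lemma fun_of_diff: "AE x in lborel. fun_of (v - w) x = fun_of v x - fun_of w x"
  using fun_of_add[of v "(-1) *\<^sub>R w"] fun_of_scaleR[of "-1" w] by eventually_elim simp

lemma fun_of_0: "AE x in lborel. fun_of 0 x = 0"
  using fun_of_scaleR[of 0 0] by simp

lemma inner_of_fun_right:
  assumes "square_integrable f"
  shows "v \<bullet> of_fun f = (LINT x|lborel. fun_of v x * f x)"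
  unfolding inner_l2_fun_of
proof (rule integral_cong_AE)
  show "AE x in lborel. fun_of v x * fun_of (of_fun f) x = fun_of v x * f x"
    using fun_of_of_fun[OF assms] by eventually_elim simp
qed (use assms in \<open>auto simp: square_integrable_def\<close>)

lemma norm_l2_square: "(norm v)\<^sup>2 = (LINT x|lborel. (fun_of v x)\<^sup>2)"
  unfolding power2_norm_eq_inner inner_l2_fun_of by (simp add: power2_eq_square)

lemma norm_of_fun_square:
  assumes "square_integrable f"
  shows "(norm (of_fun f))\<^sup>2 = (LINT x|lborel. (f x)\<^sup>2)"
  unfolding norm_l2_square
proof (rule integral_cong_AE)
  show "AE x in lborel. (fun_of (of_fun f) x)\<^sup>2 = (f x)\<^sup>2"
    using fun_of_of_fun[OF assms] by eventually_elim simp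
qed (use assms in \<open>auto simp: square_integrable_def\<close>)

lemma nn_integral_fun_of_square: "(\<integral>\<^sup>+x. ennreal ((fun_of v x)\<^sup>2) \<partial>lborel) = ennreal ((norm v)\<^sup>2)"
  unfolding norm_l2_square
  using square_integrable_fun_of[of v] by (intro nn_integral_eq_integral) (auto simp: square_integrable_def)

lemma square_integrable_iff_nn_integral:
  "square_integrable f \<longleftrightarrow> f \<in> borel_measurable borel \<and> (\<integral>\<^sup>+x. ennreal ((f x)\<^sup>2) \<partial>lborel) < \<infinity>"
  by (auto simp: square_integrable_def integrable_iff_bounded)

lemma norm_of_fun_le:
  assumes "square_integrable f" "(\<integral>\<^sup>+x. ennreal ((f x)\<^sup>2) \<partial>lborel) \<le> ennreal (B\<^sup>2)" "0 \<le> B"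
  shows "norm (of_fun f) \<le> B"
proof -
  have "(\<integral>\<^sup>+x. ennreal ((f x)\<^sup>2) \<partial>lborel) = ennreal ((norm (of_fun f))\<^sup>2)"
    unfolding norm_of_fun_square[OF assms(1)]
    using assms(1) by (intro nn_integral_eq_integral) (auto simp: square_integrable_def)
  with assms(2,3) show ?thesis by (simp add: power_mono_iff)
qed

text \<open>Riesz--Fischer: along a subsequence whose increments have norms summing to at most \<open>2\<close>,
  the partial sums of the absolute increments stay bounded in \<open>L\<^sup>2\<close>, so by monotone convergence the
  subsequence converges almost everywhere; Fatou's lemma identifies the \<open>L\<^sup>2\<close> limit.\<close>

lemma l2_Cauchy_convergent:
  fixes v :: "nat \<Rightarrow> 'n::finite l2"
  assumes "Cauchy v"
  shows "convergent v"
proof -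
  have "\<exists>r::nat\<Rightarrow>nat. \<forall>n. (\<forall>i\<ge>r n. \<forall>j\<ge>r n. dist (v i) (v j) < (1 / 2) ^ n) \<and> r n < r (Suc n)"
  proof (intro dependent_nat_choice)
    show "\<exists>x. \<forall>i\<ge>x. \<forall>j\<ge>x. dist (v i) (v j) < (1 / 2) ^ 0"
      using metric_CauchyD[OF assms, of "(1/2)^0"] by auto
    fix x n
    obtain N where "\<forall>i\<ge>N. \<forall>j\<ge>N. dist (v i) (v j) < (1 / 2) ^ Suc n"
      using metric_CauchyD[OF assms, of "(1/2)^Suc n"] by auto
    then show "\<exists>y. (\<forall>i\<ge>y. \<forall>j\<ge>y. dist (v i) (v j) < (1 / 2) ^ Suc n) \<and> x < y"
      by (intro exI[of _ "max N (Suc x)"]) auto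
  qed
  then obtain r :: "nat \<Rightarrow> nat" where
    r: "\<And>n i j. i \<ge> r n \<Longrightarrow> j \<ge> r n \<Longrightarrow> dist (v i) (v j) < (1 / 2) ^ n" "strict_mono r"
    by (auto simp: strict_mono_Suc_iff)
  define w where "w n = v (r n)" for n
  have wd: "norm (w m - w n) < (1 / 2) ^ n" if "n \<le> m" for m n
    unfolding w_def dist_norm[symmetric]
    using strict_mono_mono[OF r(2)] that by (intro r(1)) (auto simp: mono_def)
  define a where "a i = (\<lambda>x. \<bar>fun_of (w (Suc i) - w i) x\<bar>)" for i
  have a: "square_integrable (a i)" "norm (of_fun (a i)) \<le> (1 / 2) ^ i" for i
  proof -
    show sq: "square_integrable (a i)"
      using square_integrable_fun_of[of "w (Suc i) - w i"] by (auto simp: square_integrable_def a_def)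
    have "(norm (of_fun (a i)))\<^sup>2 = (norm (w (Suc i) - w i))\<^sup>2"
      unfolding norm_of_fun_square[OF sq] unfolding norm_l2_square by (simp add: a_def)
    then have "norm (of_fun (a i)) = norm (w (Suc i) - w i)" by simp
    then show "norm (of_fun (a i)) \<le> (1 / 2) ^ i" using wd[of i "Suc i"] by simp
  qed
  define g where "g n = (\<Sum>i<n. of_fun (a i))" for n
  have g: "AE x in lborel. fun_of (g n) x = (\<Sum>i<n. a i x)" for n
  proof (induction n)
    case 0
    show ?case using fun_of_0 by (simp add: g_def)
  next
    case (Suc n)
    show ?case
      using Suc fun_of_add[of "g n" "of_fun (a n)"] fun_of_of_fun[OF a(1)[of n]]
      by eventually_elim (simp add: g_def)
  qed
  have ng: "norm (g n) \<le> 2" for n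
  proof -
    have "norm (g n) \<le> (\<Sum>i<n. (1 / 2) ^ i)"
      unfolding g_def by (rule order.trans[OF norm_sum sum_mono]) (rule a(2))
    also have "\<dots> \<le> 2" by (simp add: sum_gp_strict)
    finally show ?thesis .
  qed
  have am: "a i \<in> borel_measurable borel" for i
    using a(1)[of i] by (simp add: square_integrable_def)
  have "(\<integral>\<^sup>+x. (SUP n. ennreal ((\<Sum>i<n. a i x)\<^sup>2)) \<partial>lborel) = (SUP n. \<integral>\<^sup>+x. ennreal ((\<Sum>i<n. a i x)\<^sup>2) \<partial>lborel)"
    using am by (intro nn_integral_monotone_convergence_SUP)
      (auto simp: incseq_Suc_iff le_fun_def a_def intro!: ennreal_leI power_mono sum_nonneg)
  also have "\<dots> \<le> 4"
  proof (rule SUP_least)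
    fix n
    have "(\<integral>\<^sup>+x. ennreal ((\<Sum>i<n. a i x)\<^sup>2) \<partial>lborel) = (\<integral>\<^sup>+x. ennreal ((fun_of (g n) x)\<^sup>2) \<partial>lborel)"
      using g[of n] by (intro nn_integral_cong_AE) (auto elim: eventually_mono)
    also have "\<dots> \<le> ennreal (2\<^sup>2)"
      unfolding nn_integral_fun_of_square by (intro ennreal_leI power_mono ng) simp
    finally show "(\<integral>\<^sup>+x. ennreal ((\<Sum>i<n. a i x)\<^sup>2) \<partial>lborel) \<le> 4" by simp
  qed
  also have "\<dots> < \<infinity>" by simp
  finally have fin: "AE x in lborel. (SUP n. ennreal ((\<Sum>i<n. a i x)\<^sup>2)) < \<infinity>"
    using am by (intro finite_nn_integral_imp_ae_finite) auto
  \<comment> \<open>\<open>fun_of\<close> is additive only off a null set that depends on the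
    vectors; countably many of them leave one common null set.\<close>
  have dif: "AE x in lborel. \<forall>i. fun_of (w (Suc i) - w i) x = fun_of (w (Suc i)) x - fun_of (w i) x"
    by (subst AE_all_countable) (intro allI fun_of_diff)
  have conv: "AE x in lborel. convergent (\<lambda>n. fun_of (w n) x)"
    using fin dif
  proof eventually_elim
    fix x
    assume fin: "(SUP n. ennreal ((\<Sum>i<n. a i x)\<^sup>2)) < \<infinity>"
      and dif: "\<forall>i. fun_of (w (Suc i) - w i) x = fun_of (w (Suc i)) x - fun_of (w i) x"
    then obtain B where B: "0 \<le> B" "(SUP n. ennreal ((\<Sum>i<n. a i x)\<^sup>2)) = ennreal B"
      by (cases "SUP n. ennreal ((\<Sum>i<n. a i x)\<^sup>2)") auto
    have "(\<Sum>i<n. a i x) \<le> sqrt B" for n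
    proof -
      have "ennreal ((\<Sum>i<n. a i x)\<^sup>2) \<le> ennreal B" unfolding B(2)[symmetric] by (rule SUP_upper) simp
      then show ?thesis using B(1) by (intro real_le_rsqrt) simp
    qed
    then have "summable (\<lambda>i. a i x)"
      by (intro bounded_imp_summable[of _ "sqrt B"])
        (auto simp: a_def lessThan_Suc_atMost[symmetric] simp del: sum.lessThan_Suc)
    then have "summable (\<lambda>i. fun_of (w (Suc i)) x - fun_of (w i) x)"
      unfolding a_def dif[rule_format] by (rule summable_rabs_cancel)
    then have "convergent (\<lambda>n. \<Sum>i<n. fun_of (w (Suc i)) x - fun_of (w i) x)"
      by (simp add: summable_iff_convergent)
    then have "convergent (\<lambda>n. fun_of (w n) x - fun_of (w 0) x)"
      by (simp only: sum_lessThan_telescope[of "\<lambda>i. fun_of (w i) x"])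
    from convergent_add[OF this convergent_const[of "fun_of (w 0) x"]]
    show "convergent (\<lambda>n. fun_of (w n) x)" by simp
  qed
  define f where "f x = lim (\<lambda>n. fun_of (w n) x)" for x
  have fm [measurable]: "f \<in> borel_measurable borel" unfolding f_def by measurable
  have lim: "AE x in lborel. (\<lambda>n. fun_of (w n) x) \<longlonglongrightarrow> f x"
    using conv by eventually_elim (simp add: f_def convergent_LIMSEQ_iff)
  have fat: "(\<integral>\<^sup>+x. ennreal ((f x - fun_of (w n) x)\<^sup>2) \<partial>lborel) \<le> ennreal (((1 / 2) ^ n)\<^sup>2)" for n
  proof -
    have "AE x in lborel. \<forall>m. fun_of (w m - w n) x = fun_of (w m) x - fun_of (w n) x"
      by (subst AE_all_countable) (intro allI fun_of_diff)
    then have "AE x in lborel. ennreal ((f x - fun_of (w n) x)\<^sup>2)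
        = liminf (\<lambda>m. ennreal ((fun_of (w m - w n) x)\<^sup>2))"
      using lim
    proof eventually_elim
      case (elim x)
      have "(\<lambda>m. ennreal ((fun_of (w m) x - fun_of (w n) x)\<^sup>2)) \<longlonglongrightarrow> ennreal ((f x - fun_of (w n) x)\<^sup>2)"
        by (intro tendsto_ennrealI tendsto_intros elim(2))
      then show ?case unfolding elim(1)[rule_format] by (intro lim_imp_Liminf[symmetric]) auto
    qed
    then have "(\<integral>\<^sup>+x. ennreal ((f x - fun_of (w n) x)\<^sup>2) \<partial>lborel)
        = (\<integral>\<^sup>+x. liminf (\<lambda>m. ennreal ((fun_of (w m - w n) x)\<^sup>2)) \<partial>lborel)"
      by (rule nn_integral_cong_AE)
    also have "\<dots> \<le> liminf (\<lambda>m. \<integral>\<^sup>+x. ennreal ((fun_of (w m - w n) x)\<^sup>2) \<partial>lborel)"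
      by (rule nn_integral_liminf) measurable
    also have "\<dots> \<le> ennreal (((1 / 2) ^ n)\<^sup>2)"
    proof (rule Liminf_le)
      show "\<forall>\<^sub>F m in sequentially. (\<integral>\<^sup>+x. ennreal ((fun_of (w m - w n) x)\<^sup>2) \<partial>lborel) \<le> ennreal (((1 / 2) ^ n)\<^sup>2)"
        unfolding nn_integral_fun_of_square eventually_sequentially
        using wd by (intro exI[of _ n] allI impI ennreal_leI power_mono) (auto intro: less_imp_le)
    qed simp
    finally show ?thesis .
  qed
  have sqd: "square_integrable (\<lambda>x. f x - fun_of (w n) x)" for n
    unfolding square_integrable_iff_nn_integral
    using fat[of n] by (auto intro: le_less_trans)
  have sqf: "square_integrable f"
    using square_integrable_add[OF sqd[of 0] square_integrable_fun_of[of "w 0"]] by simp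
  have nd: "norm (of_fun f - w n) \<le> (1 / 2) ^ n" for n
  proof -
    have "AE x in lborel. fun_of (of_fun f - w n) x = fun_of (of_fun (\<lambda>x. f x - fun_of (w n) x)) x"
      using fun_of_of_fun[OF sqf] fun_of_diff[of "of_fun f" "w n"] fun_of_of_fun[OF sqd[of n]]
      by eventually_elim simp
    then have "of_fun f - w n = of_fun (\<lambda>x. f x - fun_of (w n) x)" by (rule l2_eqI)
    then show ?thesis using norm_of_fun_le[OF sqd fat] by simp
  qed
  have "w \<longlonglongrightarrow> of_fun f"
  proof (rule LIMSEQ_iff[THEN iffD2, rule_format])
    fix e :: real assume "0 < e"
    then obtain N where N: "(1 / 2) ^ N < e" using real_arch_pow_inv[of e "1/2"] by auto
    have "norm (w n - of_fun f) < e" if "n \<ge> N" for n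
    proof -
      have "norm (w n - of_fun f) \<le> (1 / 2) ^ n" using nd[of n] by (simp add: norm_minus_commute)
      also have "\<dots> \<le> (1 / 2) ^ N" using that by (intro power_decreasing) auto
      finally show ?thesis using N by simp
    qed
    then show "\<exists>no. \<forall>n\<ge>no. norm (w n - of_fun f) < e" by blast
  qed
  then show ?thesis
    using Cauchy_converges_subseq[OF assms r(2)] by (auto simp: w_def[abs_def] o_def convergent_def)
qed

text \<open>The inner product equals the integral of the square of \<open>v\<close> outside
  \<Omega>. In this form membership survives limits: each member of the sequence is orthogonal to
  the part of the limit outside \<Omega>.\<close>

lemma L2_iff_inner: "v \<in> L2 \<Omega> \<longleftrightarrow> v \<bullet> of_fun (\<lambda>x. indicator (- \<Omega>) x * fun_of v x) = 0"
  if \<Omega>: "\<Omega> \<in> sets borel"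
proof -
  let ?f = "\<lambda>x. indicator (- \<Omega>) x * fun_of v x"
  have m: "?f \<in> borel_measurable borel" using \<Omega> by measurable
  have int: "integrable lborel (\<lambda>x. (fun_of v x)\<^sup>2)"
    using square_integrable_fun_of[of v] by (simp add: square_integrable_def)
  have int2: "integrable lborel (\<lambda>x. (?f x)\<^sup>2)"
    using m by (intro Bochner_Integration.integrable_bound[OF int]) (auto simp: indicator_def)
  then have sq: "square_integrable ?f" using m by (simp add: square_integrable_def)
  have "v \<bullet> of_fun ?f = (LINT x|lborel. (?f x)\<^sup>2)"
    unfolding inner_of_fun_right[OF sq]
    by (intro Bochner_Integration.integral_cong refl) (auto simp: indicator_def power2_eq_square)
  also have "\<dots> = 0 \<longleftrightarrow> (AE x in lborel. (?f x)\<^sup>2 = 0)"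
    by (rule integral_nonneg_eq_0_iff_AE[OF int2]) simp
  also have "\<dots> \<longleftrightarrow> v \<in> L2 \<Omega>"
    unfolding L2_def mem_Collect_eq by (intro AE_cong) (auto simp: indicator_def)
  finally show ?thesis ..
qed

lemma complete_L2:
  assumes \<Omega>: "\<Omega> \<in> sets borel"
  shows "complete (L2 \<Omega>)"
  unfolding complete_def
proof (intro allI impI)
  fix v assume v: "(\<forall>n. v n \<in> L2 \<Omega>) \<and> Cauchy v"
  then obtain l where l: "v \<longlonglongrightarrow> l" using l2_Cauchy_convergent by (auto simp: convergent_def)
  let ?f = "\<lambda>x. indicator (- \<Omega>) x * fun_of l x"
  have m: "?f \<in> borel_measurable borel" using \<Omega> by measurable
  have "integrable lborel (\<lambda>x. (fun_of l x)\<^sup>2)"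
    using square_integrable_fun_of[of l] by (simp add: square_integrable_def)
  then have sq: "square_integrable ?f"
    unfolding square_integrable_def using m
    by (auto intro!: Bochner_Integration.integrable_bound[of lborel "\<lambda>x. (fun_of l x)\<^sup>2"] simp: indicator_def)
  have "v n \<bullet> of_fun ?f = 0" for n
  proof -
    have "AE x in lborel. fun_of (v n) x * ?f x = 0"
      using v by (auto simp: L2_def indicator_def elim!: allE[of _ n] eventually_mono)
    then show ?thesis unfolding inner_of_fun_right[OF sq] by (rule integral_eq_zero_AE)
  qed
  then have "(\<lambda>n. 0) \<longlonglongrightarrow> l \<bullet> of_fun ?f" using tendsto_inner[OF l tendsto_const, of "of_fun ?f"] by simp
  then have "l \<bullet> of_fun ?f = 0" by (simp add: LIMSEQ_const_iff)
  then have "l \<in> L2 \<Omega>" using L2_iff_inner[OF \<Omega>] by blast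
  with l show "\<exists>l\<in>L2 \<Omega>. v \<longlonglongrightarrow> l" by blast
qed

section \<open>Density of test functions\<close>

text \<open>The functions \<open>flat p\<close> form a class of functions on the line, flat at the origin, that is closed
  under differentiation.\<close>

definition flat :: "real poly \<Rightarrow> real \<Rightarrow> real" where
  "flat p t = (if 0 < t then poly p (1 / t) * exp (- (1 / t)) else 0)"

text \<open>The chain rule in the variable \<open>1 / t\<close>: the derivative of
  \<open>p (1 / t) * exp (- (1 / t))\<close> is
  \<open>(1 / t)\<^sup>2 * (p - p') (1 / t) * exp (- (1 / t))\<close>.\<close>

definition flat_deriv :: "real poly \<Rightarrow> real poly" where
  "flat_deriv p = monom 1 2 * (p - pderiv p)"

lemma flat_tendsto_0: "(flat p \<longlongrightarrow> 0) (at 0)"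
proof -
  have "((\<lambda>x. \<Sum>i\<le>degree p. coeff p i * (x ^ i / exp x)) \<longlongrightarrow> (\<Sum>i\<le>degree p. coeff p i * 0)) at_top"
    by (intro tendsto_intros tendsto_power_div_exp_0)
  then have *: "((\<lambda>x. poly p x * exp (- x)) \<longlongrightarrow> 0) at_top"
    by (simp add: poly_altdef sum_distrib_right exp_minus divide_inverse mult.assoc)
  have "((\<lambda>t. poly p (1 / t) * exp (- (1 / t))) \<longlongrightarrow> 0) (at_right 0)"
    using filterlim_compose[OF * filterlim_inverse_at_top_right] by (simp add: inverse_eq_divide)
  then have "(flat p \<longlongrightarrow> 0) (at_right 0)"
    by (rule Lim_transform_eventually) (auto simp: flat_def eventually_at_filter)
  moreover have "(flat p \<longlongrightarrow> 0) (at_left 0)"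
    by (rule Lim_transform_eventually[OF tendsto_const]) (auto simp: flat_def eventually_at_filter)
  ultimately show ?thesis by (simp add: filterlim_split_at)
qed

lemma flat_has_derivative [derivative_intros]: "(flat p has_real_derivative flat (flat_deriv p) t) (at t)"
proof (cases t "0::real" rule: linorder_cases)
  case less
  have "((\<lambda>_. 0) has_real_derivative 0) (at t)" by simp
  then have "(flat p has_real_derivative 0) (at t)"
    by (rule has_field_derivative_transform_within_open[of _ _ _ "{..<0}"]) (use less in \<open>auto simp: flat_def\<close>)
  then show ?thesis using less by (simp add: flat_def)
next
  case greater
  have "((\<lambda>t. poly p (1 / t) * exp (- (1 / t))) has_real_derivative flat (flat_deriv p) t) (at t)"
    using greater
    by (auto intro!: derivative_eq_intros DERIV_chain2[of "poly p" _ "\<lambda>t. 1 / t"]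
        simp: flat_def flat_deriv_def poly_monom power2_eq_square field_simps)
  then show ?thesis
    by (rule has_field_derivative_transform_within_open[of _ _ _ "{0<..}"]) (use greater in \<open>auto simp: flat_def\<close>)
next
  case equal
  have "((\<lambda>h. (flat p (0 + h) - flat p 0) / h) \<longlongrightarrow> 0) (at 0)"
    \<comment> \<open>Dividing by \<open>h\<close> multiplies the polynomial by its variable, so the
      difference quotient at 0 is again a flat function.\<close>
    by (rule Lim_transform_eventually[OF flat_tendsto_0[of "pCons 0 p"]])
      (auto simp: flat_def eventually_at_filter)
  then show ?thesis using equal by (simp add: DERIV_def flat_def)
qed

text \<open>Carries a function of one variable together with all its derivatives, \<open>F j\<close>
  being the j-th one, so that mixed partials of products over the coordinates have a closed
  form.\<close>

definition smooth_sequence :: "(nat \<Rightarrow> real \<Rightarrow> real) \<Rightarrow> bool" where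
  "smooth_sequence F \<longleftrightarrow> (\<forall>j t. (F j has_real_derivative F (Suc j) t) (at t))"

text \<open>Finite sums of products \<open>flat p (k * (t - a)) * flat q (k * (b - t))\<close> are
  closed under differentiation. Lists of pairs of polynomials represent them, and \<open>D\<close>
  is the product rule with inner derivatives \<open>k\<close> and \<open>- k\<close>.\<close>

lemma smooth_bump_1D:
  obtains F where "smooth_sequence F" "F 0 = (\<lambda>t. flat 1 (k * (t - a)) * flat 1 (k * (b - t)))"
proof -
  define D where "D xs = concat (map (\<lambda>(p, q). [(smult k (flat_deriv p), q), (p, smult (- k) (flat_deriv q))]) xs)"
    for xs :: "(real poly \<times> real poly) list"
  define G where "G xs t = (\<Sum>(p, q)\<leftarrow>xs. flat p (k * (t - a)) * flat q (k * (b - t)))" for xs t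
  have flat_smult: "flat (smult c p) t = c * flat p t" "flat (- p) t = - flat p t" for c p t
    by (simp_all add: flat_def)
  have "(G xs has_real_derivative G (D xs) t) (at t)" for xs t
  proof (induction xs)
    case Nil
    show ?case by (simp add: G_def[abs_def] D_def)
  next
    case (Cons pq xs)
    obtain p q where pq: "pq = (p, q)" by force
    have "((\<lambda>t. flat p (k * (t - a)) * flat q (k * (b - t))) has_real_derivative
        (flat (flat_deriv p) (k * (t - a)) * k) * flat q (k * (b - t))
        + (flat (flat_deriv q) (k * (b - t)) * (- k)) * flat p (k * (t - a))) (at t)"
      by (intro DERIV_mult DERIV_chain2[OF flat_has_derivative]) (auto intro!: derivative_eq_intros)
    from DERIV_add[OF this Cons.IH] show ?case
      by (simp add: pq G_def[abs_def] D_def flat_smult algebra_simps)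
  qed
  then have "smooth_sequence (\<lambda>j. G ((D ^^ j) [(1, 1)]))" by (simp add: smooth_sequence_def)
  moreover have "G ((D ^^ 0) [(1, 1)]) = (\<lambda>t. flat 1 (k * (t - a)) * flat 1 (k * (b - t)))"
    by (simp add: G_def[abs_def])
  ultimately show thesis by (rule that)
qed

lemma has_derivative_prod_coordinates:
  fixes f f' :: "'n::finite \<Rightarrow> real \<Rightarrow> real"
  assumes "\<And>i t. (f i has_real_derivative f' i t) (at t)"
  shows "((\<lambda>x::real^'n. \<Prod>i\<in>UNIV. f i (x $ i)) has_derivative
    (\<lambda>y. \<Sum>i\<in>UNIV. (f' i (x $ i) * y $ i) * (\<Prod>j\<in>UNIV - {i}. f j (x $ j)))) (at x)"
proof (rule has_derivative_prod)
  fix i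
  show "((\<lambda>x::real^'n. f i (x $ i)) has_derivative (\<lambda>y. f' i (x $ i) * y $ i)) (at x)"
    using DERIV_compose_FDERIV[OF assms bounded_linear_imp_has_derivative[OF bounded_linear_vec_nth]]
    by (simp add: mult.commute)
qed

lemma partials_prod_coordinates:
  fixes F :: "'n::finite \<Rightarrow> nat \<Rightarrow> real \<Rightarrow> real"
  assumes "\<And>i. smooth_sequence (F i)"
  shows "partials is (\<lambda>x. \<Prod>i\<in>UNIV. F i 0 (x $ i)) = (\<lambda>x. \<Prod>i\<in>UNIV. F i (count_list is i) (x $ i))"
proof (induction "is")
  case (Cons j js)
  show ?case
  proof
    fix x :: "real^'n"
    have *: "((\<lambda>x::real^'n. \<Prod>i\<in>UNIV. F i (count_list js i) (x $ i)) has_derivative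
      (\<lambda>y. \<Sum>i\<in>UNIV. (F i (Suc (count_list js i)) (x $ i) * y $ i) * (\<Prod>k\<in>UNIV - {i}. F k (count_list js k) (x $ k)))) (at x)"
      using assms by (intro has_derivative_prod_coordinates) (simp add: smooth_sequence_def)
    have "partials (j # js) (\<lambda>x. \<Prod>i\<in>UNIV. F i 0 (x $ i)) x =
      (\<Sum>i\<in>UNIV. (F i (Suc (count_list js i)) (x $ i) * axis j 1 $ i) * (\<Prod>k\<in>UNIV - {i}. F k (count_list js k) (x $ k)))"
      by (simp add: Cons.IH partial_def frechet_derivative_at[OF *, symmetric])
    also have "\<dots> = (\<Sum>i\<in>UNIV. if i = j then F i (Suc (count_list js i)) (x $ i) * (\<Prod>k\<in>UNIV - {i}. F k (count_list js k) (x $ k)) else 0)"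
      by (intro sum.cong refl) (auto simp: axis_def)
    also have "\<dots> = F j (Suc (count_list js j)) (x $ j) * (\<Prod>k\<in>UNIV - {j}. F k (count_list (j # js) k) (x $ k))"
      by (auto simp: sum.delta intro!: disjI2 prod.cong)
    also have "\<dots> = (\<Prod>i\<in>UNIV. F i (count_list (j # js) i) (x $ i))"
      by (subst prod.remove[of UNIV j]) auto
    finally show "partials (j # js) (\<lambda>x. \<Prod>i\<in>UNIV. F i 0 (x $ i)) x = (\<Prod>i\<in>UNIV. F i (count_list (j # js) i) (x $ i))" .
  qed
qed simp

lemma smooth_on_prod_coordinates:
  fixes F :: "'n::finite \<Rightarrow> nat \<Rightarrow> real \<Rightarrow> real"
  assumes "\<And>i. smooth_sequence (F i)"
  shows "smooth_on UNIV (\<lambda>x. \<Prod>i\<in>UNIV. F i 0 (x $ i))"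
  unfolding smooth_on_def partials_prod_coordinates[of F, OF assms]
  using has_derivative_prod_coordinates[of "\<lambda>i. F i (count_list is i)" "\<lambda>i. F i (Suc (count_list is i))" for "is"]
    assms unfolding differentiable_def smooth_sequence_def by fast

text \<open>The argument of the bump is scaled, not its support:
  \<open>exp (- (1 / (k * s)))\<close> tends to 1 for each positive \<open>s\<close>, while every
  bump vanishes off the same open box. The closed box in \<Omega> absorbs the closure taken in
  \<open>test_functions\<close>.\<close>

lemma indicator_box_limit_of_test_functions:
  fixes a b :: "real^'n::finite"
  assumes "cbox a b \<subseteq> \<Omega>"
  obtains \<phi> where "\<And>k. \<phi> k \<in> test_functions \<Omega>" "\<And>k x. 0 \<le> \<phi> k x" "\<And>k x. \<phi> k x \<le> indicator (box a b) x"
    "\<And>x. (\<lambda>k. \<phi> k x) \<longlonglongrightarrow> indicator (box a b) x"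
proof -
  \<comment> \<open>\<open>Suc k\<close> keeps the scaling factor positive for all
    \<open>k\<close>.\<close>
  define g where "g k i t = flat 1 (real (Suc k) * (t - a $ i)) * flat 1 (real (Suc k) * (b $ i - t))" for k i t
  have "\<forall>k i. \<exists>F. smooth_sequence F \<and> F 0 = g k i" unfolding g_def by (metis smooth_bump_1D)
  then obtain F where F: "\<And>k i. smooth_sequence (F k i)" "\<And>k i. F k i 0 = g k i" by metis
  define \<phi> where "\<phi> k x = (\<Prod>i\<in>UNIV. g k i (x $ i))" for k and x :: "real^'n"
  have g01: "0 \<le> g k i t" "g k i t \<le> 1" for k i t
    by (auto simp: g_def flat_def mult_nonneg_nonneg mult_le_one)
  have out: "\<phi> k x = 0" if x: "x \<notin> box a b" for k x
  proof -
    obtain i where "\<not> (a $ i < x $ i \<and> x $ i < b $ i)" using x unfolding mem_box_cart by blast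
    then have "g k i (x $ i) = 0" by (auto simp: g_def flat_def zero_less_mult_iff)
    then show ?thesis by (auto simp: \<phi>_def intro!: prod_zero)
  qed
  show thesis
  proof
    fix k
    have "smooth_on UNIV (\<phi> k)" using smooth_on_prod_coordinates[of "F k"] F by (simp add: \<phi>_def[abs_def])
    moreover have "closure {x. \<phi> k x \<noteq> 0} \<subseteq> cbox a b"
      using out box_subset_cbox[of a b] by (intro closure_minimal closed_cbox) auto
    ultimately show "\<phi> k \<in> test_functions \<Omega>"
      using assms compact_Int_closed[OF compact_cbox, of "closure {x. \<phi> k x \<noteq> 0}" a b]
      by (auto simp: test_functions_def Int_absorb1 simp del: compact_closure)
    show "0 \<le> \<phi> k x" for x unfolding \<phi>_def by (intro prod_nonneg g01 ballI)
    show "\<phi> k x \<le> indicator (box a b) x" for x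
    proof (cases "x \<in> box a b")
      case True
      have "\<phi> k x \<le> 1" unfolding \<phi>_def using g01 by (intro prod_le_1) auto
      then show ?thesis using True by simp
    qed (simp add: out)
  next
    fix x
    show "(\<lambda>k. \<phi> k x) \<longlonglongrightarrow> indicator (box a b) x"
    proof (cases "x \<in> box a b")
      case True
      have e: "(\<lambda>k. exp (- (1 / (real (Suc k) * s)))) \<longlonglongrightarrow> 1" if "0 < s" for s
      proof -
        have "(\<lambda>k. exp (- (inverse (real (Suc k)) * (1 / s)))) \<longlonglongrightarrow> exp (- (0 * (1 / s)))"
          by (intro tendsto_intros LIMSEQ_inverse_real_of_nat)
        then show ?thesis by (simp add: field_simps)
      qed
      have g1: "(\<lambda>k. g k i (x $ i)) \<longlonglongrightarrow> 1" for i
      proof -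
        have i: "0 < x $ i - a $ i" "0 < b $ i - x $ i" using True by (auto simp: mem_box_cart)
        have "g k i (x $ i) = exp (- (1 / (real (Suc k) * (x $ i - a $ i)))) * exp (- (1 / (real (Suc k) * (b $ i - x $ i))))" for k
          using i by (simp add: g_def flat_def del: of_nat_Suc)
        then show ?thesis using tendsto_mult[OF e[OF i(1)] e[OF i(2)]] by simp
      qed
      have "(\<lambda>k. \<phi> k x) \<longlonglongrightarrow> (\<Prod>i\<in>(UNIV :: 'n set). 1)"
        unfolding \<phi>_def by (rule tendsto_prod) (rule g1)
      then show ?thesis using True by simp
    qed (simp add: out)
  qed
qed

section \<open>The fundamental lemma of the calculus of variations\<close>

lemma smooth_on_imp_continuous_on: "smooth_on U f \<Longrightarrow> continuous_on U f"
  unfolding smooth_on_def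
  by (metis partials.simps(1) continuous_at_imp_continuous_on differentiable_imp_continuous_within)

text \<open>Dynkin's argument: boxes form an intersection-stable generator of the Borel sets, and
  \<open>tot\<close> settles complements. The sets where \<open>h\<close> is positive and where it
  is negative then show that the absolute value has integral 0.\<close>

lemma AE_zero_if_integral_box_zero:
  fixes h :: "'a::euclidean_space \<Rightarrow> real"
  assumes int: "integrable lborel h" and box: "\<And>c d. (LINT x:box c d|lborel. h x) = 0" and tot: "(LINT x|lborel. h x) = 0"
  shows "AE x in lborel. h x = 0"
proof -
  have si: "set_integrable lborel A h" if "A \<in> sets borel" for A
    unfolding set_integrable_def using int that by (intro integrable_mult_indicator) auto
  have z: "(LINT x:A|lborel. h x) = 0" if "A \<in> sets borel" for A
  proof -
    have A: "A \<in> sigma_sets UNIV (range (\<lambda>(a, b). box a b))" using that unfolding borel_eq_box by simp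
    have "Int_stable (range (\<lambda>(a, b). box a b :: 'a set))" by (auto simp: Int_stable_def box_Int_box)
    moreover have "range (\<lambda>(a, b). box a b :: 'a set) \<subseteq> Pow UNIV" by simp
    ultimately show ?thesis using A
    proof (induction rule: sigma_sets_induct_disjoint)
      case (basic A)
      then show ?case using box by auto
    next
      case empty
      show ?case by (simp add: set_lebesgue_integral_def)
    next
      case (compl A)
      then have A: "A \<in> sets borel" unfolding borel_eq_box by simp
      have "(LINT x:A \<union> (UNIV - A)|lborel. h x) = (LINT x:A|lborel. h x) + (LINT x:UNIV - A|lborel. h x)"
        using A by (intro set_integral_Un si) auto
      then show ?case using compl(2) tot by (simp add: set_lebesgue_integral_def)
    next
      case (union A)
      then have A: "A i \<in> sets borel" for i unfolding borel_eq_box by auto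
      have "(LINT x:(\<Union>i. A i)|lborel. h x) = (\<Sum>i. (LINT x:(A i)|lborel. h x))"
        using A union(1) by (intro lebesgue_integral_countable_add si) (auto simp: disjoint_family_on_def)
      then show ?case using union(3) by simp
    qed
  qed
  have m: "h \<in> borel_measurable borel" using int by auto
  then have P: "{x. 0 < h x} \<in> sets borel" "{x. h x < 0} \<in> sets borel" by measurable
  have "\<bar>h x\<bar> = indicator {x. 0 < h x} x *\<^sub>R h x - indicator {x. h x < 0} x *\<^sub>R h x" for x
    by (auto simp: indicator_def)
  then have "(LINT x|lborel. \<bar>h x\<bar>) = (LINT x:{x. 0 < h x}|lborel. h x) - (LINT x:{x. h x < 0}|lborel. h x)"
    using si[OF P(1)] si[OF P(2)] unfolding set_lebesgue_integral_def set_integrable_def by simp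
  then have "(LINT x|lborel. \<bar>h x\<bar>) = 0" using z P by simp
  then show ?thesis using integral_nonneg_eq_0_iff_AE[of lborel "\<lambda>x. \<bar>h x\<bar>"] int by simp
qed

text \<open>Bumps approximating box indicators give zero integrals over all boxes with closed box in
  \<Omega>; smaller boxes inside such a box qualify too, so \<open>g\<close> vanishes almost
  everywhere on it. Lindelof's theorem reduces the cover of \<Omega> to countably many boxes, and
  membership in \<open>L2 \<Omega>\<close> handles the complement.\<close>

lemma test_function_orthogonal_imp_zero:
  fixes g :: "'n::finite l2"
  assumes \<Omega>: "open \<Omega>" and g: "g \<in> L2 \<Omega>"
    and orth: "\<And>\<phi>. \<phi> \<in> test_functions \<Omega> \<Longrightarrow> (LINT x|lborel. fun_of g x * \<phi> x) = 0"
  shows "g = 0"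
proof -
  have sqb: "square_integrable (indicator (box a b))" for a b :: "real^'n"
    unfolding square_integrable_def power2_eq_square indicator_inter_arith[symmetric]
    by (auto intro!: integrable_real_indicator simp: emeasure_lborel_box_eq)
  have intb: "integrable lborel (\<lambda>x. fun_of g x * indicator (box a b) x)" for a b
    by (rule integrable_mult_square_integrable[OF square_integrable_fun_of sqb])
  have zero: "(LINT x|lborel. fun_of g x * indicator (box a b) x) = 0" if ab: "cbox a b \<subseteq> \<Omega>" for a b
  proof -
    obtain \<phi> where \<phi>: "\<And>k. \<phi> k \<in> test_functions \<Omega>" "\<And>k x. 0 \<le> \<phi> k x"
      "\<And>k x. \<phi> k x \<le> indicator (box a b) x" "\<And>x. (\<lambda>k. \<phi> k x) \<longlonglongrightarrow> indicator (box a b) x"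
      by (rule indicator_box_limit_of_test_functions[OF ab]) blast
    have [measurable]: "\<phi> k \<in> borel_measurable borel" for k
      using \<phi>(1)[of k] by (auto simp: test_functions_def intro!: borel_measurable_continuous_onI smooth_on_imp_continuous_on)
    have "(\<lambda>k. LINT x|lborel. fun_of g x * \<phi> k x) \<longlonglongrightarrow> (LINT x|lborel. fun_of g x * indicator (box a b) x)"
    proof (rule integral_dominated_convergence)
      show "integrable lborel (\<lambda>x. \<bar>fun_of g x * indicator (box a b) x\<bar>)" using intb by simp
      show "AE x in lborel. (\<lambda>k. fun_of g x * \<phi> k x) \<longlonglongrightarrow> fun_of g x * indicator (box a b) x"
        by (intro AE_I2 tendsto_intros \<phi>)
      show "AE x in lborel. norm (fun_of g x * \<phi> k x) \<le> \<bar>fun_of g x * indicator (box a b) x\<bar>" for k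
        using \<phi>(2,3)[of k] by (intro AE_I2) (auto simp: abs_mult intro!: mult_left_mono)
    qed (auto intro: borel_measurable_integrable[OF intb])
    then show ?thesis using orth[OF \<phi>(1)] by (simp add: LIMSEQ_const_iff)
  qed
  have ae: "AE x in lborel. x \<in> box a b \<longrightarrow> fun_of g x = 0" if ab: "cbox a b \<subseteq> \<Omega>" for a b
  proof -
    have "AE x in lborel. fun_of g x * indicator (box a b) x = 0"
    proof (rule AE_zero_if_integral_box_zero[OF intb])
      fix c d :: "real^'n"
      have "(LINT x:box c d|lborel. fun_of g x * indicator (box a b) x) =
         (LINT x|lborel. fun_of g x * indicator (box a b \<inter> box c d) x)"
        unfolding set_lebesgue_integral_def by (intro Bochner_Integration.integral_cong) (auto simp: indicator_def)
      also have "\<dots> = 0"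
        unfolding box_Int_box
      proof (rule zero, rule order.trans[OF _ ab])
        show "cbox (\<Sum>i\<in>Basis. max (a \<bullet> i) (c \<bullet> i) *\<^sub>R i) (\<Sum>i\<in>Basis. min (b \<bullet> i) (d \<bullet> i) *\<^sub>R i) \<subseteq> cbox a b"
          by (auto simp: mem_box)
      qed
      finally show "(LINT x:box c d|lborel. fun_of g x * indicator (box a b) x) = 0" .
    qed (rule zero[OF ab])
    then show ?thesis by eventually_elim (auto simp: indicator_def)
  qed
  define \<F> where "\<F> = {box a b | a b. cbox a b \<subseteq> \<Omega>}"
  have "\<Omega> \<subseteq> \<Union>\<F>"
  proof
    fix x assume "x \<in> \<Omega>"
    then obtain e where e: "0 < e" "cball x e \<subseteq> \<Omega>" using \<Omega> by (meson open_contains_cball)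
    obtain a b where ab: "x \<in> box a b" "box a b \<subseteq> ball x e" using rational_boxes[OF e(1), of x] by blast
    have "cbox a b = closure (box a b)" using ab(1) by (metis closure_box empty_iff)
    also have "\<dots> \<subseteq> cball x e" using ab(2) ball_subset_cball by (intro closure_minimal) blast+
    finally show "x \<in> \<Union>\<F>" using e(2) ab(1) unfolding \<F>_def by blast
  qed
  moreover obtain \<F>' where F': "\<F>' \<subseteq> \<F>" "countable \<F>'" "\<Union>\<F>' = \<Union>\<F>"
    by (rule Lindelof[of \<F>]) (auto simp: \<F>_def)
  ultimately have "\<Omega> \<subseteq> \<Union>\<F>'" by simp
  have "AE x in lborel. \<forall>X\<in>\<F>'. x \<in> X \<longrightarrow> fun_of g x = 0"
    using F'(1) ae by (subst AE_ball_countable[OF F'(2)]) (auto simp: \<F>_def)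
  moreover have "AE x in lborel. x \<notin> \<Omega> \<longrightarrow> fun_of g x = 0" using g by (simp add: L2_def)
  ultimately have "AE x in lborel. fun_of g x = fun_of 0 x"
    using fun_of_0 by eventually_elim (use \<open>\<Omega> \<subseteq> \<Union>\<F>'\<close> in auto)
  then show ?thesis by (rule l2_eqI)
qed

section \<open>Differentiable functions with compact support\<close>

text \<open>One continuous derivative is what the translation estimate and integration by parts use,
  and the class is closed under products.\<close>

definition C1_compact :: "(real^'n \<Rightarrow> real) \<Rightarrow> bool" where
  "C1_compact f \<longleftrightarrow> (\<forall>x. f differentiable (at x)) \<and> (\<forall>i. continuous_on UNIV (partial i f)) \<and>
     bounded {x. f x \<noteq> 0}"

definition dir_deriv :: "(real^'n \<Rightarrow> real) \<Rightarrow> real^'n \<Rightarrow> real^'n \<Rightarrow> real" where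
  "dir_deriv f y x = (\<Sum>i\<in>UNIV. y $ i * partial i f x)"

lemma integral_lborel_translation:
  fixes g :: "'a::euclidean_space \<Rightarrow> real"
  assumes "g \<in> borel_measurable borel"
  shows "(LINT x|lborel. g (x + c)) = (LINT x|lborel. g x)"
proof -
  have "(LINT x|lborel. g x) = (LINT x|distr lborel borel ((+) c). g x)" by (simp only: lborel_distr_plus)
  also have "\<dots> = (LINT x|lborel. g (c + x))" by (rule integral_distr) (use assms in auto)
  finally show ?thesis by (simp add: add.commute)
qed

lemma nn_integral_lborel_translation:
  fixes g :: "'a::euclidean_space \<Rightarrow> ennreal"
  assumes "g \<in> borel_measurable borel"
  shows "(\<integral>\<^sup>+x. g (x + c) \<partial>lborel) = (\<integral>\<^sup>+x. g x \<partial>lborel)"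
proof -
  have "(\<integral>\<^sup>+x. g x \<partial>lborel) = (\<integral>\<^sup>+x. g x \<partial>distr lborel borel ((+) c))" by (simp only: lborel_distr_plus)
  also have "\<dots> = (\<integral>\<^sup>+x. g (c + x) \<partial>lborel)" by (rule nn_integral_distr) (use assms in auto)
  finally show ?thesis by (simp add: add.commute)
qed

text \<open>Provides the integrable majorant for the dominated convergence arguments below.\<close>

lemma continuous_bounded_support_bound:
  fixes g :: "real^'n \<Rightarrow> real"
  assumes "continuous_on UNIV g" "bounded {x. g x \<noteq> 0}"
  obtains M r where "0 \<le> M" "\<And>x. \<bar>g x\<bar> \<le> M * indicator (cball 0 r) x"
proof -
  obtain r where r: "\<And>x. g x \<noteq> 0 \<Longrightarrow> norm x \<le> r" using assms(2) by (auto simp: bounded_iff)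
  have "bounded (g ` cball 0 r)"
    by (intro compact_imp_bounded compact_continuous_image continuous_on_subset[OF assms(1)]) auto
  then obtain M where "\<forall>x\<in>cball 0 r. \<bar>g x\<bar> \<le> M" by (auto simp: bounded_iff)
  then have M: "\<bar>g x\<bar> \<le> M" if "norm x \<le> r" for x using that by simp
  show thesis
  proof
    show "\<bar>g x\<bar> \<le> max M 0 * indicator (cball 0 r) x" for x
      using r[of x] M[of x] by (cases "g x = 0") (auto simp: indicator_def max_def)
  qed simp
qed

lemma integrable_indicator_cball: "integrable lborel (\<lambda>x::real^'n. M * indicator (cball 0 r) x :: real)"
  using emeasure_bounded_finite[OF bounded_cball[of "0 :: real^'n" r]]
  by (intro integrable_mult_right integrable_real_indicator) auto

lemma integrable_if_le_indicator_cball: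
  fixes g :: "real^'n \<Rightarrow> real"
  assumes "g \<in> borel_measurable borel" "\<And>x. \<bar>g x\<bar> \<le> M * indicator (cball 0 r) x"
  shows "integrable lborel g"
  by (rule Bochner_Integration.integrable_bound[OF integrable_indicator_cball[of M r]])
    (use assms in \<open>auto intro!: AE_I2 intro: order_trans[OF _ abs_ge_self]\<close>)

lemma continuous_bounded_support_integrable:
  fixes g :: "real^'n \<Rightarrow> real"
  assumes "continuous_on UNIV g" "bounded {x. g x \<noteq> 0}"
  shows "integrable lborel g" "square_integrable g"
proof -
  have int: "integrable lborel f" if f: "continuous_on UNIV f" "bounded {x. f x \<noteq> 0}" for f :: "real^'n \<Rightarrow> real"
  proof -
    obtain M r where "0 \<le> M" "\<And>x. \<bar>f x\<bar> \<le> M * indicator (cball 0 r) x"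
      using continuous_bounded_support_bound[OF f] by blast
    then show ?thesis
      using that by (intro integrable_if_le_indicator_cball) (auto intro: borel_measurable_continuous_onI)
  qed
  show "integrable lborel g" by (rule int[OF assms])
  show "square_integrable g"
    unfolding square_integrable_def
    using assms by (auto intro!: borel_measurable_continuous_onI int continuous_intros)
qed

context
  fixes f :: "real^'n::finite \<Rightarrow> real"
  assumes f: "C1_compact f"
begin

lemma C1_compact_has_derivative: "(f has_derivative (\<lambda>y. dir_deriv f y x)) (at x)"
proof -
  have d: "(f has_derivative frechet_derivative f (at x)) (at x)"
    using f unfolding C1_compact_def by (simp add: frechet_derivative_works)
  then have lin: "linear (frechet_derivative f (at x))" by (rule has_derivative_linear)
  have "frechet_derivative f (at x) y = dir_deriv f y x" for y
  proof -
    have "frechet_derivative f (at x) y = frechet_derivative f (at x) (\<Sum>i\<in>UNIV. y $ i *\<^sub>R axis i 1)"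
      using basis_expansion[of y] by (simp add: scalar_mult_eq_scaleR)
    then show ?thesis by (simp add: linear_sum[OF lin] linear_scale[OF lin] dir_deriv_def partial_def)
  qed
  then have "frechet_derivative f (at x) = (\<lambda>y. dir_deriv f y x)" by blast
  with d show ?thesis by simp
qed

lemma C1_compact_continuous: "continuous_on UNIV f"
  by (intro continuous_at_imp_continuous_on ballI has_derivative_continuous[OF C1_compact_has_derivative])

lemma partial_eq_0_outside: "x \<notin> closure {x. f x \<noteq> 0} \<Longrightarrow> partial i f x = 0"
proof -
  assume x: "x \<notin> closure {x. f x \<noteq> 0}"
  have "((\<lambda>_. 0) has_derivative (\<lambda>_. 0)) (at x)" by simp
  then have "(f has_derivative (\<lambda>_. 0)) (at x)"
    by (rule has_derivative_transform_within_open[of _ _ _ _ "- closure {x. f x \<noteq> 0}"])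
      (use x closure_subset[of "{x. f x \<noteq> 0}"] in auto)
  then show ?thesis by (simp add: partial_def frechet_derivative_at[symmetric])
qed

lemma partial_bounded_support: "bounded {x. partial i f x \<noteq> 0}"
proof (rule bounded_subset)
  show "bounded (closure {x. f x \<noteq> 0})" using f by (simp add: C1_compact_def bounded_closure)
  show "{x. partial i f x \<noteq> 0} \<subseteq> closure {x. f x \<noteq> 0}" using partial_eq_0_outside by blast
qed

lemma C1_compact_square_integrable: "square_integrable f" "square_integrable (partial i f)"
  using f unfolding C1_compact_def
  by (intro continuous_bounded_support_integrable C1_compact_continuous partial_bounded_support; simp)+

lemma dir_deriv_continuous: "continuous_on UNIV (dir_deriv f y)"
  using f unfolding dir_deriv_def C1_compact_def by (intro continuous_intros) auto

lemma dir_deriv_bounded_support: "bounded {x. dir_deriv f y x \<noteq> 0}"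
proof (rule bounded_subset)
  show "bounded (closure {x. f x \<noteq> 0})" using f by (simp add: C1_compact_def bounded_closure)
  show "{x. dir_deriv f y x \<noteq> 0} \<subseteq> closure {x. f x \<noteq> 0}"
    using partial_eq_0_outside by (auto simp: dir_deriv_def intro: ccontr)
qed

lemma C1_compact_line: "((\<lambda>s. f (x + s *\<^sub>R y)) has_real_derivative dir_deriv f y (x + s *\<^sub>R y)) (at s)"
proof -
  have "((\<lambda>s. x + s *\<^sub>R y) has_derivative (\<lambda>h. h *\<^sub>R y)) (at s)"
    by (auto intro!: derivative_eq_intros)
  from has_derivative_compose[OF this C1_compact_has_derivative]
  have "((\<lambda>s. f (x + s *\<^sub>R y)) has_derivative (\<lambda>h. dir_deriv f (h *\<^sub>R y) (x + s *\<^sub>R y))) (at s)" .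
  moreover have "dir_deriv f (h *\<^sub>R y) z = dir_deriv f y z * h" for h z
    by (simp add: dir_deriv_def sum_distrib_left mult_ac)
  ultimately show ?thesis by (simp add: has_field_derivative_def)
qed

lemma difference_quotient_tendsto:
  "(\<lambda>n. (f (x + inverse (real (Suc n)) *\<^sub>R y) - f x) / inverse (real (Suc n))) \<longlonglongrightarrow> dir_deriv f y x"
proof -
  have "filterlim (\<lambda>n. inverse (real (Suc n))) (at 0) sequentially"
    by (intro filterlim_atI LIMSEQ_inverse_real_of_nat) auto
  moreover have "((\<lambda>h. (f (x + h *\<^sub>R y) - f x) / h) \<longlongrightarrow> dir_deriv f y x) (at 0)"
    using C1_compact_line[of x y 0] by (simp add: DERIV_def)
  ultimately show ?thesis by (rule filterlim_compose[rotated])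
qed

lemma difference_quotient_bound:
  obtains M r where "0 \<le> M"
    "\<And>x n. \<bar>(f (x + inverse (real (Suc n)) *\<^sub>R y) - f x) / inverse (real (Suc n))\<bar> \<le> M * indicator (cball 0 r) x"
proof -
  obtain M r where M: "0 \<le> M" "\<And>x. \<bar>dir_deriv f y x\<bar> \<le> M * indicator (cball 0 r) x"
    using continuous_bounded_support_bound[OF dir_deriv_continuous dir_deriv_bounded_support] by blast
  show thesis
  proof
    fix x and n :: nat
    let ?h = "inverse (real (Suc n))"
    have h: "0 < ?h" "?h \<le> 1" by (simp_all add: inverse_le_1_iff)
    obtain z where z: "0 < z" "z < ?h" "f (x + ?h *\<^sub>R y) - f (x + 0 *\<^sub>R y) = (?h - 0) * dir_deriv f y (x + z *\<^sub>R y)"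
      using MVT2[OF h(1), of "\<lambda>s. f (x + s *\<^sub>R y)" "\<lambda>s. dir_deriv f y (x + s *\<^sub>R y)"] C1_compact_line by blast
    have "\<bar>(f (x + ?h *\<^sub>R y) - f x) / ?h\<bar> = \<bar>dir_deriv f y (x + z *\<^sub>R y)\<bar>"
      using z(3) by simp
    also have "\<dots> \<le> M * indicator (cball 0 r) (x + z *\<^sub>R y)" by (rule M(2))
    \<comment> \<open>The intermediate point of the mean value theorem is displaced by at most
      \<open>norm y\<close>, as the step is at most 1; the enlarged ball serves all \<open>n\<close>
      at once.\<close>
    also have "\<dots> \<le> M * indicator (cball 0 (r + norm y)) x"
    proof -
      have "norm x \<le> norm (x + z *\<^sub>R y) + norm (z *\<^sub>R y)" using norm_triangle_ineq4[of "x + z *\<^sub>R y" "z *\<^sub>R y"] by simp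
      also have "norm (z *\<^sub>R y) \<le> norm y" using z h by (simp add: mult_left_le_one_le)
      finally show ?thesis using M(1) by (auto simp: indicator_def)
    qed
    finally show "\<bar>(f (x + ?h *\<^sub>R y) - f x) / ?h\<bar> \<le> M * indicator (cball 0 (r + norm y)) x" .
  qed (rule M(1))
qed

text \<open>Every difference quotient has integral 0 by translation invariance, and dominated
  convergence passes this to the derivative.\<close>

lemma integral_dir_deriv_eq_0: "(LINT x|lborel. dir_deriv f y x) = 0"
proof -
  obtain M r where M: "0 \<le> M"
    "\<And>x n. \<bar>(f (x + inverse (real (Suc n)) *\<^sub>R y) - f x) / inverse (real (Suc n))\<bar> \<le> M * indicator (cball 0 r) x"
    by (rule difference_quotient_bound[of y]) blast
  have fm [measurable]: "f \<in> borel_measurable borel" by (intro borel_measurable_continuous_onI C1_compact_continuous)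
  have [measurable]: "dir_deriv f y \<in> borel_measurable borel" by (intro borel_measurable_continuous_onI dir_deriv_continuous)
  have int: "integrable lborel f"
    using C1_compact_continuous f by (intro continuous_bounded_support_integrable) (auto simp: C1_compact_def)
  have "(\<lambda>n. LINT x|lborel. (f (x + inverse (real (Suc n)) *\<^sub>R y) - f x) / inverse (real (Suc n))) \<longlonglongrightarrow> (LINT x|lborel. dir_deriv f y x)"
  proof (rule integral_dominated_convergence[OF _ _ integrable_indicator_cball[of M r]])
    show "AE x in lborel. norm ((f (x + inverse (real (Suc n)) *\<^sub>R y) - f x) / inverse (real (Suc n)))
        \<le> M * indicator (cball 0 r) x" for n
      unfolding real_norm_def by (intro AE_I2 M)
  qed (auto intro!: difference_quotient_tendsto simp del: of_nat_Suc)
  moreover have z: "(LINT x|lborel. (f (x + c) - f x) / h) = 0" for c h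
  proof -
    have "integrable lborel (\<lambda>x. f (x + c))"
      using integrable_distr[of "(+) c" lborel borel f] int by (simp add: lborel_distr_plus add.commute)
    then show ?thesis using int integral_lborel_translation[OF fm, of c] by simp
  qed
  ultimately show ?thesis unfolding z by (simp add: LIMSEQ_const_iff)
qed

text \<open>The increment along \<open>y\<close> is cut into \<open>Suc n\<close> equal steps.
  Cauchy-Schwarz for the sum and translation invariance bound its square integral by that of the
  difference quotient with step \<open>inverse (Suc n)\<close>, for every \<open>n\<close>; the
  limit gives the derivative with constant 1.\<close>

lemma translation_le_dir_deriv:
  "(LINT x|lborel. (f (x + y) - f x)\<^sup>2) \<le> (LINT x|lborel. (dir_deriv f y x)\<^sup>2)"
proof -
  obtain M r where M: "0 \<le> M"
    "\<And>x n. \<bar>(f (x + inverse (real (Suc n)) *\<^sub>R y) - f x) / inverse (real (Suc n))\<bar> \<le> M * indicator (cball 0 r) x"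
    by (rule difference_quotient_bound[of y]) blast
  have fm [measurable]: "f \<in> borel_measurable borel" by (intro borel_measurable_continuous_onI C1_compact_continuous)
  have [measurable]: "dir_deriv f y \<in> borel_measurable borel" by (intro borel_measurable_continuous_onI dir_deriv_continuous)
  have "(\<lambda>n. LINT x|lborel. ((f (x + inverse (real (Suc n)) *\<^sub>R y) - f x) / inverse (real (Suc n)))\<^sup>2)
      \<longlonglongrightarrow> (LINT x|lborel. (dir_deriv f y x)\<^sup>2)"
  proof (rule integral_dominated_convergence[OF _ _ integrable_indicator_cball[of "M\<^sup>2" r]])
    show "AE x in lborel. norm (((f (x + inverse (real (Suc n)) *\<^sub>R y) - f x) / inverse (real (Suc n)))\<^sup>2)
        \<le> M\<^sup>2 * indicator (cball 0 r) x" for n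
    proof (rule AE_I2)
      fix x
      have "\<bar>(f (x + inverse (real (Suc n)) *\<^sub>R y) - f x) / inverse (real (Suc n))\<bar>\<^sup>2 \<le> (M * indicator (cball 0 r) x)\<^sup>2"
        by (rule power_mono[OF M(2)]) simp
      also have "\<dots> = M\<^sup>2 * indicator (cball 0 r) x" by (simp add: indicator_def)
      finally show "norm (((f (x + inverse (real (Suc n)) *\<^sub>R y) - f x) / inverse (real (Suc n)))\<^sup>2)
          \<le> M\<^sup>2 * indicator (cball 0 r) x"
        by (simp only: real_norm_def power_abs)
    qed
  qed (auto intro!: difference_quotient_tendsto tendsto_power simp del: of_nat_Suc)
  moreover have "(LINT x|lborel. (f (x + y) - f x)\<^sup>2)
      \<le> (LINT x|lborel. ((f (x + inverse (real (Suc n)) *\<^sub>R y) - f x) / inverse (real (Suc n)))\<^sup>2)" for n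
  proof -
    define z where "z = inverse (real (Suc n)) *\<^sub>R y"
    define d where "d x = f (x + z) - f x" for x
    have y: "y = real (Suc n) *\<^sub>R z" by (simp add: z_def del: of_nat_Suc)
    have dm [measurable]: "d \<in> borel_measurable borel" unfolding d_def by measurable
    have dc: "continuous_on UNIV d"
      unfolding d_def by (intro continuous_intros continuous_on_compose2[OF C1_compact_continuous]) auto
    have "bounded {x. d x \<noteq> 0}"
    proof (rule bounded_subset)
      have b: "bounded {x. f x \<noteq> 0}" using f by (simp add: C1_compact_def)
      show "bounded ({x. f x \<noteq> 0} \<union> (\<lambda>x. x - z) ` {x. f x \<noteq> 0})"
        using b bounded_translation_minus[OF b] by auto
      show "{x. d x \<noteq> 0} \<subseteq> {x. f x \<noteq> 0} \<union> (\<lambda>x. x - z) ` {x. f x \<noteq> 0}"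
      proof
        fix x assume "x \<in> {x. d x \<noteq> 0}"
        then have "f x \<noteq> 0 \<or> f (x + z) \<noteq> 0" by (auto simp: d_def)
        then show "x \<in> {x. f x \<noteq> 0} \<union> (\<lambda>x. x - z) ` {x. f x \<noteq> 0}"
          by (auto intro!: image_eqI[of x "\<lambda>x. x - z" "x + z"])
      qed
    qed
    from continuous_bounded_support_integrable(2)[OF dc this]
    have d2: "integrable lborel (\<lambda>x. (d x)\<^sup>2)" by (simp add: square_integrable_def)
    have dk: "integrable lborel (\<lambda>x. (d (x + c))\<^sup>2)" for c
      using integrable_distr[of "(+) c" lborel borel "\<lambda>x. (d x)\<^sup>2"] d2 by (simp add: lborel_distr_plus add.commute)
    have tel: "f (x + y) - f x = (\<Sum>k<Suc n. d (x + real k *\<^sub>R z))" for x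
    proof -
      have "(\<Sum>k<m. d (x + real k *\<^sub>R z)) = f (x + real m *\<^sub>R z) - f x" for m
        by (induction m) (simp_all add: d_def scaleR_add_left add_ac)
      then show ?thesis unfolding y by metis
    qed
    have le: "(f (x + y) - f x)\<^sup>2 \<le> real (Suc n) * (\<Sum>k<Suc n. (d (x + real k *\<^sub>R z))\<^sup>2)" for x
      unfolding tel using sum_squared_le_sum_of_squares[of "\<lambda>k. d (x + real k *\<^sub>R z)" "{..<Suc n}"]
      by (simp add: mult.commute del: sum.lessThan_Suc of_nat_Suc)
    have "(LINT x|lborel. (f (x + y) - f x)\<^sup>2) \<le> (LINT x|lborel. real (Suc n) * (\<Sum>k<Suc n. (d (x + real k *\<^sub>R z))\<^sup>2))"
      by (rule integral_mono'[OF _ le])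
        (auto intro!: integrable_mult_right Bochner_Integration.integrable_sum dk mult_nonneg_nonneg sum_nonneg
          simp del: sum.lessThan_Suc)
    also have "\<dots> = real (Suc n) * (\<Sum>k<Suc n. LINT x|lborel. (d (x + real k *\<^sub>R z))\<^sup>2)"
      by (subst integral_mult_right_zero, subst Bochner_Integration.integral_sum) (auto intro: dk)
    also have "\<dots> = (real (Suc n))\<^sup>2 * (LINT x|lborel. (d x)\<^sup>2)"
      using integral_lborel_translation[of "\<lambda>x. (d x)\<^sup>2"] by (simp add: power2_eq_square del: sum.lessThan_Suc of_nat_Suc)
    also have "\<dots> = (LINT x|lborel. (real (Suc n))\<^sup>2 * (d x)\<^sup>2)" by (simp del: of_nat_Suc)
    also have "\<dots> = (LINT x|lborel. (d x / inverse (real (Suc n)))\<^sup>2)"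
      by (intro Bochner_Integration.integral_cong refl)
        (simp add: power_divide power_inverse field_simps del: of_nat_Suc)
    finally show ?thesis by (simp only: d_def z_def)
  qed
  ultimately show ?thesis by (intro LIMSEQ_le_const[of _ "LINT x|lborel. (dir_deriv f y x)\<^sup>2"]) auto
qed

lemma translation_le_gradient:
  "(LINT x|lborel. (f (x + y) - f x)\<^sup>2) \<le> (norm y)\<^sup>2 * (\<Sum>i\<in>UNIV. LINT x|lborel. (partial i f x)\<^sup>2)"
proof -
  have p: "integrable lborel (\<lambda>x. (partial i f x)\<^sup>2)" for i
    using C1_compact_square_integrable(2) by (simp add: square_integrable_def)
  have "(dir_deriv f y x)\<^sup>2 \<le> (norm y)\<^sup>2 * (\<Sum>i\<in>UNIV. (partial i f x)\<^sup>2)" for x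
    using Cauchy_Schwarz_ineq[of y "\<chi> i. partial i f x"]
    unfolding power2_norm_eq_inner by (simp add: dir_deriv_def inner_vec_def power2_eq_square)
  then have "(LINT x|lborel. (dir_deriv f y x)\<^sup>2) \<le> (LINT x|lborel. (norm y)\<^sup>2 * (\<Sum>i\<in>UNIV. (partial i f x)\<^sup>2))"
    by (intro integral_mono') (auto intro!: integrable_mult_right Bochner_Integration.integrable_sum p mult_nonneg_nonneg sum_nonneg)
  also have "\<dots> = (norm y)\<^sup>2 * (\<Sum>i\<in>UNIV. LINT x|lborel. (partial i f x)\<^sup>2)"
    by (subst integral_mult_right_zero, subst Bochner_Integration.integral_sum) (auto intro: p)
  finally show ?thesis using translation_le_dir_deriv[of y] by simp
qed

end

lemma test_function_C1_compact: "\<phi> \<in> test_functions \<Omega> \<Longrightarrow> C1_compact \<phi>"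
proof -
  assume \<phi>: "\<phi> \<in> test_functions \<Omega>"
  then have s: "partials is \<phi> differentiable (at x)" for "is" x by (simp add: test_functions_def smooth_on_def)
  have "continuous_on UNIV (partial i \<phi>)" for i
    using s[of "[i]"] differentiable_imp_continuous_within continuous_at_imp_continuous_on by (metis partials.simps)
  moreover have "bounded {x. \<phi> x \<noteq> 0}"
    using \<phi> by (auto simp: test_functions_def intro: bounded_subset[OF compact_imp_bounded closure_subset])
  ultimately show ?thesis using s[of "[]"] by (simp add: C1_compact_def)
qed

lemma C1_compact_mult:
  fixes f g :: "real^'n::finite \<Rightarrow> real"
  assumes f: "C1_compact f" and g: "C1_compact g"
  shows "C1_compact (\<lambda>x. f x * g x)" "partial i (\<lambda>x. f x * g x) x = f x * partial i g x + partial i f x * g x"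
proof -
  have p: "partial i (\<lambda>x. f x * g x) = (\<lambda>x. f x * partial i g x + partial i f x * g x)" for i
  proof
    fix x
    have e: "dir_deriv h (axis i 1) x = partial i h x" for h
      by (simp add: dir_deriv_def axis_def if_distrib[of "\<lambda>c. c * _"] cong: if_cong)
    show "partial i (\<lambda>x. f x * g x) x = f x * partial i g x + partial i f x * g x"
      unfolding partial_def[of i "\<lambda>x. f x * g x"]
      using frechet_derivative_at[OF has_derivative_mult[OF C1_compact_has_derivative[OF f] C1_compact_has_derivative[OF g]], symmetric]
      by (simp add: e)
  qed
  show "partial i (\<lambda>x. f x * g x) x = f x * partial i g x + partial i f x * g x" by (simp only: p)
  show "C1_compact (\<lambda>x. f x * g x)"
    unfolding C1_compact_def
  proof (intro conjI allI)
    show "(\<lambda>x. f x * g x) differentiable (at x)" for x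
      using f g by (intro differentiable_mult) (auto simp: C1_compact_def)
    show "continuous_on UNIV (partial i (\<lambda>x. f x * g x))" for i
      unfolding p using C1_compact_continuous[OF f] C1_compact_continuous[OF g] f g
      by (intro continuous_intros) (auto simp: C1_compact_def)
    show "bounded {x. f x * g x \<noteq> 0}"
      using f by (auto simp: C1_compact_def intro: bounded_subset)
  qed
qed

lemma integration_by_parts:
  fixes f g :: "real^'n::finite \<Rightarrow> real"
  assumes f: "C1_compact f" and g: "C1_compact g"
  shows "(LINT x|lborel. f x * partial i g x) = - (LINT x|lborel. partial i f x * g x)"
proof -
  have "dir_deriv (\<lambda>x. f x * g x) (axis i 1) x = partial i (\<lambda>x. f x * g x) x" for x
    by (simp add: dir_deriv_def axis_def if_distrib[of "\<lambda>c. c * _"] cong: if_cong)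
  then have "(LINT x|lborel. f x * partial i g x + partial i f x * g x) = 0"
    using integral_dir_deriv_eq_0[OF C1_compact_mult(1)[OF f g], of "axis i 1"]
    by (simp add: C1_compact_mult(2)[OF f g])
  then show ?thesis
    by (simp add: integrable_mult_square_integrable C1_compact_square_integrable f g)
qed

section \<open>The Friedrichs inequality\<close>

text \<open>For positive \<open>s\<close> these are half-open cubes of side \<open>s\<close>. The
  floor puts every point into exactly one cell, so sums of indicators over cells collapse to one
  term.\<close>

definition grid_cell :: "real \<Rightarrow> ('n::finite \<Rightarrow> int) \<Rightarrow> (real^'n) set" where
  "grid_cell s m = {x. \<forall>i. \<lfloor>x $ i / s\<rfloor> = m i}"

lemma sets_grid_cell [measurable]: "grid_cell s m \<in> sets borel"
proof -
  have "grid_cell s m = (\<Inter>i\<in>UNIV. {x. \<lfloor>x $ i / s\<rfloor> = m i})" by (auto simp: grid_cell_def)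
  moreover have "{x :: real^'a. \<lfloor>x $ i / s\<rfloor> = m i} \<in> sets borel" for i by measurable
  ultimately show ?thesis by auto
qed

lemma emeasure_lborel_cube:
  fixes a :: "real^'n::finite"
  assumes "0 \<le> s"
  shows "emeasure lborel (cbox a (a + (\<chi> i. s))) = ennreal (s ^ CARD('n))"
    "emeasure lborel (box a (a + (\<chi> i. s))) = ennreal (s ^ CARD('n))"
proof -
  have le: "\<And>b. b \<in> Basis \<Longrightarrow> a \<bullet> b \<le> (a + (\<chi> i. s)) \<bullet> b"
    using assms by (auto simp: Basis_vec_def inner_axis)
  have bas: "(Basis :: (real^'n) set) = range (\<lambda>i. axis i 1)" by (auto simp: Basis_vec_def)
  have inj: "inj (\<lambda>i :: 'n. axis i (1 :: real))" by (simp add: inj_on_def axis_eq_axis)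
  have "(\<Prod>b\<in>Basis. (a + (\<chi> i. s) - a) \<bullet> b) = s ^ CARD('n)"
    unfolding bas by (subst prod.reindex[OF inj]) (simp add: inner_axis)
  then show "emeasure lborel (cbox a (a + (\<chi> i. s))) = ennreal (s ^ CARD('n))"
    "emeasure lborel (box a (a + (\<chi> i. s))) = ennreal (s ^ CARD('n))"
    using emeasure_lborel_cbox[OF le] emeasure_lborel_box[OF le] by simp_all
qed

lemma emeasure_grid_cell:
  fixes m :: "'n::finite \<Rightarrow> int"
  assumes "0 < s"
  shows "emeasure lborel (grid_cell s m) = ennreal (s ^ CARD('n))"
proof (rule antisym)
  define a :: "real^'n" where "a = (\<chi> i. s * m i)"
  have *: "x \<in> grid_cell s m \<longleftrightarrow> (\<forall>i. a $ i \<le> x $ i \<and> x $ i < a $ i + s)" for x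
    using assms by (simp add: grid_cell_def a_def floor_eq_iff field_simps)
  have "grid_cell s m \<subseteq> cbox a (a + (\<chi> i. s))"
    by (auto simp: * mem_box_cart less_imp_le)
  from emeasure_mono[OF this, of lborel]
  show "emeasure lborel (grid_cell s m) \<le> ennreal (s ^ CARD('n))"
    using assms by (simp add: emeasure_lborel_cube)
  have "box a (a + (\<chi> i. s)) \<subseteq> grid_cell s m"
    by (auto simp: * mem_box_cart less_imp_le)
  from emeasure_mono[OF this, of lborel]
  show "ennreal (s ^ CARD('n)) \<le> emeasure lborel (grid_cell s m)"
    using assms by (simp add: emeasure_lborel_cube)
qed

lemma grid_cell_diff_bound:
  assumes "0 < s" "x \<in> grid_cell s m" "z \<in> grid_cell s m"
  shows "\<bar>x $ i - z $ i\<bar> \<le> s"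
proof -
  have f: "\<lfloor>x $ i / s\<rfloor> = \<lfloor>z $ i / s\<rfloor>" using assms(2,3) by (simp add: grid_cell_def)
  have "\<bar>x $ i / s - z $ i / s\<bar> \<le> 1"
    using f by linarith
  then have "\<bar>x $ i - z $ i\<bar> / s \<le> 1" using assms(1) by (simp add: abs_divide flip: diff_divide_distrib)
  then show ?thesis using assms(1) by simp
qed

text \<open>Expanding the square expresses the integral of \<open>f\<^sup>2\<close> over
  \<open>Q\<close>, up to the squared mean part, through differences of values. The left side is a
  nonnegative integral so that it can be enlarged and summed freely; the second claim ensures that
  \<open>ennreal\<close> on the right truncates nothing.\<close>

lemma variance_double_integral:
  fixes f :: "real^'n::finite \<Rightarrow> real"
  assumes f: "square_integrable f" and Q: "Q \<in> sets borel" "emeasure lborel Q = ennreal q" "0 \<le> q"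
  shows "(\<integral>\<^sup>+z. \<integral>\<^sup>+x. ennreal (indicator Q z * indicator Q x * (f x - f z)\<^sup>2) \<partial>lborel \<partial>lborel)
    = ennreal (2 * q * (LINT x|lborel. indicator Q x * (f x)\<^sup>2) - 2 * (LINT x|lborel. f x * indicator Q x)\<^sup>2)"
    "0 \<le> 2 * q * (LINT x|lborel. indicator Q x * (f x)\<^sup>2) - 2 * (LINT x|lborel. f x * indicator Q x)\<^sup>2"
proof -
  define A where "A = (LINT x|lborel. indicator Q x * (f x)\<^sup>2)"
  define b where "b = (LINT x|lborel. f x * indicator Q x)"
  have [measurable]: "f \<in> borel_measurable borel" "Q \<in> sets borel"
    using f Q by (auto simp: square_integrable_def)
  have i0: "integrable lborel (indicator Q :: _ \<Rightarrow> real)" "(LINT x|lborel. indicator Q x) = q"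
    using Q by (auto simp: integrable_real_indicator measure_def)
  have "square_integrable (indicator Q)"
    using i0(1) by (simp add: square_integrable_def power2_eq_square flip: indicator_inter_arith)
  from integrable_mult_square_integrable[OF f this]
  have i1: "integrable lborel (\<lambda>x. f x * indicator Q x)" .
  have i2: "integrable lborel (\<lambda>x. indicator Q x * (f x)\<^sup>2)"
    using f integrable_mult_indicator[of Q lborel "\<lambda>x. (f x)\<^sup>2"] by (simp add: square_integrable_def)
  have inner: "(\<integral>\<^sup>+x. ennreal (indicator Q z * indicator Q x * (f x - f z)\<^sup>2) \<partial>lborel)
      = ennreal (A * indicator Q z - 2 * b * (f z * indicator Q z) + q * (indicator Q z * (f z)\<^sup>2))" for z
  proof -
    have e: "indicator Q z * indicator Q x * (f x - f z)\<^sup>2 = indicator Q z *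
        (indicator Q x * (f x)\<^sup>2 - 2 * f z * (f x * indicator Q x) + (f z)\<^sup>2 * indicator Q x)" for x
      by (simp add: power2_eq_square algebra_simps)
    have "integrable lborel (\<lambda>x. indicator Q z * indicator Q x * (f x - f z)\<^sup>2)"
      unfolding e using i0 i1 i2 by (intro integrable_mult_right Bochner_Integration.integrable_add Bochner_Integration.integrable_diff)
    then have "(\<integral>\<^sup>+x. ennreal (indicator Q z * indicator Q x * (f x - f z)\<^sup>2) \<partial>lborel)
        = ennreal (LINT x|lborel. indicator Q z * indicator Q x * (f x - f z)\<^sup>2)"
      by (rule nn_integral_eq_integral) simp
    also have "(LINT x|lborel. indicator Q z * indicator Q x * (f x - f z)\<^sup>2)
        = indicator Q z * (A - 2 * f z * b + (f z)\<^sup>2 * q)"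
      unfolding e using i0 i1 i2 by (simp add: A_def b_def)
    finally show ?thesis by (simp add: algebra_simps)
  qed
  have nn: "0 \<le> A * indicator Q z - 2 * b * (f z * indicator Q z) + q * (indicator Q z * (f z)\<^sup>2)" for z
  proof -
    have "A * 1 - 2 * b * f z + q * (f z)\<^sup>2 = (LINT x|lborel. indicator Q x * (f x - f z)\<^sup>2)"
    proof -
      have e: "indicator Q x * (f x - f z)\<^sup>2 =
          indicator Q x * (f x)\<^sup>2 - 2 * f z * (f x * indicator Q x) + (f z)\<^sup>2 * indicator Q x" for x
        by (simp add: power2_eq_square algebra_simps)
      have "(LINT x|lborel. indicator Q x * (f x - f z)\<^sup>2) = A - 2 * f z * b + (f z)\<^sup>2 * q"
        unfolding e using i0 i1 i2 by (simp add: A_def b_def)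
      then show ?thesis by simp
    qed
    also have "0 \<le> \<dots>" by (rule Bochner_Integration.integral_nonneg) simp
    finally show ?thesis by (simp add: indicator_def)
  qed
  have "(\<integral>\<^sup>+z. \<integral>\<^sup>+x. ennreal (indicator Q z * indicator Q x * (f x - f z)\<^sup>2) \<partial>lborel \<partial>lborel)
      = ennreal (LINT z|lborel. A * indicator Q z - 2 * b * (f z * indicator Q z) + q * (indicator Q z * (f z)\<^sup>2))"
    unfolding inner using i0 i1 i2 nn
    by (intro nn_integral_eq_integral integrable_mult_right Bochner_Integration.integrable_add Bochner_Integration.integrable_diff) auto
  moreover have total: "(LINT z|lborel. A * indicator Q z - 2 * b * (f z * indicator Q z) + q * (indicator Q z * (f z)\<^sup>2))
      = 2 * q * A - 2 * b\<^sup>2"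
    using i0 i1 i2 by (simp add: power2_eq_square[of b] flip: A_def b_def)
  ultimately show "(\<integral>\<^sup>+z. \<integral>\<^sup>+x. ennreal (indicator Q z * indicator Q x * (f x - f z)\<^sup>2) \<partial>lborel \<partial>lborel)
      = ennreal (2 * q * (LINT x|lborel. indicator Q x * (f x)\<^sup>2) - 2 * (LINT x|lborel. f x * indicator Q x)\<^sup>2)"
    by (simp only: A_def b_def)
  show "0 \<le> 2 * q * (LINT x|lborel. indicator Q x * (f x)\<^sup>2) - 2 * (LINT x|lborel. f x * indicator Q x)\<^sup>2"
    unfolding A_def[symmetric] b_def[symmetric] total[symmetric] by (rule Bochner_Integration.integral_nonneg) (rule nn)
qed

text \<open>Substituting \<open>x = y + z\<close> and exchanging the integrals leaves, for each
  \<open>y\<close> in a cube of volume \<open>(2 * s) ^ CARD('n)\<close>, a translation of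
  \<open>f\<close> by \<open>y\<close>, whose squared length is at most
  \<open>CARD('n) * s\<^sup>2\<close>.\<close>

lemma double_integral_near_diagonal_bound:
  fixes f :: "real^'n::finite \<Rightarrow> real"
  assumes f: "C1_compact f" and s: "0 \<le> s"
  shows "(\<integral>\<^sup>+z. \<integral>\<^sup>+x. ennreal (indicator {y. \<forall>i. \<bar>y $ i\<bar> \<le> s} (x - z) * (f x - f z)\<^sup>2) \<partial>lborel \<partial>lborel)
    \<le> ennreal ((2 * s) ^ CARD('n) * (real CARD('n) * s\<^sup>2 * (\<Sum>i\<in>UNIV. LINT x|lborel. (partial i f x)\<^sup>2)))"
proof -
  define D where "D = (\<Sum>i\<in>UNIV. LINT x|lborel. (partial i f x)\<^sup>2)"
  define B where "B = {y :: real^'n. \<forall>i. \<bar>y $ i\<bar> \<le> s}"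
  have D0: "0 \<le> D" unfolding D_def by (intro sum_nonneg Bochner_Integration.integral_nonneg) simp
  have Bbox: "B = cbox (\<chi> i. - s) ((\<chi> i. - s) + (\<chi> i. 2 * s))"
    by (auto simp: B_def mem_box_cart abs_le_iff minus_le_iff)
  have Bm [measurable]: "B \<in> sets borel" unfolding Bbox by simp
  have eB: "emeasure lborel B = ennreal ((2 * s) ^ CARD('n))"
    unfolding Bbox using s by (intro emeasure_lborel_cube) simp
  have [measurable]: "f \<in> borel_measurable borel"
    by (intro borel_measurable_continuous_onI C1_compact_continuous f)
  have "(\<integral>\<^sup>+z. \<integral>\<^sup>+x. ennreal (indicator B (x - z) * (f x - f z)\<^sup>2) \<partial>lborel \<partial>lborel)
      = (\<integral>\<^sup>+z. \<integral>\<^sup>+y. ennreal (indicator B y * (f (y + z) - f z)\<^sup>2) \<partial>lborel \<partial>lborel)"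
  proof (rule nn_integral_cong)
    fix z :: "real^'n"
    show "(\<integral>\<^sup>+x. ennreal (indicator B (x - z) * (f x - f z)\<^sup>2) \<partial>lborel)
        = (\<integral>\<^sup>+y. ennreal (indicator B y * (f (y + z) - f z)\<^sup>2) \<partial>lborel)"
      using nn_integral_lborel_translation[of "\<lambda>x. ennreal (indicator B (x - z) * (f x - f z)\<^sup>2)" z] by simp
  qed
  also have "\<dots> = (\<integral>\<^sup>+y. \<integral>\<^sup>+z. ennreal (indicator B y * (f (y + z) - f z)\<^sup>2) \<partial>lborel \<partial>lborel)"
    by (rule lborel_pair.Fubini') measurable
  also have "\<dots> \<le> (\<integral>\<^sup>+y. ennreal (real CARD('n) * s\<^sup>2 * D) * indicator B y \<partial>lborel)"
  proof (intro nn_integral_mono)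
    fix y :: "real^'n"
    show "(\<integral>\<^sup>+z. ennreal (indicator B y * (f (y + z) - f z)\<^sup>2) \<partial>lborel) \<le> ennreal (real CARD('n) * s\<^sup>2 * D) * indicator B y"
    proof (cases "y \<in> B")
      case True
      have "square_integrable (\<lambda>z. f (z + y))"
      proof -
        have "integrable lborel (\<lambda>x. (f x)\<^sup>2)"
          using C1_compact_square_integrable(1)[OF f] by (simp add: square_integrable_def)
        then have "integrable lborel (\<lambda>z. (f (z + y))\<^sup>2)"
          using integrable_distr[of "(+) y" lborel borel "\<lambda>x. (f x)\<^sup>2"] by (simp add: lborel_distr_plus add.commute)
        then show ?thesis by (simp add: square_integrable_def)
      qed
      from square_integrable_add[OF this square_integrable_scale[OF C1_compact_square_integrable(1)[OF f], of "-1"]]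
      have int: "integrable lborel (\<lambda>z. (f (z + y) - f z)\<^sup>2)" by (simp add: square_integrable_def)
      have "(\<integral>\<^sup>+z. ennreal (indicator B y * (f (y + z) - f z)\<^sup>2) \<partial>lborel) = ennreal (LINT z|lborel. (f (z + y) - f z)\<^sup>2)"
        using True nn_integral_eq_integral[OF int] by (simp add: add.commute)
      also have "\<dots> \<le> ennreal (real CARD('n) * s\<^sup>2 * D)"
      proof (rule ennreal_leI)
        have "(norm y)\<^sup>2 = (\<Sum>i\<in>UNIV. (y $ i)\<^sup>2)"
          unfolding power2_norm_eq_inner by (simp add: inner_vec_def power2_eq_square)
        also have "\<dots> \<le> (\<Sum>i\<in>(UNIV :: 'n set). s\<^sup>2)"
          using True s by (intro sum_mono) (auto simp: B_def abs_le_square_iff[symmetric])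
        finally have "(norm y)\<^sup>2 * D \<le> (real CARD('n) * s\<^sup>2) * D" using D0 by (intro mult_right_mono) auto
        then show "(LINT z|lborel. (f (z + y) - f z)\<^sup>2) \<le> real CARD('n) * s\<^sup>2 * D"
          using translation_le_gradient[OF f, of y] by (simp add: D_def)
      qed
      finally show ?thesis using True by simp
    qed simp
  qed
  also have "\<dots> = ennreal (real CARD('n) * s\<^sup>2 * D) * ennreal ((2 * s) ^ CARD('n))"
    by (simp add: nn_integral_cmult_indicator eB)
  also have "\<dots> = ennreal ((2 * s) ^ CARD('n) * (real CARD('n) * s\<^sup>2 * D))"
    using s D0 by (simp add: ennreal_mult[symmetric] mult.commute)
  finally show ?thesis by (simp only: B_def D_def)
qed

text \<open>Replaces Rellich's compactness theorem: modulo finitely many linear functionals, the \<open>L\<^sup>2\<close> norm is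
  small relative to the gradient.\<close>

lemma friedrichs_inequality:
  fixes \<Omega> :: "(real^'n::finite) set"
  assumes \<Omega>: "bounded \<Omega>" and \<epsilon>: "0 < \<epsilon>"
  obtains g :: "nat \<Rightarrow> 'n l2" and N where
    "\<And>f. C1_compact f \<Longrightarrow> {x. f x \<noteq> 0} \<subseteq> \<Omega> \<Longrightarrow>
      (norm (of_fun f))\<^sup>2 \<le> \<epsilon> * (\<Sum>i\<in>UNIV. (norm (of_fun (partial i f)))\<^sup>2) + (\<Sum>j<N. (of_fun f \<bullet> g j)\<^sup>2)"
proof -
  define n where "n = CARD('n)"
  \<comment> \<open>Makes the near-diagonal bound \<open>(2 * s) ^ n * (n * s\<^sup>2 * D)\<close>
    equal to \<open>q * (\<epsilon> * D)\<close>, where \<open>q = s ^ n\<close> is the cell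
    volume.\<close>
  define s where "s = sqrt (\<epsilon> / (2 ^ n * real n))"
  have n: "0 < n" by (simp add: n_def)
  have s: "0 < s" "2 ^ n * real n * s\<^sup>2 = \<epsilon>" using \<epsilon> n by (auto simp: s_def)
  define q where "q = s ^ n"
  have q: "0 < q" using s by (simp add: q_def)
  obtain r where r: "\<And>x. x \<in> \<Omega> \<Longrightarrow> norm x \<le> r" using \<Omega> by (auto simp: bounded_iff)
  \<comment> \<open>The indices of finitely many cells that cover the ball of radius
    \<open>r\<close>, and with it \<Omega>.\<close>
  define M where "M = Pi\<^sub>E (UNIV :: 'n set) (\<lambda>_. {\<lfloor>- r / s\<rfloor>..\<lfloor>r / s\<rfloor>})"
  have finM: "finite M" unfolding M_def by (intro finite_PiE) auto
  \<comment> \<open>Cell indicators of norm 1, so that the square of a functional is the squared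
    cell integral divided by \<open>q\<close>.\<close>
  define g where "g m = of_fun (\<lambda>x. indicator (grid_cell s m) x / sqrt q)" for m :: "'n \<Rightarrow> int"
  have eq: "emeasure lborel (grid_cell s m) = ennreal q" for m :: "'n \<Rightarrow> int"
    using emeasure_grid_cell[OF s(1)] by (simp add: q_def n_def)
  have sqg: "square_integrable (\<lambda>x. indicator (grid_cell s m) x / sqrt q)" for m :: "'n \<Rightarrow> int"
  proof -
    have "square_integrable (indicator (grid_cell s m))"
      unfolding square_integrable_def power2_eq_square indicator_inter_arith[symmetric]
      by (auto intro!: integrable_real_indicator simp: eq)
    from square_integrable_scale[OF this, of "1 / sqrt q"] show ?thesis by simp
  qed
  have main: "(norm (of_fun f))\<^sup>2 \<le> \<epsilon> * (\<Sum>i\<in>UNIV. (norm (of_fun (partial i f)))\<^sup>2) + (\<Sum>m\<in>M. (of_fun f \<bullet> g m)\<^sup>2)"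
    if f: "C1_compact f" and supp: "{x. f x \<noteq> 0} \<subseteq> \<Omega>" for f
  proof -
    have sq: "square_integrable f" by (rule C1_compact_square_integrable[OF f])
    have [measurable]: "f \<in> borel_measurable borel" using sq by (simp add: square_integrable_def)
    define D where "D = (\<Sum>i\<in>UNIV. LINT x|lborel. (partial i f x)\<^sup>2)"
    define A where "A m = (LINT x|lborel. indicator (grid_cell s m) x * (f x)\<^sup>2)" for m
    define b where "b m = (LINT x|lborel. f x * indicator (grid_cell s m) x)" for m
    have D: "D = (\<Sum>i\<in>UNIV. (norm (of_fun (partial i f)))\<^sup>2)"
      by (simp add: D_def norm_of_fun_square[OF C1_compact_square_integrable(2)[OF f]])
    have D0: "0 \<le> D" unfolding D by (intro sum_nonneg) simp
    have intA: "integrable lborel (\<lambda>x. indicator (grid_cell s m) x * (f x)\<^sup>2)" for m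
      using sq integrable_mult_indicator[of "grid_cell s m" lborel "\<lambda>x. (f x)\<^sup>2"]
      by (simp add: square_integrable_def)
    have "(norm (of_fun f))\<^sup>2 = (LINT x|lborel. (\<Sum>m\<in>M. indicator (grid_cell s m) x * (f x)\<^sup>2))"
      unfolding norm_of_fun_square[OF sq]
    proof (intro Bochner_Integration.integral_cong refl)
      fix x :: "real^'n"
      show "(f x)\<^sup>2 = (\<Sum>m\<in>M. indicator (grid_cell s m) x * (f x)\<^sup>2)"
      proof (cases "f x = 0")
        case False
        then have "norm x \<le> r" using supp r by auto
        then have xi: "- r \<le> x $ i" "x $ i \<le> r" for i
          using component_le_norm_cart[of x i] by auto
        define m where "m i = \<lfloor>x $ i / s\<rfloor>" for i
        have "- r / s \<le> x $ i / s" "x $ i / s \<le> r / s" for i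
          using xi s(1) by (intro divide_right_mono; simp)+
        then have "m \<in> M" unfolding M_def m_def by (auto intro!: floor_mono)
        moreover have "indicator (grid_cell s m') x = (if m' = m then 1 else 0 :: real)" for m'
          by (auto simp: grid_cell_def m_def indicator_def)
        ultimately show ?thesis using finM by (simp add: if_distrib[of "\<lambda>c. c * _"] cong: if_cong)
      qed simp
    qed
    also have "\<dots> = (\<Sum>m\<in>M. A m)" unfolding A_def by (intro Bochner_Integration.integral_sum intA)
    finally have nf: "(norm (of_fun f))\<^sup>2 = (\<Sum>m\<in>M. A m)" .
    have fg: "(of_fun f \<bullet> g m)\<^sup>2 = (b m)\<^sup>2 / q" for m
    proof -
      have "of_fun f \<bullet> g m = (LINT x|lborel. fun_of (of_fun f) x * (indicator (grid_cell s m) x / sqrt q))"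
        unfolding g_def by (rule inner_of_fun_right[OF sqg])
      also have "\<dots> = (LINT x|lborel. (f x * indicator (grid_cell s m) x) / sqrt q)"
      proof (rule integral_cong_AE)
        show "AE x in lborel. fun_of (of_fun f) x * (indicator (grid_cell s m) x / sqrt q)
            = f x * indicator (grid_cell s m) x / sqrt q"
          using fun_of_of_fun[OF sq] by eventually_elim simp
      qed measurable
      also have "\<dots> = b m / sqrt q" by (simp add: b_def)
      finally show ?thesis using q by (simp add: power_divide)
    qed
    let ?v = "\<lambda>m z x. ennreal (indicator (grid_cell s m) z * indicator (grid_cell s m) x * (f x - f z)\<^sup>2)"
    have v: "(\<integral>\<^sup>+z. \<integral>\<^sup>+x. ?v m z x \<partial>lborel \<partial>lborel) = ennreal (2 * q * A m - 2 * (b m)\<^sup>2)" for m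
      unfolding A_def b_def using q eq by (intro variance_double_integral(1) sq sets_grid_cell) auto
    have pos: "0 \<le> 2 * q * A m - 2 * (b m)\<^sup>2" for m
      unfolding A_def b_def using q eq by (intro variance_double_integral(2) sq sets_grid_cell) auto
    have "ennreal (\<Sum>m\<in>M. 2 * q * A m - 2 * (b m)\<^sup>2) = (\<Sum>m\<in>M. \<integral>\<^sup>+z. \<integral>\<^sup>+x. ?v m z x \<partial>lborel \<partial>lborel)"
      unfolding v using pos by (intro sum_ennreal[symmetric]) auto
    also have "\<dots> = (\<integral>\<^sup>+z. \<integral>\<^sup>+x. (\<Sum>m\<in>M. ?v m z x) \<partial>lborel \<partial>lborel)"
      by (subst nn_integral_sum[symmetric], measurable, subst nn_integral_sum[symmetric]) auto
    \<comment> \<open>For given \<open>z\<close> only its own cell contributes, and points of one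
      cell differ by at most \<open>s\<close> in each coordinate: the diagonal blocks lie in a band
      around the diagonal.\<close>
    also have "\<dots> \<le> (\<integral>\<^sup>+z. \<integral>\<^sup>+x. ennreal (indicator {y. \<forall>i. \<bar>y $ i\<bar> \<le> s} (x - z) * (f x - f z)\<^sup>2) \<partial>lborel \<partial>lborel)"
    proof (intro nn_integral_mono)
      fix z x :: "real^'n"
      define mz where "mz i = \<lfloor>z $ i / s\<rfloor>" for i
      have iz: "indicator (grid_cell s m) z = (if m = mz then 1 else 0 :: real)" for m
        by (auto simp: grid_cell_def mz_def indicator_def)
      have "(\<Sum>m\<in>M. ?v m z x) = (if mz \<in> M then ennreal (indicator (grid_cell s mz) x * (f x - f z)\<^sup>2) else 0)"
        unfolding iz using finM by (simp add: if_distrib[of "\<lambda>c. c * _"] if_distrib[of ennreal] cong: if_cong)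
      also have "\<dots> \<le> ennreal (indicator {y. \<forall>i. \<bar>y $ i\<bar> \<le> s} (x - z) * (f x - f z)\<^sup>2)"
      proof (cases "x \<in> grid_cell s mz")
        case True
        moreover have "z \<in> grid_cell s mz" by (simp add: grid_cell_def mz_def)
        ultimately show ?thesis using grid_cell_diff_bound[OF s(1)] by (auto simp: indicator_def)
      qed simp
      finally show "(\<Sum>m\<in>M. ?v m z x) \<le> ennreal (indicator {y. \<forall>i. \<bar>y $ i\<bar> \<le> s} (x - z) * (f x - f z)\<^sup>2)" .
    qed
    also have "\<dots> \<le> ennreal ((2 * s) ^ n * (real n * s\<^sup>2 * D))"
      unfolding n_def D_def by (rule double_integral_near_diagonal_bound[OF f]) (use s in simp)
    finally have "(\<Sum>m\<in>M. 2 * q * A m - 2 * (b m)\<^sup>2) \<le> (2 * s) ^ n * (real n * s\<^sup>2 * D)"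
      using s(1) D0 by (subst (asm) ennreal_le_iff) auto
    also have "\<dots> = q * (\<epsilon> * D)" by (simp add: q_def power_mult_distrib flip: s(2))
    finally have "2 * q * (\<Sum>m\<in>M. A m) \<le> q * (\<epsilon> * D) + 2 * (\<Sum>m\<in>M. (b m)\<^sup>2)"
      by (simp add: sum_subtractf sum_distrib_left)
    \<comment> \<open>The estimate actually yields \<open>\<epsilon> / 2\<close>; a factor of two is
      given away here.\<close>
    moreover have "q * (\<epsilon> * D) \<le> 2 * (q * (\<epsilon> * D))" using q \<epsilon> D0 by simp
    ultimately have "q * (\<Sum>m\<in>M. A m) \<le> q * (\<epsilon> * D) + (\<Sum>m\<in>M. (b m)\<^sup>2)" by linarith
    then have "(\<Sum>m\<in>M. A m) \<le> \<epsilon> * D + (\<Sum>m\<in>M. (b m)\<^sup>2) / q"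
      using q by (simp add: field_simps)
    then show ?thesis unfolding nf D[symmetric] fg by (simp add: sum_divide_distrib)
  qed
  obtain e where e: "bij_betw e {..<card M} M"
    using ex_bij_betw_nat_finite[OF finM] by (auto simp: atLeast0LessThan)
  show thesis
  proof (rule that[of "\<lambda>j. g (e j)" "card M"])
    fix f :: "real^'n \<Rightarrow> real"
    assume "C1_compact f" "{x. f x \<noteq> 0} \<subseteq> \<Omega>"
    from main[OF this]
    show "(norm (of_fun f))\<^sup>2 \<le> \<epsilon> * (\<Sum>i\<in>UNIV. (norm (of_fun (partial i f)))\<^sup>2) + (\<Sum>j<card M. (of_fun f \<bullet> g (e j))\<^sup>2)"
      using sum.reindex_bij_betw[OF e, of "\<lambda>m. (of_fun f \<bullet> g m)\<^sup>2"] by simp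
  qed
qed

section \<open>The principal eigenvalue and the Rayleigh quotient\<close>

abbreviation unit_index :: "'n \<Rightarrow> 'n \<Rightarrow> nat" where
  "unit_index i \<equiv> (\<lambda>j. if j = i then 1 else 0)"

lemma test_function_square_integrable:
  fixes \<phi> :: "real^'n::finite \<Rightarrow> real"
  shows "\<phi> \<in> test_functions \<Omega> \<Longrightarrow> square_integrable \<phi>"
  using C1_compact_square_integrable(1) test_function_C1_compact by blast

lemma L2_diff:
  assumes "v \<in> L2 \<Omega>" "w \<in> L2 \<Omega>"
  shows "v - w \<in> L2 \<Omega>"
  using assms fun_of_diff[of v w] unfolding L2_def mem_Collect_eq by eventually_elim simp

lemma integral_fun_of_diff_mult:
  fixes \<phi> :: "real^'n::finite \<Rightarrow> real"
  assumes "square_integrable \<phi>"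
  shows "(LINT x|lborel. fun_of (v - w) x * \<phi> x) = (LINT x|lborel. fun_of v x * \<phi> x) - (LINT x|lborel. fun_of w x * \<phi> x)"
  using assms by (simp add: inner_diff_left flip: inner_of_fun_right)

text \<open>The list \<open>js\<close> witnesses that \<beta> can be enumerated; without such a list
  the test condition would be vacuous. The difference of two candidates is orthogonal to all test
  functions.\<close>

lemma has_weak_derivative_unique:
  fixes g g' :: "'n::finite l2"
  assumes "open \<Omega>" "\<And>i. count_list js i = \<beta> i"
    and g: "has_weak_derivative \<Omega> \<beta> v g" and g': "has_weak_derivative \<Omega> \<beta> v g'"
  shows "g' = g"
proof -
  have "g' - g = 0"
  proof (rule test_function_orthogonal_imp_zero[OF assms(1)])
    show "g' - g \<in> L2 \<Omega>" using g g' by (simp add: has_weak_derivative_def L2_diff)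
    fix \<phi> :: "real^'n \<Rightarrow> real" assume \<phi>: "\<phi> \<in> test_functions \<Omega>"
    have e: "(LINT x|lborel. fun_of v x * partials js \<phi> x) = (- 1) ^ multi_order \<beta> * (LINT x|lborel. fun_of h x * \<phi> x)"
      if "has_weak_derivative \<Omega> \<beta> v h" for h
      using that \<phi> assms(2) unfolding has_weak_derivative_def by blast
    show "(LINT x|lborel. fun_of (g' - g) x * \<phi> x) = 0"
      using e[OF g] e[OF g'] by (simp add: integral_fun_of_diff_mult test_function_square_integrable[OF \<phi>])
  qed
  then show ?thesis by simp
qed

lemma weak_derivative_eq:
  assumes "open \<Omega>" "\<And>i. count_list js i = \<beta> i" "has_weak_derivative \<Omega> \<beta> v g"
  shows "weak_derivative \<Omega> \<beta> v = g"
  unfolding weak_derivative_def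
  using assms(3) has_weak_derivative_unique[OF assms(1,2,3)] by (rule the_equality)

lemma count_list_0_iff: "(\<forall>j. count_list js j = 0) \<longleftrightarrow> js = []"
  by (cases js) auto

lemma count_list_unit_index_iff: "(\<forall>j. count_list js j = unit_index i j) \<longleftrightarrow> js = [i]"
proof
  assume *: "\<forall>j. count_list js j = unit_index i j"
  then obtain k ks where js: "js = k # ks" by (cases js) (auto dest: spec[of _ i])
  with * have "k = i" by (auto dest: spec[of _ k] split: if_splits)
  with * js have "\<forall>j. count_list ks j = 0" by (auto split: if_splits)
  then show "js = [i]" using js \<open>k = i\<close> by (simp add: count_list_0_iff)
qed auto

lemma has_weak_derivative_0_iff: "has_weak_derivative \<Omega> (\<lambda>_. 0) v g \<longleftrightarrow> g \<in> L2 \<Omega> \<and>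
    (\<forall>\<phi>\<in>test_functions \<Omega>. (LINT x|lborel. fun_of v x * \<phi> x) = (LINT x|lborel. fun_of g x * \<phi> x))"
  by (auto simp: has_weak_derivative_def count_list_0_iff multi_order_def)

lemma has_weak_derivative_unit_iff: "has_weak_derivative \<Omega> (unit_index i) v g \<longleftrightarrow> g \<in> L2 \<Omega> \<and>
    (\<forall>\<phi>\<in>test_functions \<Omega>. (LINT x|lborel. fun_of v x * partial i \<phi> x) = - (LINT x|lborel. fun_of g x * \<phi> x))"
  unfolding has_weak_derivative_def count_list_unit_index_iff by (auto simp: multi_order_def)

lemma has_weak_derivative_diff:
  assumes "has_weak_derivative \<Omega> (unit_index i) v g" "has_weak_derivative \<Omega> (unit_index i) w h"
  shows "has_weak_derivative \<Omega> (unit_index i) (v - w) (g - h)"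
  using assms unfolding has_weak_derivative_unit_iff
  by (simp add: L2_diff integral_fun_of_diff_mult test_function_square_integrable
      C1_compact_square_integrable(2) test_function_C1_compact)

lemma of_fun_in_L2:
  assumes "square_integrable f" "\<And>x. x \<notin> \<Omega> \<Longrightarrow> f x = 0"
  shows "of_fun f \<in> L2 \<Omega>"
  unfolding L2_def mem_Collect_eq using fun_of_of_fun[OF assms(1)] by eventually_elim (use assms(2) in auto)

lemma test_function_weak_derivative:
  fixes \<phi> :: "real^'n::finite \<Rightarrow> real"
  assumes \<phi>: "\<phi> \<in> test_functions \<Omega>"
  shows "of_fun \<phi> \<in> L2 \<Omega>" "has_weak_derivative \<Omega> (unit_index i) (of_fun \<phi>) (of_fun (partial i \<phi>))"
proof -
  note C = test_function_C1_compact[OF \<phi>]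
  note sq = C1_compact_square_integrable[OF C]
  have supp: "closure {x. \<phi> x \<noteq> 0} \<subseteq> \<Omega>" using \<phi> by (simp add: test_functions_def)
  show "of_fun \<phi> \<in> L2 \<Omega>"
    using supp closure_subset[of "{x. \<phi> x \<noteq> 0}"] by (intro of_fun_in_L2 sq) auto
  have "of_fun (partial i \<phi>) \<in> L2 \<Omega>"
    using supp partial_eq_0_outside[OF C] by (intro of_fun_in_L2 sq) auto
  moreover have "(LINT x|lborel. fun_of (of_fun \<phi>) x * partial i \<psi> x) = - (LINT x|lborel. fun_of (of_fun (partial i \<phi>)) x * \<psi> x)"
    if \<psi>: "\<psi> \<in> test_functions \<Omega>" for \<psi>
  proof -
    note C' = test_function_C1_compact[OF \<psi>]
    note sq' = C1_compact_square_integrable[OF C']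
    have e: "(LINT x|lborel. fun_of (of_fun f) x * g x) = (LINT x|lborel. f x * g x)"
      if "square_integrable f" "square_integrable g" for f g :: "real^'n \<Rightarrow> real"
    proof (rule integral_cong_AE)
      show "AE x in lborel. fun_of (of_fun f) x * g x = f x * g x"
        using fun_of_of_fun[OF that(1)] by eventually_elim simp
    qed (use that in \<open>auto simp: square_integrable_def\<close>)
    show ?thesis using integration_by_parts[OF C C', of i] by (simp add: e sq sq')
  qed
  ultimately show "has_weak_derivative \<Omega> (unit_index i) (of_fun \<phi>) (of_fun (partial i \<phi>))"
    by (simp add: has_weak_derivative_unit_iff)
qed

lemma norm_weak_derivative_le_sobolev_norm:
  fixes v :: "'n::finite l2"
  assumes "multi_order \<beta> \<le> 1"
  shows "norm (weak_derivative \<Omega> \<beta> v) \<le> sobolev_norm \<Omega> 1 v"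
proof -
  \<comment> \<open>Over an infinite index set the sum in \<open>sobolev_norm\<close> would be 0 by
    default, so finiteness has to be established before a single term can be compared with
    it.\<close>
  have "{\<beta> :: 'n \<Rightarrow> nat. multi_order \<beta> \<le> 1} \<subseteq> Pi\<^sub>E UNIV (\<lambda>_. {..1})"
  proof
    fix \<beta> :: "'n \<Rightarrow> nat" assume "\<beta> \<in> {\<beta>. multi_order \<beta> \<le> 1}"
    moreover have "\<beta> i \<le> multi_order \<beta>" for i unfolding multi_order_def by (rule member_le_sum) auto
    ultimately show "\<beta> \<in> Pi\<^sub>E UNIV (\<lambda>_. {..1})" by (auto intro: order_trans)
  qed
  then have "finite {\<beta> :: 'n \<Rightarrow> nat. multi_order \<beta> \<le> 1}"
    by (rule finite_subset) (intro finite_PiE, auto)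
  then have "(norm (weak_derivative \<Omega> \<beta> v))\<^sup>2 \<le> (\<Sum>\<beta> | multi_order \<beta> \<le> 1. (norm (weak_derivative \<Omega> \<beta> v))\<^sup>2)"
    using assms by (intro member_le_sum[of \<beta> _ "\<lambda>\<beta>. (norm (weak_derivative \<Omega> \<beta> v))\<^sup>2"]) auto
  then show ?thesis unfolding sobolev_norm_def by (rule real_le_rsqrt)
qed

lemma sobolev_weak_partial:
  fixes v :: "'n::finite l2"
  assumes \<Omega>: "open \<Omega>" and v: "v \<in> sobolev \<Omega> 1"
  shows "has_weak_derivative \<Omega> (unit_index i) v (weak_partial \<Omega> i v)"
proof -
  have "multi_order (unit_index i) \<le> 1" by (simp add: multi_order_def)
  then obtain g where g: "has_weak_derivative \<Omega> (unit_index i) v g" using v unfolding sobolev_def by blast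
  then have "weak_partial \<Omega> i v = g"
    unfolding weak_partial_def by (intro weak_derivative_eq[OF \<Omega>, of "[i]"]) auto
  with g show ?thesis by simp
qed

text \<open>Convergence in the Sobolev norm, read off term by term. Uniqueness identifies the weak
  derivative of \<open>v - of_fun (\<phi> k)\<close> with the difference of the derivatives.\<close>

lemma H10_approximation:
  fixes v :: "'n::finite l2"
  assumes \<Omega>: "open \<Omega>" and v: "v \<in> H10 \<Omega>"
  obtains \<phi> where "\<And>k. \<phi> k \<in> test_functions \<Omega>" "(\<lambda>k. of_fun (\<phi> k)) \<longlonglongrightarrow> v"
    "\<And>i. (\<lambda>k. of_fun (partial i (\<phi> k))) \<longlonglongrightarrow> weak_partial \<Omega> i v"
proof -
  have v1: "v \<in> sobolev \<Omega> 1" and vL: "v \<in> L2 \<Omega>" using v by (auto simp: H10_def sobolev_def)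
  have "\<exists>\<phi>\<in>test_functions \<Omega>. sobolev_norm \<Omega> 1 (v - of_fun \<phi>) < inverse (real (Suc k))" for k
    using v unfolding H10_def by simp
  then obtain \<phi> where \<phi>: "\<And>k. \<phi> k \<in> test_functions \<Omega>"
    "\<And>k. sobolev_norm \<Omega> 1 (v - of_fun (\<phi> k)) < inverse (real (Suc k))" by metis
  have lim: "x \<longlonglongrightarrow> y" if "\<And>k. norm (y - x k) \<le> sobolev_norm \<Omega> 1 (v - of_fun (\<phi> k))" for x :: "nat \<Rightarrow> 'n l2" and y
  proof (rule LIM_zero_cancel, rule Lim_null_comparison)
    show "(\<lambda>k. inverse (real (Suc k))) \<longlonglongrightarrow> 0" by (rule LIMSEQ_inverse_real_of_nat)
    show "\<forall>\<^sub>F k in sequentially. norm (x k - y) \<le> inverse (real (Suc k))"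
      using that \<phi>(2) by (intro always_eventually allI) (metis less_imp_le norm_minus_commute order_trans)
  qed
  show thesis
  proof
    show "\<phi> k \<in> test_functions \<Omega>" for k by (rule \<phi>)
    show "(\<lambda>k. of_fun (\<phi> k)) \<longlonglongrightarrow> v"
    proof (rule lim)
      fix k
      have "has_weak_derivative \<Omega> (\<lambda>_. 0) (v - of_fun (\<phi> k)) (v - of_fun (\<phi> k))"
        unfolding has_weak_derivative_0_iff using vL test_function_weak_derivative(1)[OF \<phi>(1)] by (simp add: L2_diff)
      then have "weak_derivative \<Omega> (\<lambda>_. 0) (v - of_fun (\<phi> k)) = v - of_fun (\<phi> k)"
        by (intro weak_derivative_eq[OF \<Omega>, of "[]"]) auto
      then show "norm (v - of_fun (\<phi> k)) \<le> sobolev_norm \<Omega> 1 (v - of_fun (\<phi> k))"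
        using norm_weak_derivative_le_sobolev_norm[of "\<lambda>_. 0" \<Omega> "v - of_fun (\<phi> k)"] by (simp add: multi_order_def)
    qed
    fix i
    show "(\<lambda>k. of_fun (partial i (\<phi> k))) \<longlonglongrightarrow> weak_partial \<Omega> i v"
    proof (rule lim)
      fix k
      have "weak_derivative \<Omega> (unit_index i) (v - of_fun (\<phi> k)) = weak_partial \<Omega> i v - of_fun (partial i (\<phi> k))"
        using has_weak_derivative_diff[OF sobolev_weak_partial[OF \<Omega> v1] test_function_weak_derivative(2)[OF \<phi>(1)]]
        by (intro weak_derivative_eq[OF \<Omega>, of "[i]"]) auto
      moreover have "multi_order (unit_index i) \<le> 1" by (simp add: multi_order_def)
      ultimately show "norm (weak_partial \<Omega> i v - of_fun (partial i (\<phi> k))) \<le> sobolev_norm \<Omega> 1 (v - of_fun (\<phi> k))"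
        using norm_weak_derivative_le_sobolev_norm[of "unit_index i" \<Omega> "v - of_fun (\<phi> k)"] by simp
    qed
  qed
qed

text \<open>Both sides are continuous along the approximating sequence, and the functionals depend
  on \<Omega> and \<epsilon> alone, not on the function.\<close>

lemma friedrichs_inequality_H10:
  fixes \<Omega> :: "(real^'n::finite) set"
  assumes \<Omega>: "open \<Omega>" "bounded \<Omega>" and \<epsilon>: "0 < \<epsilon>"
  obtains g :: "nat \<Rightarrow> 'n l2" and N where
    "\<And>v. v \<in> H10 \<Omega> \<Longrightarrow> (norm v)\<^sup>2 \<le> \<epsilon> * (\<Sum>i\<in>UNIV. (norm (weak_partial \<Omega> i v))\<^sup>2) + (\<Sum>j<N. (v \<bullet> g j)\<^sup>2)"
proof -
  obtain g :: "nat \<Rightarrow> 'n l2" and N where g: "\<And>f. C1_compact f \<Longrightarrow> {x. f x \<noteq> 0} \<subseteq> \<Omega> \<Longrightarrow>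
      (norm (of_fun f))\<^sup>2 \<le> \<epsilon> * (\<Sum>i\<in>UNIV. (norm (of_fun (partial i f)))\<^sup>2) + (\<Sum>j<N. (of_fun f \<bullet> g j)\<^sup>2)"
    by (rule friedrichs_inequality[OF \<Omega>(2) \<epsilon>]) blast
  show thesis
  proof
    fix v assume v: "v \<in> H10 \<Omega>"
    obtain \<phi> where \<phi>: "\<And>k. \<phi> k \<in> test_functions \<Omega>" "(\<lambda>k. of_fun (\<phi> k)) \<longlonglongrightarrow> v"
      "\<And>i. (\<lambda>k. of_fun (partial i (\<phi> k))) \<longlonglongrightarrow> weak_partial \<Omega> i v"
      by (rule H10_approximation[OF \<Omega>(1) v]) blast
    show "(norm v)\<^sup>2 \<le> \<epsilon> * (\<Sum>i\<in>UNIV. (norm (weak_partial \<Omega> i v))\<^sup>2) + (\<Sum>j<N. (v \<bullet> g j)\<^sup>2)"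
    proof (rule LIMSEQ_le)
      show "(\<lambda>k. (norm (of_fun (\<phi> k)))\<^sup>2) \<longlonglongrightarrow> (norm v)\<^sup>2" by (intro tendsto_intros \<phi>)
      show "(\<lambda>k. \<epsilon> * (\<Sum>i\<in>UNIV. (norm (of_fun (partial i (\<phi> k))))\<^sup>2) + (\<Sum>j<N. (of_fun (\<phi> k) \<bullet> g j)\<^sup>2))
          \<longlonglongrightarrow> \<epsilon> * (\<Sum>i\<in>UNIV. (norm (weak_partial \<Omega> i v))\<^sup>2) + (\<Sum>j<N. (v \<bullet> g j)\<^sup>2)"
        by (intro tendsto_intros \<phi>)
      have "{x. \<phi> k x \<noteq> 0} \<subseteq> \<Omega>" for k
        using \<phi>(1)[of k] closure_subset[of "{x. \<phi> k x \<noteq> 0}"] unfolding test_functions_def by blast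
      then show "\<exists>K. \<forall>k\<ge>K. (norm (of_fun (\<phi> k)))\<^sup>2
          \<le> \<epsilon> * (\<Sum>i\<in>UNIV. (norm (of_fun (partial i (\<phi> k))))\<^sup>2) + (\<Sum>j<N. (of_fun (\<phi> k) \<bullet> g j)\<^sup>2)"
        using g[OF test_function_C1_compact[OF \<phi>(1)]] by blast
    qed
  qed
qed

text \<open>Ellipticity is integrated over \<Omega>. The leading integrand must be shown integrable,
  because otherwise its integral would be 0 by convention; this follows from coefficients bounded on
  the compact closure. The lower-order integral is nonnegative in any case.\<close>

lemma energy_form_coercive:
  fixes \<Omega> :: "(real^'n::finite) set"
  assumes \<Omega>: "open \<Omega>" "bounded \<Omega>" and ell: "elliptic_coefficients \<Omega> \<A> a0"
  obtains c where "0 < c" "\<And>v. v \<in> H10 \<Omega> \<Longrightarrow> c * (\<Sum>i\<in>UNIV. (norm (weak_partial \<Omega> i v))\<^sup>2) \<le> energy_form \<Omega> \<A> a0 v v"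
proof -
  obtain U where U: "closure \<Omega> \<subseteq> U" "\<And>i j. smooth_on U (\<lambda>x. \<A> x $ i $ j)" and
    a0: "\<And>x. x \<in> \<Omega> \<Longrightarrow> 0 \<le> a0 x"
    using ell unfolding elliptic_coefficients_def by blast
  obtain c where c: "0 < c" "\<And>x \<xi>. x \<in> \<Omega> \<Longrightarrow> c * (norm \<xi>)\<^sup>2 \<le> (\<A> x *v \<xi>) \<bullet> \<xi>"
    using ell unfolding elliptic_coefficients_def by blast
  have cont: "continuous_on (closure \<Omega>) (\<lambda>x. \<A> x $ i $ j)" for i j
    using smooth_on_imp_continuous_on[OF U(2)] U(1) by (rule continuous_on_subset)
  have Am [measurable]: "(\<lambda>x. indicator \<Omega> x * \<A> x $ i $ j) \<in> borel_measurable borel" for i j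
    using borel_measurable_continuous_on_indicator[of \<Omega> "\<lambda>x. \<A> x $ i $ j"] \<Omega>(1)
      continuous_on_subset[OF cont closure_subset] by simp
  have Ab: "\<exists>M. \<forall>x. \<bar>indicator \<Omega> x * \<A> x $ i $ j\<bar> \<le> M" for i j
  proof -
    have "bounded ((\<lambda>x. \<A> x $ i $ j) ` closure \<Omega>)"
      using \<Omega>(2) by (intro compact_imp_bounded compact_continuous_image cont) (simp add: compact_closure)
    then obtain M where M: "\<forall>x\<in>closure \<Omega>. \<bar>\<A> x $ i $ j\<bar> \<le> M" by (auto simp: bounded_iff)
    have "\<bar>indicator \<Omega> x * \<A> x $ i $ j\<bar> \<le> max M 0" for x
    proof (cases "x \<in> \<Omega>")
      case True
      then have "\<bar>\<A> x $ i $ j\<bar> \<le> M" using M closure_subset by blast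
      then show ?thesis using True by simp
    qed simp
    then show ?thesis by blast
  qed
  show thesis
  proof
    show "0 < c" by (rule c)
    fix v assume v: "v \<in> H10 \<Omega>"
    define p where "p i = weak_partial \<Omega> i v" for i
    have pL: "p i \<in> L2 \<Omega>" for i
      using sobolev_weak_partial[OF \<Omega>(1), of v i] v by (simp add: H10_def has_weak_derivative_def p_def)
    have pp: "integrable lborel (\<lambda>x. fun_of (p j) x * fun_of (p i) x)" for i j
      by (intro integrable_mult_square_integrable square_integrable_fun_of)
    have "integrable lborel (\<lambda>x. (indicator \<Omega> x * \<A> x $ i $ j) * (fun_of (p j) x * fun_of (p i) x))" for i j
    proof -
      obtain M where M: "\<And>x. \<bar>indicator \<Omega> x * \<A> x $ i $ j\<bar> \<le> M" using Ab by blast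
      show ?thesis
      proof (rule Bochner_Integration.integrable_bound[OF integrable_mult_right[OF pp[of j i], of M]])
        show "AE x in lborel. norm ((indicator \<Omega> x * \<A> x $ i $ j) * (fun_of (p j) x * fun_of (p i) x))
            \<le> norm (M * (fun_of (p j) x * fun_of (p i) x))"
        proof (rule AE_I2)
          fix x
          have "\<bar>indicator \<Omega> x * \<A> x $ i $ j\<bar> * \<bar>fun_of (p j) x * fun_of (p i) x\<bar> \<le> \<bar>M\<bar> * \<bar>fun_of (p j) x * fun_of (p i) x\<bar>"
            by (intro mult_right_mono order_trans[OF M abs_ge_self]) simp
          then show "norm ((indicator \<Omega> x * \<A> x $ i $ j) * (fun_of (p j) x * fun_of (p i) x))
              \<le> norm (M * (fun_of (p j) x * fun_of (p i) x))"
            by (simp only: real_norm_def abs_mult)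
        qed
      qed measurable
    qed
    then have "integrable lborel (\<lambda>x. \<Sum>i\<in>UNIV. \<Sum>j\<in>UNIV. (indicator \<Omega> x * \<A> x $ i $ j) * (fun_of (p j) x * fun_of (p i) x))"
      by (intro Bochner_Integration.integrable_sum)
    moreover have "(\<Sum>i\<in>UNIV. \<Sum>j\<in>UNIV. (indicator \<Omega> x * \<A> x $ i $ j) * (fun_of (p j) x * fun_of (p i) x))
        = indicator \<Omega> x *\<^sub>R ((\<A> x *v weak_grad \<Omega> v x) \<bullet> weak_grad \<Omega> v x)" for x
      by (simp add: inner_vec_def matrix_vector_mult_def weak_grad_def p_def sum_distrib_left sum_distrib_right mult_ac)
    ultimately have int: "integrable lborel (\<lambda>x. indicator \<Omega> x *\<^sub>R ((\<A> x *v weak_grad \<Omega> v x) \<bullet> weak_grad \<Omega> v x))" by simp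
    have p2: "integrable lborel (\<lambda>x. (fun_of (p i) x)\<^sup>2)" for i
      using square_integrable_fun_of[of "p i"] by (simp add: square_integrable_def)
    have "c * (\<Sum>i\<in>UNIV. (norm (p i))\<^sup>2) = (LINT x|lborel. c * (\<Sum>i\<in>UNIV. (fun_of (p i) x)\<^sup>2))"
      unfolding norm_l2_square by (simp add: p2)
    also have "\<dots> \<le> (LINT x|lborel. indicator \<Omega> x *\<^sub>R ((\<A> x *v weak_grad \<Omega> v x) \<bullet> weak_grad \<Omega> v x))"
    proof (rule integral_mono_AE[OF _ int])
      show "integrable lborel (\<lambda>x. c * (\<Sum>i\<in>UNIV. (fun_of (p i) x)\<^sup>2))"
        by (intro integrable_mult_right Bochner_Integration.integrable_sum p2)
      \<comment> \<open>The norms on the left integrate over the whole space, the form only over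
        \<Omega>.\<close>
      have "AE x in lborel. \<forall>i. x \<notin> \<Omega> \<longrightarrow> fun_of (p i) x = 0"
        using pL by (subst AE_all_countable) (simp add: L2_def)
      then show "AE x in lborel. c * (\<Sum>i\<in>UNIV. (fun_of (p i) x)\<^sup>2)
          \<le> indicator \<Omega> x *\<^sub>R ((\<A> x *v weak_grad \<Omega> v x) \<bullet> weak_grad \<Omega> v x)"
      proof eventually_elim
        case (elim x)
        have n: "(norm (weak_grad \<Omega> v x))\<^sup>2 = (\<Sum>i\<in>UNIV. (fun_of (p i) x)\<^sup>2)"
          unfolding power2_norm_eq_inner by (simp add: inner_vec_def weak_grad_def p_def power2_eq_square)
        show ?case using c(2)[of x "weak_grad \<Omega> v x"] elim unfolding n by (cases "x \<in> \<Omega>") auto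
      qed
    qed
    also have "\<dots> \<le> energy_form \<Omega> \<A> a0 v v"
    proof -
      have "0 \<le> (LINT x:\<Omega>|lborel. a0 x * fun_of v x * fun_of v x)"
        unfolding set_lebesgue_integral_def using a0
        by (intro Bochner_Integration.integral_nonneg) (auto simp: indicator_def mult.assoc)
      then show ?thesis unfolding energy_form_def by (simp add: set_lebesgue_integral_def)
    qed
    finally show "c * (\<Sum>i\<in>UNIV. (norm (weak_partial \<Omega> i v))\<^sup>2) \<le> energy_form \<Omega> \<A> a0 v v" by (simp add: p_def)
  qed
qed

text \<open>The minimizer and its image under \<open>R\<close> both lie in
  \<open>H10 \<Omega>\<close>, which by the domain equation of the square root means that it lies in
  \<open>elliptic_domain \<Omega>\<close>. The minimum is thus an eigenvalue, and \<open>lam\<close>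
  is the least of these.\<close>

lemma principal_eigenvalue_le_rayleigh_quotient:
  fixes \<Omega> :: "(real^'n::finite) set"
  assumes \<Omega>: "open \<Omega>" "bounded \<Omega>" and ell: "elliptic_coefficients \<Omega> \<A> a0"
    and sq: "positive_sqrt_op (L2 \<Omega>) (elliptic_domain \<Omega>) (elliptic_op \<Omega> \<A> a0) (H10 \<Omega>) R"
    and form: "\<And>v. v \<in> H10 \<Omega> \<Longrightarrow> energy_form \<Omega> \<A> a0 v v = R v \<bullet> R v"
    and lam: "principal_eigenvalue \<Omega> \<A> a0 lam" and v: "v \<in> H10 \<Omega>"
  shows "lam * (norm v)\<^sup>2 \<le> (norm (R v))\<^sup>2"
proof -
  have sa: "self_adjoint_op (L2 \<Omega>) (H10 \<Omega>) R"
    and dom: "elliptic_domain \<Omega> = {v \<in> H10 \<Omega>. R v \<in> H10 \<Omega>}"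
    and RR: "\<And>v. v \<in> elliptic_domain \<Omega> \<Longrightarrow> R (R v) = elliptic_op \<Omega> \<A> a0 v"
    using sq unfolding positive_sqrt_op_def by blast+
  obtain \<phi>0 where \<phi>0: "\<phi>0 \<in> H10 \<Omega>" "\<phi>0 \<noteq> 0"
    using lam dom unfolding principal_eigenvalue_def elliptic_eigenvalue_def by blast
  obtain c where c: "0 < c"
    "\<And>v. v \<in> H10 \<Omega> \<Longrightarrow> c * (\<Sum>i\<in>UNIV. (norm (weak_partial \<Omega> i v))\<^sup>2) \<le> energy_form \<Omega> \<A> a0 v v"
    by (rule energy_form_coercive[OF \<Omega> ell]) blast
  have ineq: "\<exists>(g :: nat \<Rightarrow> 'n l2) N. \<forall>v\<in>H10 \<Omega>. \<kappa> * (norm v)\<^sup>2 \<le> (norm (R v))\<^sup>2 + (\<Sum>j<N. (v \<bullet> g j)\<^sup>2)"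
    if \<kappa>: "0 < \<kappa>" for \<kappa>
  proof -
    \<comment> \<open>With \<open>\<epsilon> = c / \<kappa>\<close> the gradient term becomes, after
      multiplication by \<kappa>, the one bounded by coercivity; the factor \<kappa> on the
      functionals is absorbed as \<open>sqrt \<kappa>\<close>.\<close>
    have "0 < c / \<kappa>" using c \<kappa> by simp
    from friedrichs_inequality_H10[OF \<Omega> this] obtain g :: "nat \<Rightarrow> 'n l2" and N where
      g: "\<And>v. v \<in> H10 \<Omega> \<Longrightarrow> (norm v)\<^sup>2 \<le> c / \<kappa> * (\<Sum>i\<in>UNIV. (norm (weak_partial \<Omega> i v))\<^sup>2) + (\<Sum>j<N. (v \<bullet> g j)\<^sup>2)"
      by blast
    have "\<kappa> * (norm v)\<^sup>2 \<le> (norm (R v))\<^sup>2 + (\<Sum>j<N. (v \<bullet> (sqrt \<kappa> *\<^sub>R g j))\<^sup>2)" if v: "v \<in> H10 \<Omega>" for v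
    proof -
      have "\<kappa> * (norm v)\<^sup>2 \<le> \<kappa> * (c / \<kappa> * (\<Sum>i\<in>UNIV. (norm (weak_partial \<Omega> i v))\<^sup>2) + (\<Sum>j<N. (v \<bullet> g j)\<^sup>2))"
        using g[OF v] \<kappa> by (intro mult_left_mono) auto
      also have "\<dots> = c * (\<Sum>i\<in>UNIV. (norm (weak_partial \<Omega> i v))\<^sup>2) + (\<Sum>j<N. (v \<bullet> (sqrt \<kappa> *\<^sub>R g j))\<^sup>2)"
        using \<kappa> by (simp add: distrib_left power_mult_distrib sum_distrib_left)
      finally show ?thesis using c(2)[OF v] form[OF v] by (simp add: power2_norm_eq_inner)
    qed
    then show ?thesis by (intro exI[of _ "\<lambda>j. sqrt \<kappa> *\<^sub>R g j"] exI[of _ N] ballI)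
  qed
  obtain \<mu> \<phi> where \<phi>: "\<phi> \<in> H10 \<Omega>" "\<phi> \<noteq> 0" "R \<phi> \<in> H10 \<Omega>" "R (R \<phi>) = \<mu> *\<^sub>R \<phi>"
    and \<mu>: "\<And>v. v \<in> H10 \<Omega> \<Longrightarrow> \<mu> * (norm v)\<^sup>2 \<le> (norm (R v))\<^sup>2"
    by (rule rayleigh_quotient_minimum_attained[OF sa complete_L2 \<phi>0 ineq]) (use \<Omega> in auto)
  have "\<phi> \<in> elliptic_domain \<Omega>" using \<phi> dom by blast
  then have "elliptic_eigenvalue \<Omega> \<A> a0 \<mu>"
    using RR \<phi>(2,4) unfolding elliptic_eigenvalue_def by metis
  then have "lam \<le> \<mu>" using lam by (simp add: principal_eigenvalue_def)
  then have "lam * (norm v)\<^sup>2 \<le> \<mu> * (norm v)\<^sup>2" by (intro mult_right_mono) auto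
  also have "\<dots> \<le> (norm (R v))\<^sup>2" by (rule \<mu>[OF v])
  finally show ?thesis .
qed

section \<open>Decay of the first-order discrete energy\<close>

theorem theorem3p3:
  fixes \<Omega> :: "(real^'n::finite) set"
    and \<A> :: "real^'n \<Rightarrow> real^'n^'n" and a0 :: "real^'n \<Rightarrow> real"
    and \<alpha> lam1 \<delta> h :: real and r :: nat
    and sqrtA :: "'n l2 \<Rightarrow> 'n l2"
    and S :: "real \<Rightarrow> 'n l2 set"
    and u0 u1 :: "'n l2" and u u' u'' :: "real \<Rightarrow> 'n l2"
  assumes "convex_polyhedral_domain \<Omega>"
    and "0 < \<alpha>"
    and "elliptic_coefficients \<Omega> \<A> a0"
    and "positive_sqrt_op (L2 \<Omega>) (elliptic_domain \<Omega>) (elliptic_op \<Omega> \<A> a0) (H10 \<Omega>) sqrtA"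
    and "\<forall>v\<in>H10 \<Omega>. \<forall>w\<in>H10 \<Omega>. energy_form \<Omega> \<A> a0 v w = sqrtA v \<bullet> sqrtA w"
    and "principal_eigenvalue \<Omega> \<A> a0 lam1" and "0 < lam1"
    and "2 \<le> r" and "approximating_family \<Omega> r S"
    and "0 < h" and "u0 \<in> S h" and "u1 \<in> S h"
    and "semidiscrete_solution \<Omega> \<A> a0 \<alpha> (S h) u0 u1 u u' u''"
    and "0 < \<delta>" and "\<delta> \<le> 1 / 3 * min \<alpha> (lam1 / (2 * \<alpha>))"
  shows "\<forall>t\<ge>0. energy1 sqrtA (discrete_op \<Omega> \<A> a0 (S h)) u u' t
      \<le> 3 * exp (- 2 * \<delta> * t) * energy1 sqrtA (discrete_op \<Omega> \<A> a0 (S h)) u u' 0"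
proof (intro allI impI)
  fix t :: real assume t: "0 \<le> t"
  have \<Omega>: "open \<Omega>" "bounded \<Omega>"
    using assms(1) polytope_imp_bounded interior_subset bounded_subset
    unfolding convex_polyhedral_domain_def by auto blast
  have form: "energy_form \<Omega> \<A> a0 v w = sqrtA v \<bullet> sqrtA w" if "v \<in> H10 \<Omega>" "w \<in> H10 \<Omega>" for v w
    using assms(5) that by blast
  have sa: "self_adjoint_op (L2 \<Omega>) (H10 \<Omega>) sqrtA" using assms(4) by (simp add: positive_sqrt_op_def)
  obtain b where b: "finite b" "S h = span b" and SH: "S h \<subseteq> H10 \<Omega>"
    using assms(9)[unfolded approximating_family_def, THEN conjunct1, rule_format, OF assms(10)] by auto
  have V: "subspace (S h)" "closed (S h)" using b closed_span_finite by auto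
  have lin: "sqrtA (v + w) = sqrtA v + sqrtA w" "sqrtA (c *\<^sub>R v) = c *\<^sub>R sqrtA v"
    if "v \<in> H10 \<Omega>" "w \<in> H10 \<Omega>" for v w c
    using sa that unfolding self_adjoint_op_def by simp_all
  obtain B where B: "bounded_linear B" "\<And>v. B v \<in> S h"
    "\<And>v w. v \<in> S h \<Longrightarrow> w \<in> S h \<Longrightarrow> B v \<bullet> w = sqrtA v \<bullet> sqrtA w"
  proof (rule discrete_form_operator[OF b, of sqrtA])
    show "sqrtA (v + w) = sqrtA v + sqrtA w" if "v \<in> S h" "w \<in> S h" for v w
      using that SH by (intro lin) auto
    show "sqrtA (c *\<^sub>R v) = c *\<^sub>R sqrtA v" if "v \<in> S h" for v c
      using that SH by (intro lin) auto
  qed blast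
  have formS: "energy_form \<Omega> \<A> a0 v w = B v \<bullet> w" if "v \<in> S h" "w \<in> S h" for v w
    using B(3)[OF that] form[OF subsetD[OF SH that(1)] subsetD[OF SH that(2)]] by simp
  have eqI: "x = y" if "x \<in> S h" "y \<in> S h" "\<And>\<psi>. \<psi> \<in> S h \<Longrightarrow> x \<bullet> \<psi> = y \<bullet> \<psi>" for x y
  proof -
    have "(x - y) \<bullet> (x - y) = 0"
      using that(3)[OF subspace_diff[OF V(1) that(1,2)]] by (simp add: inner_diff_left)
    then show ?thesis by simp
  qed
  have Ah: "discrete_op \<Omega> \<A> a0 (S h) v = B v" if v: "v \<in> S h" for v
    unfolding discrete_op_def
  proof (rule the_equality)
    show *: "B v \<in> S h \<and> (\<forall>\<psi>\<in>S h. B v \<bullet> \<psi> = energy_form \<Omega> \<A> a0 v \<psi>)"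
      using B(2) v formS by simp
    show "w = B v" if "w \<in> S h \<and> (\<forall>\<psi>\<in>S h. w \<bullet> \<psi> = energy_form \<Omega> \<A> a0 v \<psi>)" for w
      using that B(2) formS[OF v] by (intro eqI) auto
  qed
  have uV: "\<And>s. 0 \<le> s \<Longrightarrow> u s \<in> S h"
    and du: "\<And>s. 0 \<le> s \<Longrightarrow> (u has_vector_derivative u' s) (at s within {0..})"
    and cu': "continuous_on {0..} u'"
    and du': "\<And>s. 0 < s \<Longrightarrow> (u' has_vector_derivative u'' s) (at s)"
    and weak: "\<And>s \<psi>. 0 < s \<Longrightarrow> \<psi> \<in> S h \<Longrightarrow> u'' s \<bullet> \<psi> + \<alpha> * (u' s \<bullet> \<psi>) + energy_form \<Omega> \<A> a0 (u s) \<psi> = 0"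
    using assms(13) unfolding semidiscrete_solution_def by blast+
  have u'V: "u' s \<in> S h" if s: "0 \<le> s" for s
  proof (rule has_vector_derivative_in_closed_subspace[OF V _ du[OF s]])
    \<comment> \<open>At \<open>s = 0\<close> the derivative is one-sided; the right neighbourhood
      keeps the filter nontrivial.\<close>
    show "at s within {0..} \<noteq> bot"
    proof
      assume "at s within {0..} = bot"
      moreover have "{s<..} \<subseteq> {0..}" using s by (intro subsetI) simp
      ultimately have "at_right s \<le> bot" using at_le[of "{s<..}" "{0..}" s] by simp
      then show False using trivial_limit_at_right_real[of s] by (simp add: bot_unique)
    qed
  qed (use uV s in auto)
  have u''V: "u'' s \<in> S h" if s: "0 < s" for s
    using has_vector_derivative_in_closed_subspace[OF V, of "{0<..}" u' "u'' s" s] u'V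
      has_vector_derivative_at_within[OF du'[OF s]] s
    by (auto simp: at_within_open[of s "{0<..}"])
  \<comment> \<open>The variational equation becomes an equation of vectors, since both sides lie in
    the space of test vectors.\<close>
  have eq: "u'' s = - \<alpha> *\<^sub>R u' s - B (u s)" if s: "0 < s" for s
  proof (rule eqI)
    show "u'' s \<in> S h" by (rule u''V[OF s])
    show "- \<alpha> *\<^sub>R u' s - B (u s) \<in> S h"
      using s by (intro subspace_diff subspace_scale V B u'V) simp
    fix \<psi> assume \<psi>: "\<psi> \<in> S h"
    show "u'' s \<bullet> \<psi> = (- \<alpha> *\<^sub>R u' s - B (u s)) \<bullet> \<psi>"
      using weak[OF s \<psi>] formS[OF uV \<psi>, of s] s by (simp add: inner_diff_left)
  qed
  have coer: "lam1 * (norm v)\<^sup>2 \<le> B v \<bullet> v" if v: "v \<in> S h" for v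
    using principal_eigenvalue_le_rayleigh_quotient[OF \<Omega> assms(3,4) form assms(6), of v] v SH
    by (auto simp: B power2_norm_eq_inner)
  have sym: "B v \<bullet> w = v \<bullet> B w" if "v \<in> S h" "w \<in> S h" for v w
    using B(3)[OF that] B(3)[OF that(2,1)] by (simp add: inner_commute)
  \<comment> \<open>On the discrete space the squared norm of \<open>sqrtA (u' s)\<close> is
    \<open>B (u' s) \<bullet> u' s\<close>, so the energy is half the quantity estimated in
    \<open>damped_wave_energy_decay\<close>.\<close>
  have E: "energy1 sqrtA (discrete_op \<Omega> \<A> a0 (S h)) u u' s = 1 / 2 * (B (u' s) \<bullet> u' s + (norm (B (u s)))\<^sup>2)"
    if "0 \<le> s" for s
    using that by (simp add: energy1_def Ah uV u'V B power2_norm_eq_inner)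
  show "energy1 sqrtA (discrete_op \<Omega> \<A> a0 (S h)) u u' t
      \<le> 3 * exp (- 2 * \<delta> * t) * energy1 sqrtA (discrete_op \<Omega> \<A> a0 (S h)) u u' 0"
    using damped_wave_energy_decay[OF V(1) B(1) B(2) sym coer assms(7,2,14,15) uV u'V du cu' du' eq t]
    unfolding E[OF t] E[OF order_refl] by simp
qed

end
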